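(* Let $M$ be a compact smooth manifold of dimension $d\ge1$ that is Hausdorff, connected and without boundary, and let $1\le r\le\infty$. Then the Polish group $\mathrm{Diff}^r(M)$ admits a non-essentially countable orbit equivalence relation; that is, there is a Borel action of $\mathrm{Diff}^r(M)$ on some standard Borel space whose orbit equivalence relation is not essentially countable.
   Context: $\mathrm{Diff}^r(M)$ is the group of all $C^r$-diffeomorphisms of $M$ onto itself, a Polish group with the compact-open $C^r$-topology. A Borel action of a Polish group $G$ on a standard Borel space $(X,\mathcal{B})$ is a jointly Borel map $G\times X\to X$, $(g,x)\mapsto T_g(x)$, with $T_e=\mathrm{Id}_X$ and $T_g\circ T_h=T_{gh}$ for all $g,h\in G$; its orbit equivalence relation is $\{(x,T_g(x)):x\in X,\,g\in G\}\subset X\times X$. An equivalence relation on a standard Borel space $X$ is Borel if it is a Borel subset of $X\times X$, and countable if all its classes are countable. A Borel reduction of an equivalence relation $E$ on $X$ into an equivalence relation $F$ on $Y$ is a Borel function $f:X\to Y$ with $(x,x')\in E\iff(f(x),f(x'))\in F$ for all $x,x'\in X$. An equivalence relation is essentially countable if it admits a Borel reduction into a countable Borel equivalence relation (on a standard Borel space). *)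

theory Defs
  imports
    "HOL-Analysis.Analysis"
    "HOL-Algebra.Bij"
    "HOL-Algebra.Group_Action"
    "HOL-Library.Extended_Nat"
begin

section \<open>Smooth manifolds\<close>

text \<open>
  Functions between Euclidean spaces are total here, but all notions below are applied on open sets
  \<open>U\<close> and depend only on the values there. A function is \<open>C\<^sup>k\<^sup>+\<^sup>1\<close> on \<open>U\<close> iff it is (Frechet) differentiable
  there and all its directional derivatives are \<open>C\<^sup>k\<close> on \<open>U\<close>.
\<close>

primrec Ck_on :: "nat \<Rightarrow> 'e::euclidean_space set \<Rightarrow> ('e \<Rightarrow> 'f::euclidean_space) \<Rightarrow> bool" where
  "Ck_on 0 U f \<longleftrightarrow> continuous_on U f"
| "Ck_on (Suc k) U f \<longleftrightarrow>
     (\<forall>x\<in>U. f differentiable (at x)) \<and> (\<forall>v. Ck_on k U (\<lambda>x. frechet_derivative f (at x) v))"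

definition Cr_on :: "enat \<Rightarrow> 'e::euclidean_space set \<Rightarrow> ('e \<Rightarrow> 'f::euclidean_space) \<Rightarrow> bool" where
  "Cr_on r U f \<longleftrightarrow> (\<forall>k. enat k \<le> r \<longrightarrow> Ck_on k U f)"

text \<open>
  A chart \<open>(U, \<phi>)\<close> is a homeomorphism \<open>\<phi>\<close> from an open set \<open>U\<close> onto an open subset of the Euclidean
  space \<open>'e\<close>; the values of \<open>\<phi>\<close> outside \<open>U\<close> are irrelevant.
\<close>

type_synonym ('a, 'e) chart = "'a set \<times> ('a \<Rightarrow> 'e)"

definition is_chart :: "'a topology \<Rightarrow> ('a, 'e::euclidean_space) chart \<Rightarrow> bool" where
  "is_chart M = (\<lambda>(U, \<phi>). openin M U \<and> open (\<phi> ` U) \<and>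
     homeomorphic_map (subtopology M U) (top_of_set (\<phi> ` U)) \<phi>)"

text \<open>
  The atlas \<open>A\<close> need not be maximal: it determines the smooth structure, and the notions of
  \<open>C\<^sup>r\<close>-diffeomorphism and the \<open>C\<^sup>r\<close>-topology below depend on that structure only. There is no boundary
  because charts have open image in \<open>'e\<close>; the dimension is \<open>DIM('e)\<close>, which is always at least 1.
\<close>

definition smooth_atlas :: "'a topology \<Rightarrow> ('a, 'e::euclidean_space) chart set \<Rightarrow> bool" where
  "smooth_atlas M A \<longleftrightarrow>
     (\<forall>c\<in>A. is_chart M c) \<and>
     (\<Union>(U, \<phi>)\<in>A. U) = topspace M \<and>
     (\<forall>(U, \<phi>)\<in>A. \<forall>(V, \<psi>)\<in>A. Cr_on \<infinity> (\<phi> ` (U \<inter> V)) (\<psi> \<circ> inv_into U \<phi>))"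

section \<open>The group of diffeomorphisms and its topology\<close>

definition in_charts ::
    "('a, 'e::euclidean_space) chart \<Rightarrow> ('a, 'e) chart \<Rightarrow> ('a \<Rightarrow> 'a) \<Rightarrow> 'e \<Rightarrow> 'e" where
  "in_charts = (\<lambda>(U, \<phi>) (V, \<psi>) f. \<psi> \<circ> f \<circ> inv_into U \<phi>)"

definition Cr_map ::
    "enat \<Rightarrow> 'a topology \<Rightarrow> ('a, 'e::euclidean_space) chart set \<Rightarrow> ('a \<Rightarrow> 'a) \<Rightarrow> bool" where
  "Cr_map r M A f \<longleftrightarrow> continuous_map M M f \<and>
     (\<forall>(U, \<phi>)\<in>A. \<forall>(V, \<psi>)\<in>A. Cr_on r (\<phi> ` (U \<inter> f -` V)) (in_charts (U, \<phi>) (V, \<psi>) f))"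

definition Diffeo ::
    "enat \<Rightarrow> 'a topology \<Rightarrow> ('a, 'e::euclidean_space) chart set \<Rightarrow> ('a \<Rightarrow> 'a) set" where
  "Diffeo r M A =
     {f \<in> Bij (topspace M). Cr_map r M A f \<and> Cr_map r M A (inv_into (topspace M) f)}"

definition Diff_group ::
    "enat \<Rightarrow> 'a topology \<Rightarrow> ('a, 'e::euclidean_space) chart set \<Rightarrow> ('a \<Rightarrow> 'a) monoid" where
  "Diff_group r M A = BijGroup (topspace M) \<lparr>carrier := Diffeo r M A\<rparr>"

text \<open>\<open>iter_deriv [v\<^sub>1, \<dots>, v\<^sub>k] f x\<close> is the value of the \<open>k\<close>-th derivative of \<open>f\<close> at \<open>x\<close>, a \<open>k\<close>-linear
  map, on \<open>(v\<^sub>k, \<dots>, v\<^sub>1)\<close>.\<close>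

primrec iter_deriv ::
    "'e::euclidean_space list \<Rightarrow> ('e \<Rightarrow> 'f::euclidean_space) \<Rightarrow> 'e \<Rightarrow> 'f" where
  "iter_deriv [] f = f"
| "iter_deriv (v # vs) f = iter_deriv vs (\<lambda>x. frechet_derivative f (at x) v)"

text \<open>
  The usual subbasic sets of the compact-open \<open>C\<^sup>r\<close>-topology: given \<open>f\<close>, charts \<open>(U, \<phi>)\<close> and
  \<open>(V, \<psi>)\<close>, a compact \<open>K \<subseteq> U\<close> with \<open>f K \<subseteq> V\<close>, a finite order \<open>k \<le> r\<close> and \<open>\<epsilon> > 0\<close>, all \<open>g\<close> with
  \<open>g K \<subseteq> V\<close> whose derivatives up to order \<open>k\<close>, read in the charts, are \<open>\<epsilon>\<close>-close to those of \<open>f\<close>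
  at each point of \<open>\<phi> K\<close>. By compactness of the unit ball, the condition on vectors of norm at most 1
  says that the operator norm of the difference of the derivatives is less than \<open>\<epsilon>\<close>.
\<close>

definition Cr_nhd ::
    "enat \<Rightarrow> 'a topology \<Rightarrow> ('a, 'e::euclidean_space) chart set \<Rightarrow> ('a \<Rightarrow> 'a) \<Rightarrow>
     ('a, 'e) chart \<Rightarrow> ('a, 'e) chart \<Rightarrow> 'a set \<Rightarrow> nat \<Rightarrow> real \<Rightarrow> ('a \<Rightarrow> 'a) set" where
  "Cr_nhd r M A f c c' K k \<epsilon> =
     {g \<in> Diffeo r M A. g ` K \<subseteq> fst c' \<and>
        (\<forall>x \<in> snd c ` K. \<forall>vs. length vs \<le> k \<and> (\<forall>v \<in> set vs. norm v \<le> 1) \<longrightarrow>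
           norm (iter_deriv vs (in_charts c c' g) x - iter_deriv vs (in_charts c c' f) x) < \<epsilon>)}"

definition Diff_topology ::
    "enat \<Rightarrow> 'a topology \<Rightarrow> ('a, 'e::euclidean_space) chart set \<Rightarrow> ('a \<Rightarrow> 'a) topology" where
  "Diff_topology r M A = topology_generated_by (insert (Diffeo r M A)
     {Cr_nhd r M A f c c' K k \<epsilon> | f c c' K k \<epsilon>.
        f \<in> Diffeo r M A \<and> c \<in> A \<and> c' \<in> A \<and> compactin M K \<and> K \<subseteq> fst c \<and> f ` K \<subseteq> fst c' \<and>
        enat k \<le> r \<and> \<epsilon> > 0})"

lemma topspace_Diff_topology: "topspace (Diff_topology r M A) = carrier (Diff_group r M A)"
  by (auto simp: Diff_topology_def Diff_group_def Cr_nhd_def)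

section \<open>Standard Borel spaces and Borel actions\<close>

definition borel_of :: "'a topology \<Rightarrow> 'a measure" where
  "borel_of T = sigma (topspace T) {U. openin T U}"

definition standard_borel :: "'a measure \<Rightarrow> bool" where
  "standard_borel S \<longleftrightarrow>
     (\<exists>T. completely_metrizable_space T \<and> second_countable T \<and>
          space S = topspace T \<and> sets S = sets (borel_of T))"

lemma space_borel_of [simp]: "space (borel_of T) = topspace T"
  unfolding borel_of_def by (rule space_measure_of) (use openin_subset in blast)

lemma continuous_map_measurable:
  assumes "continuous_map T T' f"
  shows "f \<in> measurable (borel_of T) (borel_of T')"
  unfolding borel_of_def[of T']
proof (rule measurable_measure_of)
    show "{U. openin T' U} \<subseteq> Pow (topspace T')"
      using openin_subset by blast
    show "f \<in> space (borel_of T) \<rightarrow> topspace T'"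
      using assms by (auto simp: continuous_map_def)
    fix U assume "U \<in> {U. openin T' U}"
    then have "openin T {x \<in> topspace T. f x \<in> U}"
      using assms by (auto simp: continuous_map_def)
    moreover have "f -` U \<inter> space (borel_of T) = {x \<in> topspace T. f x \<in> U}" by auto
    moreover have "V \<in> sets (borel_of T)" if "openin T V" for V
      unfolding borel_of_def by (rule in_measure_of) (use that openin_subset in blast)+
    ultimately show "f -` U \<inter> space (borel_of T) \<in> sets (borel_of T)"
      by simp
qed

lemma second_countable_Hausdorff_inj_real:
  assumes "second_countable T" "Hausdorff_space T"
  shows "\<exists>j :: 'a \<Rightarrow> real. inj_on j (topspace T)"
proof -
  obtain B where B: "countable B"
    "\<And>U x. openin T U \<Longrightarrow> x \<in> U \<Longrightarrow> \<exists>V\<in>B. x \<in> V \<and> V \<subseteq> U"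
    using assms(1) unfolding second_countable_def by metis
  let ?h = "\<lambda>x. to_nat_on B ` {V \<in> B. x \<in> V}"
  have inj: "inj_on ?h (topspace T)"
  proof (rule inj_onI, rule ccontr)
    fix x y assume xy: "x \<in> topspace T" "y \<in> topspace T" "?h x = ?h y" "x \<noteq> y"
    then have eq: "{V \<in> B. x \<in> V} = {V \<in> B. y \<in> V}"
      using inj_on_image_eq_iff[OF inj_on_to_nat_on[OF B(1)], of "{V \<in> B. x \<in> V}" "{V \<in> B. y \<in> V}"]
      by auto
    obtain U V where "openin T U" "openin T V" "x \<in> U" "y \<in> V" "disjnt U V"
      using assms(2) xy unfolding Hausdorff_space_def by metis
    then obtain W where "W \<in> B" "x \<in> W" "W \<subseteq> U" using B(2) by meson
    then have "y \<in> W" using eq by blast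
    with \<open>W \<subseteq> U\<close> \<open>y \<in> V\<close> \<open>disjnt U V\<close> show False by (auto simp: disjnt_def)
  qed
  obtain k :: "nat set \<Rightarrow> real" where "inj k"
    using nat_sets_eqpoll_reals unfolding eqpoll_def bij_betw_def by blast
  then have "inj_on (k \<circ> ?h) (topspace T)"
    using inj by (meson comp_inj_on inj_on_subset subset_UNIV)
  then show ?thesis by blast
qed

lemma standard_borel_real_copy:
  fixes S :: "'x measure"
  assumes "standard_borel S"
  shows "\<exists>(R :: real measure) h h'. standard_borel R \<and>
    h \<in> measurable S R \<and> h' \<in> measurable R S \<and>
    (\<forall>x\<in>space S. h' (h x) = x) \<and> (\<forall>y\<in>space R. h (h' y) = y)"
proof -
  obtain T where T: "completely_metrizable_space T" "second_countable T"
    "space S = topspace T" "sets S = sets (borel_of T)"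
    using assms unfolding standard_borel_def by blast
  have "Hausdorff_space T"
    using T(1) completely_metrizable_imp_metrizable_space metrizable_imp_Hausdorff_space by blast
  then obtain j :: "'x \<Rightarrow> real" where j: "inj_on j (topspace T)"
    using second_countable_Hausdorff_inj_real T(2) by blast
  define i where "i = inv_into (topspace T) j"
  define T' where "T' = pullback_topology (j ` topspace T) i T"
  have ij: "i (j x) = x" if "x \<in> topspace T" for x
    using that j by (simp add: i_def)
  have ji: "j (i y) = y" "i y \<in> topspace T" if "y \<in> j ` topspace T" for y
    using that by (auto simp: i_def f_inv_into_f inv_into_into)
  have top': "topspace T' = j ` topspace T"
    using ji(2) by (auto simp: T'_def topspace_pullback_topology)
  have ci: "continuous_map T' T i"
    unfolding continuous_map_def
  proof (intro conjI allI impI)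
    show "i \<in> topspace T' \<rightarrow> topspace T" using ji(2) top' by auto
    fix U assume "openin T U"
    moreover have "{y \<in> topspace T'. i y \<in> U} = i -` U \<inter> j ` topspace T" using top' by auto
    ultimately show "openin T' {y \<in> topspace T'. i y \<in> U}"
      by (auto simp: T'_def openin_pullback_topology)
  qed
  have cj: "continuous_map T T' j"
    unfolding continuous_map_def
  proof (intro conjI allI impI)
    show "j \<in> topspace T \<rightarrow> topspace T'" using top' by auto
    fix W assume "openin T' W"
    then obtain U where U: "openin T U" "W = i -` U \<inter> j ` topspace T"
      by (auto simp: T'_def openin_pullback_topology)
    have "{x \<in> topspace T. j x \<in> W} = {x \<in> topspace T. i (j x) \<in> U}"
      by (auto simp: U(2))
    also have "\<dots> = U"
      using openin_subset[OF U(1)] by (auto simp: ij)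
    finally have "{x \<in> topspace T. j x \<in> W} = U" .
    with U show "openin T {x \<in> topspace T. j x \<in> W}" by simp
  qed
  have "homeomorphic_maps T T' j i"
    using ci cj by (simp add: homeomorphic_maps_def ij ji(1) top')
  then have hom: "T homeomorphic_space T'"
    unfolding homeomorphic_space_def by blast
  have "standard_borel (borel_of T')"
    unfolding standard_borel_def
    using T(1,2) homeomorphic_completely_metrizable_space[OF hom]
      homeomorphic_space_second_countability[OF hom] by (intro exI[of _ T']) simp
  moreover have "j \<in> measurable S (borel_of T')" "i \<in> measurable (borel_of T') S"
    using continuous_map_measurable[OF cj] continuous_map_measurable[OF ci] T(4)
    by (simp_all cong: measurable_cong_sets)
  ultimately show ?thesis
    using ij ji(1) top' T(3) by (intro exI[of _ "borel_of T'"] exI[of _ j] exI[of _ i]) auto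
qed

definition borel_action ::
    "('g, 'b) monoid_scheme \<Rightarrow> 'g topology \<Rightarrow> 'x measure \<Rightarrow> ('g \<Rightarrow> 'x \<Rightarrow> 'x) \<Rightarrow> bool" where
  "borel_action G T S \<alpha> \<longleftrightarrow>
     group_action G (space S) \<alpha> \<and>
     (\<lambda>(g, x). \<alpha> g x) \<in> measurable (borel_of T \<Otimes>\<^sub>M S) S"

definition orbit_relation ::
    "('g, 'b) monoid_scheme \<Rightarrow> 'x set \<Rightarrow> ('g \<Rightarrow> 'x \<Rightarrow> 'x) \<Rightarrow> ('x \<times> 'x) set" where
  "orbit_relation G X \<alpha> = {(x, \<alpha> g x) | x g. x \<in> X \<and> g \<in> carrier G}"

definition countable_borel_equiv :: "'y measure \<Rightarrow> ('y \<times> 'y) set \<Rightarrow> bool" where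
  "countable_borel_equiv Y F \<longleftrightarrow>
     equiv (space Y) F \<and> F \<in> sets (Y \<Otimes>\<^sub>M Y) \<and> (\<forall>y\<in>space Y. countable (F `` {y}))"

definition borel_reduction ::
    "'x measure \<Rightarrow> ('x \<times> 'x) set \<Rightarrow> 'y measure \<Rightarrow> ('y \<times> 'y) set \<Rightarrow> ('x \<Rightarrow> 'y) \<Rightarrow> bool" where
  "borel_reduction X E Y F f \<longleftrightarrow>
     f \<in> measurable X Y \<and> (\<forall>x\<in>space X. \<forall>x'\<in>space X. (x, x') \<in> E \<longleftrightarrow> (f x, f x') \<in> F)"

text \<open>
  HOL cannot quantify over types inside a formula, so standard Borel spaces that are bound by an
  existential quantifier are taken with underlying type \<open>real\<close>. No generality is lost, since every
  standard Borel space is Borel isomorphic to one of this type (\<open>standard_borel_real_copy\<close>); for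
  essential countability, \<open>essentially_countableI\<close> accepts targets of an arbitrary type.
\<close>

definition essentially_countable :: "'x measure \<Rightarrow> ('x \<times> 'x) set \<Rightarrow> bool" where
  "essentially_countable X E \<longleftrightarrow>
     (\<exists>(Y :: real measure) F f.
        standard_borel Y \<and> countable_borel_equiv Y F \<and> borel_reduction X E Y F f)"

lemma essentially_countableI:
  fixes Y :: "'y measure"
  assumes Y: "standard_borel Y" and F: "countable_borel_equiv Y F"
    and f: "borel_reduction X E Y F f"
  shows "essentially_countable X E"
proof -
  obtain R :: "real measure" and h h' where R: "standard_borel R"
    "h \<in> measurable Y R" "h' \<in> measurable R Y"
    "\<And>y. y \<in> space Y \<Longrightarrow> h' (h y) = y" "\<And>z. z \<in> space R \<Longrightarrow> h (h' z) = z"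
    using standard_borel_real_copy[OF Y] by blast
  note sp = measurable_space[OF R(2)] measurable_space[OF R(3)]
  define F' where "F' = {(a, b). a \<in> space R \<and> b \<in> space R \<and> (h' a, h' b) \<in> F}"
  have eqF: "equiv (space Y) F" and mF: "F \<in> sets (Y \<Otimes>\<^sub>M Y)"
    and cF: "\<And>y. y \<in> space Y \<Longrightarrow> countable (F `` {y})"
    using F by (auto simp: countable_borel_equiv_def)
  have "equiv (space R) F'"
  proof (rule equivI)
    show "F' \<subseteq> space R \<times> space R" by (auto simp: F'_def)
    show "refl_on (space R) F'"
      using eqF sp(2) by (auto simp: F'_def refl_on_def equiv_def)
    show "sym F'" using eqF by (auto simp: F'_def equiv_def sym_def)
    show "trans F'" using eqF unfolding F'_def equiv_def trans_def by blast
  qed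
  moreover have "F' \<in> sets (R \<Otimes>\<^sub>M R)"
  proof -
    have "(\<lambda>p. (h' (fst p), h' (snd p))) \<in> measurable (R \<Otimes>\<^sub>M R) (Y \<Otimes>\<^sub>M Y)"
      using R(3) by measurable
    from measurable_sets[OF this mF] show ?thesis
      by (rule back_subst[where P = "\<lambda>A. A \<in> sets (R \<Otimes>\<^sub>M R)"])
         (auto simp: F'_def space_pair_measure)
  qed
  moreover have "countable (F' `` {z})" if "z \<in> space R" for z
  proof (rule countable_subset)
    show "F' `` {z} \<subseteq> h ` (F `` {h' z})"
      using R(5) by (force simp: F'_def)
    show "countable (h ` (F `` {h' z}))"
      using cF[OF sp(2)[OF that]] by simp
  qed
  moreover have "borel_reduction X E R F' (h \<circ> f)"
  proof -
    have fm: "f \<in> measurable X Y" using f by (simp add: borel_reduction_def)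
    have "((h \<circ> f) x, (h \<circ> f) x') \<in> F' \<longleftrightarrow> (f x, f x') \<in> F"
      if "x \<in> space X" "x' \<in> space X" for x x'
      using that measurable_space[OF fm] sp(1) R(4) by (auto simp: F'_def)
    then show ?thesis
      using f measurable_comp[OF fm R(2)] by (simp add: borel_reduction_def)
  qed
  ultimately show ?thesis
    using R(1) unfolding essentially_countable_def countable_borel_equiv_def by blast
qed

end

theory Submission
  imports Defs
begin

text \<open>
  The group acts diagonally on the sequences of points of \<open>M\<close>. Fix a ray from a point \<open>p\<close> of a chart and
  segments on it that shrink geometrically towards \<open>p\<close>, and cut the \<open>n\<close>-th segment into \<open>N n\<close> equal
  steps, where \<open>N\<close> grows very fast. A point \<open>z\<close> of the Baire space chooses one subdivision point in
  each segment, hence a sequence in \<open>M\<close>. Changing every choice by at most one step is effected by a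
  diffeomorphism, whose displacement is a series of bumps with rapidly decreasing derivatives. On the
  other hand, if two choices differ by the full length of infinitely many segments and agree on
  infinitely many others, then no map of class \<open>C\<^sup>1\<close> relates them, by looking at its derivative at \<open>p\<close>.

  Let \<open>f\<close> be a Borel reduction to a countable equivalence relation, read as a function of \<open>z\<close>. The
  one-step moves form two families of commuting involutions, one for each of the two matchings of
  consecutive numbers, and \<open>f\<close> has only countably many values on the orbit of \<open>z\<close> under
  the compact group of all moves of one family. By Baire category, on some cylinder \<open>f\<close> is
  generically invariant under moves of single late coordinates. Such moves connect any two cylinders of
  the same depth, so \<open>f\<close> is generically constant there. Reflecting the odd coordinates preserves comeager
  sets, and therefore \<open>f\<close> takes the same value on two choices that are not related.
\<close>

section \<open>Calculus of C^k functions\<close>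

text \<open>Two demands pull in opposite directions. One diffeomorphism must carry out infinitely
  many moves, so a move must be tiny in every C^k norm; yet finitely many moves of one coordinate
  must add up to something that a first derivative at p sees. Both are met because the n-th segment
  runs from distance R / 4^n to 5/4 of it: its relative length does not depend on n, while its steps
  may be as short as desired. The orbit relation on choices is never computed, only squeezed: it
  contains all simultaneous one-step changes, and it forces the ratios of distances to p to tend to
  1 as soon as infinitely many of them equal 1. Without that proviso a diffeomorphism could rescale
  the ray, which is why the even coordinates are kept fixed. One matching alone never leaves a pair
  {2i, 2i+1}, hence two. Involutions replace translations because they generate a product of groups
  of order two whose every element is a one-step change, so that category applies to the moves
  themselves.\<close>

lemma frechet_derivative_cong_open:
  assumes "open U" "x \<in> U" "\<And>y. y \<in> U \<Longrightarrow> f y = g y"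
  shows "frechet_derivative f (at x) = frechet_derivative g (at x)"
proof -
  have "(f has_derivative D) (at x) \<longleftrightarrow> (g has_derivative D) (at x)" for D
    using has_derivative_transform_within_open[OF _ assms(1,2)] assms(3) by metis
  then show ?thesis unfolding frechet_derivative_def by presburger
qed

lemma Ck_on_cong:
  assumes "open U" "\<And>x. x \<in> U \<Longrightarrow> f x = g x" "Ck_on k U f"
  shows "Ck_on k U g"
  using assms(2,3)
proof (induction k arbitrary: f g)
  case 0
  then show ?case by (metis Ck_on.simps(1) continuous_on_cong)
next
  case (Suc k)
  have "g differentiable (at x)" if "x \<in> U" for x
    using Suc.prems that has_derivative_transform_within_open[OF _ assms(1) that]
    unfolding Ck_on.simps differentiable_def by metis
  moreover have "Ck_on k U (\<lambda>x. frechet_derivative g (at x) v)" for v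
  proof (rule Suc.IH)
    show "frechet_derivative f (at x) v = frechet_derivative g (at x) v" if "x \<in> U" for x
      by (simp add: frechet_derivative_cong_open[OF assms(1) that Suc.prems(1)])
    show "Ck_on k U (\<lambda>x. frechet_derivative f (at x) v)" using Suc.prems by simp
  qed
  ultimately show ?case by simp
qed

text \<open>Introduction rule for the closure lemmas below: the derivative may be given by any
  formula \<open>D\<close>, and the choice hidden in \<open>frechet_derivative\<close>
  disappears.\<close>

lemma Ck_on_SucI:
  assumes "open U" "\<And>x. x \<in> U \<Longrightarrow> (f has_derivative D x) (at x)" "\<And>v. Ck_on k U (\<lambda>x. D x v)"
  shows "Ck_on (Suc k) U f"
proof -
  have "Ck_on k U (\<lambda>x. frechet_derivative f (at x) v)" for v
    by (rule Ck_on_cong[OF assms(1) _ assms(3)[of v]])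
       (simp add: frechet_derivative_at[OF assms(2), symmetric])
  then show ?thesis using assms(2) by (auto simp: differentiable_def)
qed

lemma Ck_on_SucD:
  assumes "Ck_on (Suc k) U f"
  shows "x \<in> U \<Longrightarrow> (f has_derivative frechet_derivative f (at x)) (at x)"
    and "Ck_on k U (\<lambda>x. frechet_derivative f (at x) v)"
proof -
  show "Ck_on k U (\<lambda>x. frechet_derivative f (at x) v)" using assms by simp
  show "(f has_derivative frechet_derivative f (at x)) (at x)" if "x \<in> U"
    using assms that by (simp flip: frechet_derivative_works)
qed

lemma Ck_on_Suc_imp: "Ck_on (Suc k) U f \<Longrightarrow> Ck_on k U f"
proof (induction k arbitrary: f)
  case 0
  then have "f differentiable_on U"
    by (simp add: differentiable_at_imp_differentiable_on)
  then show ?case by (simp add: differentiable_imp_continuous_on)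
next
  case (Suc k)
  then show ?case unfolding Ck_on.simps(2)[of "Suc k" U f] by (simp only: Ck_on.simps(2)[of k U f]) blast
qed

lemma Ck_on_subset: "Ck_on k U f \<Longrightarrow> V \<subseteq> U \<Longrightarrow> Ck_on k V f"
proof (induction k arbitrary: f)
  case (Suc k)
  then show ?case by (simp add: subset_iff)
qed (auto intro: continuous_on_subset)

text \<open>No derivatives have to be patched together, since \<open>frechet_derivative f\<close> is
  one global function. The purpose is to check a map of manifolds near each point in whichever
  charts are convenient.\<close>

lemma Ck_on_local:
  assumes "\<And>x. x \<in> U \<Longrightarrow> \<exists>V. open V \<and> x \<in> V \<and> Ck_on k V f"
  shows "Ck_on k U f"
  using assms
proof (induction k arbitrary: f)
  case 0
  then have "isCont f x" if "x \<in> U" for x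
    using that continuous_on_eq_continuous_at by (metis Ck_on.simps(1))
  then show ?case by (simp add: continuous_at_imp_continuous_on)
next
  case (Suc k)
  have "Ck_on k U (\<lambda>x. frechet_derivative f (at x) v)" for v
    by (rule Suc.IH) (metis Suc.prems Ck_on.simps(2))
  then show ?case using Suc.prems by (metis Ck_on.simps(2))
qed

lemma Ck_on_const: "open U \<Longrightarrow> Ck_on k U (\<lambda>x. c)"
proof (induction k arbitrary: c)
  case (Suc k)
  then show ?case by (intro Ck_on_SucI[where D = "\<lambda>_ _. 0"]) auto
qed auto

lemma Ck_on_bounded_linear:
  assumes "open U" "bounded_linear L"
  shows "Ck_on k U L"
proof (cases k)
  case 0
  then show ?thesis using assms(2) by (simp add: linear_continuous_on)
next
  case (Suc j)
  show ?thesis unfolding Suc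
    by (rule Ck_on_SucI[OF assms(1), where D = "\<lambda>_. L"])
      (auto simp: assms Ck_on_const intro: bounded_linear_imp_has_derivative)
qed

lemma Ck_on_id: "open U \<Longrightarrow> Ck_on k U (\<lambda>x. x)"
  by (rule Ck_on_bounded_linear) auto

lemma Ck_on_linear_comp:
  assumes "open U" "bounded_linear L" "Ck_on k U f"
  shows "Ck_on k U (\<lambda>x. L (f x))"
  using assms(3)
proof (induction k arbitrary: f)
  case 0
  then show ?case using assms(2) by (simp add: bounded_linear.continuous_on)
next
  case (Suc k)
  show ?case
  proof (rule Ck_on_SucI[OF assms(1)])
    show "((\<lambda>x. L (f x)) has_derivative (\<lambda>v. L (frechet_derivative f (at x) v))) (at x)" if "x \<in> U" for x
      using bounded_linear.has_derivative[OF assms(2) Ck_on_SucD(1)[OF Suc.prems that]] .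
  qed (rule Suc.IH[OF Ck_on_SucD(2)[OF Suc.prems]])
qed

lemma Ck_on_add:
  assumes "open U" "Ck_on k U f" "Ck_on k U g"
  shows "Ck_on k U (\<lambda>x. f x + g x)"
  using assms(2,3)
proof (induction k arbitrary: f g)
  case 0
  then show ?case by (simp add: continuous_on_add)
next
  case (Suc k)
  show ?case
  proof (rule Ck_on_SucI[OF assms(1)])
    show "((\<lambda>x. f x + g x) has_derivative
        (\<lambda>v. frechet_derivative f (at x) v + frechet_derivative g (at x) v)) (at x)" if "x \<in> U" for x
      using has_derivative_add[OF Ck_on_SucD(1)[OF Suc.prems(1) that] Ck_on_SucD(1)[OF Suc.prems(2) that]] .
  qed (rule Suc.IH[OF Ck_on_SucD(2) Ck_on_SucD(2), OF Suc.prems])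
qed

lemma Ck_on_sum:
  assumes "open U" "\<And>i. i \<in> I \<Longrightarrow> Ck_on k U (f i)"
  shows "Ck_on k U (\<lambda>x. \<Sum>i\<in>I. f i x)"
  using assms(2)
proof (induction I rule: infinite_finite_induct)
  case (insert i I)
  then show ?case by (simp add: Ck_on_add[OF assms(1)])
qed (simp_all add: Ck_on_const assms(1))

lemma Ck_on_scaleR:
  fixes f :: "'e::euclidean_space \<Rightarrow> real" and g :: "'e \<Rightarrow> 'f::euclidean_space"
  assumes "open U" "Ck_on k U f" "Ck_on k U g"
  shows "Ck_on k U (\<lambda>x. f x *\<^sub>R g x)"
  using assms(2,3)
proof (induction k arbitrary: f g)
  case 0
  then show ?case by (simp add: continuous_on_scaleR)
next
  case (Suc k)
  show ?case
  proof (rule Ck_on_SucI[OF assms(1)])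
    show "((\<lambda>x. f x *\<^sub>R g x) has_derivative
        (\<lambda>v. f x *\<^sub>R frechet_derivative g (at x) v + frechet_derivative f (at x) v *\<^sub>R g x)) (at x)"
      if "x \<in> U" for x
      using has_derivative_scaleR[OF Ck_on_SucD(1)[OF Suc.prems(1) that] Ck_on_SucD(1)[OF Suc.prems(2) that]] .
    show "Ck_on k U (\<lambda>x. f x *\<^sub>R frechet_derivative g (at x) v + frechet_derivative f (at x) v *\<^sub>R g x)" for v
      by (intro Ck_on_add assms(1) Suc.IH) (use Suc.prems Ck_on_SucD(2) Ck_on_Suc_imp in blast)+
  qed
qed

lemma Ck_on_mult:
  fixes f g :: "'e::euclidean_space \<Rightarrow> real"
  assumes "open U" "Ck_on k U f" "Ck_on k U g"
  shows "Ck_on k U (\<lambda>x. f x * g x)"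
  using Ck_on_scaleR[OF assms] by simp

lemma Ck_on_inverse:
  fixes f :: "'e::euclidean_space \<Rightarrow> real"
  assumes "open U" "Ck_on k U f" "\<And>x. x \<in> U \<Longrightarrow> f x \<noteq> 0"
  shows "Ck_on k U (\<lambda>x. inverse (f x))"
  using assms(2)
proof (induction k)
  case 0
  then show ?case using assms(3) by (auto intro: continuous_on_inverse)
next
  case (Suc k)
  have IH: "Ck_on k U (\<lambda>x. inverse (f x))" using Suc Ck_on_Suc_imp by blast
  show ?case
  proof (rule Ck_on_SucI[OF assms(1)])
    show "((\<lambda>x. inverse (f x)) has_derivative
        (\<lambda>v. - 1 * (inverse (f x) * frechet_derivative f (at x) v * inverse (f x)))) (at x)"
      if "x \<in> U" for x
      using Deriv.has_derivative_inverse[OF assms(3)[OF that] Ck_on_SucD(1)[OF Suc.prems that]] by simp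
  qed (intro Ck_on_mult Ck_on_const assms(1) IH Ck_on_SucD(2)[OF Suc.prems])
qed

lemma Ck_on_compose:
  fixes f :: "'e::euclidean_space \<Rightarrow> 'f::euclidean_space" and g :: "'f \<Rightarrow> 'g::euclidean_space"
  assumes "open U" "open V" "f ` U \<subseteq> V" "Ck_on k V g" "Ck_on k U f"
  shows "Ck_on k U (g \<circ> f)"
  using assms(4,5)
proof (induction k arbitrary: g)
  case 0
  then show ?case using assms(3) by (auto intro: continuous_on_compose2)
next
  case (Suc k)
  show ?case
  proof (rule Ck_on_SucI[OF assms(1)])
    fix x assume x: "x \<in> U"
    let ?Df = "frechet_derivative f (at x)" and ?Dg = "frechet_derivative g (at (f x))"
    have g: "(g has_derivative ?Dg) (at (f x))"
      using Ck_on_SucD(1)[OF Suc.prems(1)] x assms(3) by blast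
    then interpret bounded_linear ?Dg by (rule has_derivative_bounded_linear)
    \<comment> \<open>The chain rule applies the derivative of \<open>g\<close> to a vector that
      varies with \<open>x\<close>, while \<open>Ck_on\<close> speaks of fixed directions only.
      Expansion in the basis leaves fixed directions with scalar coefficients.\<close>
    have rep: "?Dg w = (\<Sum>b\<in>Basis. (w \<bullet> b) *\<^sub>R ?Dg b)" for w
    proof -
      have "?Dg w = ?Dg (\<Sum>b\<in>Basis. (w \<bullet> b) *\<^sub>R b)" by (simp add: euclidean_representation)
      then show ?thesis by (simp add: sum scale)
    qed
    have "?Dg \<circ> ?Df = (\<lambda>v. \<Sum>b\<in>Basis. (?Df v \<bullet> b) *\<^sub>R ?Dg b)"
      by (rule ext) (unfold comp_apply, rule rep)
    moreover have "(g \<circ> f has_derivative ?Dg \<circ> ?Df) (at x)"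
      using diff_chain_at[OF Ck_on_SucD(1)[OF Suc.prems(2) x] g] .
    ultimately show "(g \<circ> f has_derivative
       (\<lambda>v. \<Sum>b\<in>Basis. (?Df v \<bullet> b) *\<^sub>R ?Dg b)) (at x)" by simp
  next
    fix v
    have "Ck_on k U (\<lambda>x. frechet_derivative g (at (f x)) b)" for b
      using Suc.IH[OF Ck_on_SucD(2)[OF Suc.prems(1)] Ck_on_Suc_imp[OF Suc.prems(2)]]
      by (simp add: comp_def)
    then show "Ck_on k U (\<lambda>x. \<Sum>b\<in>Basis. (frechet_derivative f (at x) v \<bullet> b) *\<^sub>R frechet_derivative g (at (f x)) b)"
      by (intro Ck_on_sum Ck_on_scaleR assms(1) Ck_on_linear_comp[OF _ bounded_linear_inner_left]
          Ck_on_SucD(2)[OF Suc.prems(2)])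
  qed
qed

text \<open>Bootstrapping: \<open>Q w x\<close> stands for the inverse of the derivative at
  \<open>x\<close>, applied to \<open>w\<close>. Each order of smoothness of \<open>Gi\<close>
  passes to its derivative and so yields the next order.\<close>

lemma Ck_on_inverse_function:
  fixes G :: "'e::euclidean_space \<Rightarrow> 'e"
  assumes "\<And>y. (Gi has_derivative (\<lambda>w. Q w (Gi y))) (at y)" "\<And>k w. Ck_on k UNIV (Q w)"
  shows "Ck_on k UNIV Gi"
proof (induction k)
  case 0
  then show ?case using assms(1) has_derivative_continuous continuous_at_imp_continuous_on
    by (metis Ck_on.simps(1))
next
  case (Suc k)
  have "Ck_on k UNIV (Q w \<circ> Gi)" for w
    by (rule Ck_on_compose[OF open_UNIV open_UNIV _ assms(2) Suc]) simp
  then show ?case using assms(1) by (intro Ck_on_SucI) (auto simp: comp_def)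
qed

section \<open>The flat function exp (- 1 / t) and smooth bumps\<close>

definition flat :: "nat \<Rightarrow> real \<Rightarrow> real" where
  "flat m t = (if t \<le> 0 then 0 else exp (- inverse t) * inverse t ^ m)"

lemma flat_tendsto_0: "(flat m \<longlongrightarrow> 0) (at_right 0)"
proof -
  have "((\<lambda>y::real. y ^ m / exp y) \<longlongrightarrow> 0) at_top" by (rule tendsto_power_div_exp_0)
  then have "((\<lambda>t::real. inverse t ^ m / exp (inverse t)) \<longlongrightarrow> 0) (at_right 0)"
    by (rule filterlim_compose[OF _ filterlim_inverse_at_top_right])
  then show ?thesis
  proof (rule Lim_transform_eventually)
    show "\<forall>\<^sub>F t in at_right 0. inverse t ^ m / exp (inverse t) = flat m t"
      unfolding eventually_at_filter
      by (rule always_eventually) (auto simp: flat_def exp_minus field_simps)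
  qed
qed

text \<open>The index \<open>m\<close> makes the family closed under differentiation up to linear
  combinations, so that one induction gives smoothness of all members. At 0, the difference quotient
  of \<open>flat m\<close> is \<open>flat (m + 1)\<close>, which tends to 0.\<close>

lemma flat_DERIV: "(flat m has_real_derivative (flat (m + 2) t - real m * flat (m + 1) t)) (at t)"
proof -
  consider "t < 0" | "t > 0" | "t = 0" by linarith
  then show ?thesis
  proof cases
    case 1
    have "((\<lambda>_. 0) has_real_derivative 0) (at t)" by simp
    then have "(flat m has_real_derivative 0) (at t)"
      by (rule has_field_derivative_transform_within_open[where S = "{..<0}"]) (use 1 in \<open>auto simp: flat_def\<close>)
    then show ?thesis using 1 by (simp add: flat_def)
  next
    case 2
    have "((\<lambda>t. inverse t ^ m) has_real_derivative
        real m * (- (inverse t ^ Suc (Suc 0)) * inverse t ^ (m - Suc 0))) (at t)"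
      using 2 by (intro DERIV_power DERIV_inverse) auto
    moreover have "real m * (- (inverse t ^ Suc (Suc 0)) * inverse t ^ (m - Suc 0)) = - real m * inverse t ^ (m + 1)"
      by (cases m) (auto simp: algebra_simps)
    ultimately have p: "((\<lambda>t. inverse t ^ m) has_real_derivative - real m * inverse t ^ (m + 1)) (at t)"
      by (simp only:)
    have e: "((\<lambda>t. exp (- inverse t)) has_real_derivative exp (- inverse t) * (inverse t * inverse t)) (at t)"
      using 2 by (auto intro!: derivative_eq_intros simp: power2_eq_square)
    have "exp (- inverse t) * (inverse t * inverse t) * inverse t ^ m + (- real m * inverse t ^ (m + 1)) * exp (- inverse t)
        = flat (m + 2) t - real m * flat (m + 1) t"
      using 2 by (simp add: flat_def power_add algebra_simps)
    with DERIV_mult[OF e p] have "((\<lambda>t. exp (- inverse t) * inverse t ^ m) has_real_derivative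
       (flat (m + 2) t - real m * flat (m + 1) t)) (at t)" by simp
    then show ?thesis
      by (rule has_field_derivative_transform_within_open[where S = "{0<..}"]) (use 2 in \<open>auto simp: flat_def\<close>)
  next
    case 3
    have l: "(flat (m + 1) \<longlongrightarrow> 0) (at_left 0)"
      by (rule Lim_transform_eventually[OF tendsto_const])
        (auto simp: eventually_at_filter flat_def intro!: always_eventually)
    have "(flat (m + 1) \<longlongrightarrow> 0) (at 0)"
      using l flat_tendsto_0 by (simp add: filterlim_split_at_real)
    then have "((\<lambda>h. (flat m (0 + h) - flat m 0) / h) \<longlongrightarrow> 0) (at 0)"
      by (rule Lim_transform_eventually)
        (auto simp: eventually_at_filter flat_def divide_inverse intro!: always_eventually)
    then have "(flat m has_real_derivative 0) (at 0)" by (simp add: DERIV_def)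
    then show ?thesis using 3 by (simp add: flat_def)
  qed
qed

lemma Ck_on_flat_comp:
  fixes u :: "'e::euclidean_space \<Rightarrow> real"
  assumes "open U" "Ck_on k U u"
  shows "Ck_on k U (\<lambda>x. flat m (u x))"
  using assms(2)
proof (induction k arbitrary: m)
  case 0
  have "continuous_on UNIV (flat m)"
    using flat_DERIV DERIV_isCont continuous_at_imp_continuous_on by blast
  then show ?case using 0 continuous_on_compose2 by fastforce
next
  case (Suc k)
  show ?case
  proof (rule Ck_on_SucI[OF assms(1)])
    show "((\<lambda>x. flat m (u x)) has_derivative
       (\<lambda>v. frechet_derivative u (at x) v * (flat (m + 2) (u x) + (- real m) * flat (m + 1) (u x)))) (at x)"
      if "x \<in> U" for x
      using has_derivative_compose[OF Ck_on_SucD(1)[OF Suc.prems that]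
          flat_DERIV[of m "u x", unfolded has_field_derivative_def]]
      by (simp add: mult.commute)
    show "Ck_on k U (\<lambda>x. frechet_derivative u (at x) v * (flat (m + 2) (u x) + (- real m) * flat (m + 1) (u x)))" for v
      by (intro Ck_on_mult Ck_on_add Ck_on_const assms(1) Suc.IH Ck_on_Suc_imp[OF Suc.prems]
          Ck_on_SucD(2)[OF Suc.prems])
  qed
qed

lemma flat_pos: "t > 0 \<Longrightarrow> flat 0 t > 0"
  by (simp add: flat_def)

lemma flat_mono: "s \<le> t \<Longrightarrow> flat 0 s \<le> flat 0 t"
  by (auto simp: flat_def)

text \<open>\<open>flat\<close> is used twice. The inner function \<open>h\<close> vanishes outside
  radius \<open>2 * \<rho>\<close> and is at least \<open>c\<close> within radius
  \<open>\<rho>\<close>; the outer one cuts it off at \<open>c\<close>, because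
  \<open>flat 0 (c - h)\<close> is 0 when \<open>c \<le> h\<close> and \<open>flat 0 c\<close> when
  \<open>h\<close> is 0.\<close>

lemma bump_exists:
  fixes a :: "'e::euclidean_space"
  assumes "\<rho> > 0"
  obtains \<psi> :: "'e \<Rightarrow> real" where "\<And>k. Ck_on k UNIV \<psi>"
    "\<And>x. dist x a \<le> \<rho> \<Longrightarrow> \<psi> x = 1" "\<And>x. dist x a \<ge> 2 * \<rho> \<Longrightarrow> \<psi> x = 0"
proof
  define c where "c = flat 0 (3 * \<rho>\<^sup>2)"
  have c: "c > 0" using assms by (simp add: c_def flat_pos)
  define h where "h x = flat 0 (4 * \<rho>\<^sup>2 + (-1) * ((x - a) \<bullet> (x - a)))" for x
  define \<psi> where "\<psi> x = 1 + (- inverse (flat 0 c)) * flat 0 (c + (-1) * h x)" for x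
  have n: "(x - a) \<bullet> (x - a) = (dist x a)\<^sup>2" for x
    by (simp add: dist_norm power2_norm_eq_inner)
  show "Ck_on k UNIV \<psi>" for k
  proof -
    have d: "Ck_on k UNIV (\<lambda>x::'e. x - a)"
      using Ck_on_add[OF open_UNIV Ck_on_id Ck_on_const, of k "- a"] by simp
    have "Ck_on k UNIV (\<lambda>x. \<Sum>b\<in>Basis. ((x - a) \<bullet> b) * ((x - a) \<bullet> b))"
      by (intro Ck_on_sum Ck_on_mult open_UNIV Ck_on_linear_comp[OF _ bounded_linear_inner_left] d)
    then have "Ck_on k UNIV (\<lambda>x. (x - a) \<bullet> (x - a))"
      by (subst (asm) euclidean_inner[symmetric])
    then show ?thesis unfolding \<psi>_def h_def
      by (intro Ck_on_add Ck_on_mult Ck_on_const Ck_on_flat_comp open_UNIV)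
  qed
  show "\<psi> x = 1" if "dist x a \<le> \<rho>" for x
  proof -
    have "(dist x a)\<^sup>2 \<le> \<rho>\<^sup>2" using that by (simp add: power_mono)
    then have "c \<le> h x" unfolding c_def h_def n by (intro flat_mono) simp
    then show ?thesis by (simp add: \<psi>_def flat_def)
  qed
  show "\<psi> x = 0" if "dist x a \<ge> 2 * \<rho>" for x
  proof -
    have "(2 * \<rho>)\<^sup>2 \<le> (dist x a)\<^sup>2" using that assms by (intro power_mono) auto
    then have "h x = 0" by (simp add: h_def n flat_def power2_eq_square)
    then show ?thesis using flat_pos[OF c] by (simp add: \<psi>_def)
  qed
qed

section \<open>Iterated derivatives and termwise differentiation of series\<close>

lemma iter_deriv_cong_open:
  assumes "open U" "\<And>x. x \<in> U \<Longrightarrow> f x = g x" "x \<in> U"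
  shows "iter_deriv vs f x = iter_deriv vs g x"
  using assms(2)
proof (induction vs arbitrary: f g)
  case Nil
  then show ?case using assms(3) by simp
next
  case (Cons v vs)
  have "frechet_derivative f (at x) v = frechet_derivative g (at x) v" if "x \<in> U" for x
    by (simp add: frechet_derivative_cong_open[OF assms(1) that Cons.prems])
  then show ?case unfolding iter_deriv.simps by (rule Cons.IH)
qed

lemma iter_deriv_zero [simp]: "iter_deriv vs (\<lambda>x. 0) = (\<lambda>x. 0)"
  by (induction vs) auto

lemma Ck_on_iter_deriv:
  "(\<And>k. Ck_on k U f) \<Longrightarrow> Ck_on k U (iter_deriv vs f)"
proof (induction vs arbitrary: f)
  case (Cons v vs)
  have "Ck_on k U (\<lambda>x. frechet_derivative f (at x) v)" for k
    using Cons.prems[of "Suc k"] by simp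
  then show ?case using Cons.IH by simp
qed simp

lemma iter_deriv_cmult:
  fixes f :: "'e::euclidean_space \<Rightarrow> real"
  assumes "\<And>k. Ck_on k UNIV f"
  shows "iter_deriv vs (\<lambda>x. c * f x) = (\<lambda>x. c * iter_deriv vs f x)"
  using assms
proof (induction vs arbitrary: f)
  case (Cons v vs)
  have "(f has_derivative frechet_derivative f (at x)) (at x)" for x
    using Ck_on_SucD(1)[OF Cons.prems] by blast
  then have "frechet_derivative (\<lambda>x. c * f x) (at x) = (\<lambda>v. c * frechet_derivative f (at x) v)" for x
    by (simp add: frechet_derivative_at[OF has_derivative_mult_right, symmetric])
  moreover have "Ck_on k UNIV (\<lambda>x. frechet_derivative f (at x) v)" for k
    using Cons.prems[of "Suc k"] by simp
  ultimately show ?case using Cons.IH by simp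
qed simp

text \<open>Termwise differentiation asks for uniform convergence of the derivatives in operator
  norm. In finite dimension this follows from summable bounds along the finitely many basis vectors;
  the tail \<open>T N\<close> then bounds the operator norm of the error.\<close>

lemma has_derivative_suminf_Basis:
  fixes f :: "nat \<Rightarrow> 'e::euclidean_space \<Rightarrow> real"
  assumes f: "\<And>n x. (f n has_derivative f' n x) (at x)"
    and s: "\<And>x. summable (\<lambda>n. f n x)"
    and B: "\<And>b. b \<in> Basis \<Longrightarrow> summable (B b)" "\<And>n x b. b \<in> Basis \<Longrightarrow> \<bar>f' n x b\<bar> \<le> B b n"
  shows "((\<lambda>x. \<Sum>n. f n x) has_derivative (\<lambda>v. \<Sum>b\<in>Basis. (v \<bullet> b) * (\<Sum>n. f' n x b))) (at x)"
proof -
  have rep: "f' n x v = (\<Sum>b\<in>Basis. (v \<bullet> b) * f' n x b)" for n x v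
  proof -
    interpret bounded_linear "f' n x" using f by (rule has_derivative_bounded_linear)
    have "f' n x v = f' n x (\<Sum>b\<in>Basis. (v \<bullet> b) *\<^sub>R b)" by (simp add: euclidean_representation)
    also have "\<dots> = (\<Sum>b\<in>Basis. (v \<bullet> b) * f' n x b)" by (simp add: sum scale)
    finally show ?thesis .
  qed
  have ss: "summable (\<lambda>n. f' n x b)" if "b \<in> Basis" for x b
    by (rule summable_comparison_test'[OF B(1)[OF that], of 0]) (use B(2)[OF that] in auto)
  define T where "T N = (\<Sum>b\<in>Basis. (\<Sum>n. B b (n + N)))" for N
  have T: "T \<longlonglongrightarrow> 0"
  proof -
    have "(\<lambda>N. \<Sum>b\<in>(Basis::'e set). (\<Sum>n. B b (n + N))) \<longlonglongrightarrow> (\<Sum>b\<in>(Basis::'e set). 0)"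
      by (intro tendsto_sum suminf_exist_split2 B)
    moreover have "T = (\<lambda>N. \<Sum>b\<in>Basis. (\<Sum>n. B b (n + N)))" by (simp add: T_def fun_eq_iff)
    ultimately show ?thesis by simp
  qed
  have tail: "\<bar>(\<Sum>n<N. f' n x b) - (\<Sum>n. f' n x b)\<bar> \<le> (\<Sum>n. B b (n + N))" if b: "b \<in> Basis" for N x b
  proof -
    have sB: "summable (\<lambda>n. B b (n + N))" using B(1)[OF b] by (simp add: summable_iff_shift)
    have sa: "summable (\<lambda>n. \<bar>f' (n + N) x b\<bar>)"
      by (rule summable_comparison_test'[OF sB, of 0]) (use B(2)[OF b] in auto)
    have "(\<Sum>n. f' n x b) = (\<Sum>n. f' (n + N) x b) + (\<Sum>n<N. f' n x b)"
      using suminf_split_initial_segment[OF ss[OF b]] by blast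
    then have "\<bar>(\<Sum>n<N. f' n x b) - (\<Sum>n. f' n x b)\<bar> = \<bar>\<Sum>n. f' (n + N) x b\<bar>" by simp
    also have "\<dots> \<le> (\<Sum>n. \<bar>f' (n + N) x b\<bar>)" by (rule summable_rabs[OF sa])
    also have "\<dots> \<le> (\<Sum>n. B b (n + N))" by (rule suminf_le[OF _ sa sB]) (use B(2)[OF b] in auto)
    finally show ?thesis .
  qed
  define g' where "g' x v = (\<Sum>b\<in>Basis. (v \<bullet> b) * (\<Sum>n. f' n x b))" for x v
  have unif: "\<forall>\<^sub>F n in sequentially. \<forall>x\<in>UNIV. \<forall>h. norm ((\<Sum>i<n. f' i x h) - g' x h) \<le> e * norm h"
    if "e > 0" for e
  proof -
    have "\<forall>\<^sub>F N in sequentially. T N < e" using T that by (rule order_tendstoD)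
    then show ?thesis
    proof (eventually_elim, intro ballI allI)
      fix N x and h :: 'e assume N: "T N < e"
      have "(\<Sum>i<N. f' i x h) - g' x h = (\<Sum>b\<in>Basis. (h \<bullet> b) * ((\<Sum>i<N. f' i x b) - (\<Sum>n. f' n x b)))"
        unfolding g'_def by (subst rep) (simp add: sum.swap[of _ _ "{..<N}"] sum_distrib_left
            sum_subtractf right_diff_distrib)
      then have "norm ((\<Sum>i<N. f' i x h) - g' x h) \<le> (\<Sum>b\<in>Basis. \<bar>h \<bullet> b\<bar> * \<bar>(\<Sum>i<N. f' i x b) - (\<Sum>n. f' n x b)\<bar>)"
        by (simp add: sum_abs flip: abs_mult)
      also have "\<dots> \<le> (\<Sum>b\<in>Basis. norm h * (\<Sum>n. B b (n + N)))"
        by (intro sum_mono mult_mono Basis_le_norm tail) auto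
      also have "\<dots> = norm h * T N" by (simp add: T_def sum_distrib_left)
      also have "\<dots> \<le> e * norm h" using mult_left_mono[of "T N" e "norm h"] N by (simp add: mult.commute)
      finally show "norm ((\<Sum>i<N. f' i x h) - g' x h) \<le> e * norm h" .
    qed
  qed
  have "\<exists>g. \<forall>x\<in>UNIV. (\<lambda>n. f n x) sums g x \<and> (g has_derivative g' x) (at x within UNIV)"
    by (rule has_derivative_series[OF convex_UNIV _ unif, of f 0 "\<Sum>n. f n 0"])
       (use f s summable_sums in auto)
  then obtain g where g: "\<And>x. (\<lambda>n. f n x) sums g x" "\<And>x. (g has_derivative g' x) (at x)" by auto
  then have "g = (\<lambda>x. \<Sum>n. f n x)" by (auto simp: sums_iff)
  then show ?thesis using g(2) by (simp add: g'_def[abs_def])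
qed

text \<open>A Weierstrass test for every list of basis directions. Passing to the partial derivative
  along \<open>b\<close> prepends \<open>b\<close> to the lists, so the hypothesis reproduces itself
  in the induction.\<close>

lemma Ck_on_suminf:
  fixes f :: "nat \<Rightarrow> 'e::euclidean_space \<Rightarrow> real"
  assumes "\<And>n k. Ck_on k UNIV (f n)"
    and "\<And>vs. set vs \<subseteq> Basis \<Longrightarrow> \<exists>B. summable B \<and> (\<forall>n x. \<bar>iter_deriv vs (f n) x\<bar> \<le> B n)"
  shows "Ck_on k UNIV (\<lambda>x. \<Sum>n. f n x)"
  using assms
proof (induction k arbitrary: f)
  case 0
  obtain B where B: "summable B" "\<And>n x. \<bar>f n x\<bar> \<le> B n"
    using 0(2)[of "[]"] by auto
  have "uniform_limit UNIV (\<lambda>n x. \<Sum>i<n. f i x) (\<lambda>x. \<Sum>i. f i x) sequentially"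
    by (rule Weierstrass_m_test[OF _ B(1)]) (use B(2) in auto)
  moreover have "\<forall>\<^sub>F n in sequentially. continuous_on UNIV (\<lambda>x. \<Sum>i<n. f i x)"
    using 0(1)[of 0] by (intro always_eventually allI continuous_on_sum) auto
  ultimately show ?case
    using uniform_limit_theorem sequentially_bot by (metis Ck_on.simps(1))
next
  case (Suc k)
  define f' where "f' n x = frechet_derivative (f n) (at x)" for n x
  obtain B0 where B0: "summable B0" "\<And>n x. \<bar>f n x\<bar> \<le> B0 n"
    using Suc.prems(2)[of "[]"] by auto
  have "\<exists>B. summable B \<and> (\<forall>n x. \<bar>f' n x b\<bar> \<le> B n)" if "b \<in> Basis" for b
    using Suc.prems(2)[of "[b]"] that by (simp add: f'_def)
  then obtain B where B: "\<And>b. b \<in> Basis \<Longrightarrow> summable (B b)" "\<And>n x b. b \<in> Basis \<Longrightarrow> \<bar>f' n x b\<bar> \<le> B b n"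
    by metis
  have s: "summable (\<lambda>n. f n x)" for x
    by (rule summable_comparison_test'[OF B0(1), of 0]) (use B0(2) in auto)
  have d: "((\<lambda>x. \<Sum>n. f n x) has_derivative (\<lambda>v. \<Sum>b\<in>Basis. (v \<bullet> b) * (\<Sum>n. f' n x b))) (at x)" for x
    by (rule has_derivative_suminf_Basis[OF _ s B])
       (auto simp: f'_def intro!: Ck_on_SucD(1)[OF Suc.prems(1)])
  have "Ck_on k UNIV (\<lambda>x. \<Sum>n. f' n x b)" if b: "b \<in> Basis" for b
  proof (rule Suc.IH)
    show "Ck_on k UNIV (\<lambda>x. f' n x b)" for n k
      using Suc.prems(1)[of "Suc k" n] by (simp add: f'_def)
    show "\<exists>B. summable B \<and> (\<forall>n x. \<bar>iter_deriv vs (\<lambda>x. f' n x b) x\<bar> \<le> B n)" if "set vs \<subseteq> Basis" for vs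
      using Suc.prems(2)[of "b # vs"] b that by (simp add: f'_def)
  qed
  then show ?case
    by (intro Ck_on_SucI[OF open_UNIV d] Ck_on_sum Ck_on_mult Ck_on_const open_UNIV)
qed

section \<open>Small smooth perturbations of the identity\<close>

lemma bounded_of_support:
  fixes f :: "'e::euclidean_space \<Rightarrow> real"
  assumes "continuous_on UNIV f" "\<And>x. dist x a > \<rho> \<Longrightarrow> f x = 0"
  obtains C where "\<And>x. \<bar>f x\<bar> \<le> C"
proof -
  have "compact (f ` cball a \<rho>)"
    using assms(1) by (intro compact_continuous_image) (auto intro: continuous_on_subset)
  then obtain C where C: "\<And>x. x \<in> cball a \<rho> \<Longrightarrow> \<bar>f x\<bar> \<le> C"
    using compact_imp_bounded bounded_iff by (metis image_eqI real_norm_def)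
  have "\<bar>f x\<bar> \<le> max C 0" for x
  proof (cases "x \<in> cball a \<rho>")
    case True
    then show ?thesis using C[OF True] by simp
  next
    case False
    then show ?thesis using assms(2)[of x] by (simp add: dist_commute)
  qed
  then show ?thesis using that by blast
qed

lemma iter_deriv_bounded:
  fixes f :: "'e::euclidean_space \<Rightarrow> real"
  assumes "\<And>k. Ck_on k UNIV f" "\<And>x. dist x a \<ge> \<rho> \<Longrightarrow> f x = 0"
  obtains C where "\<And>x. \<bar>iter_deriv vs f x\<bar> \<le> C"
proof -
  have "iter_deriv vs f x = 0" if "dist x a > \<rho>" for x
  proof -
    have "iter_deriv vs f x = iter_deriv vs (\<lambda>x. 0) x"
    proof (rule iter_deriv_cong_open)
      show "open (- cball a \<rho>)" by (simp add: open_Compl)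
      show "x \<in> - cball a \<rho>" using that by (simp add: dist_commute)
      show "f x = 0" if "x \<in> - cball a \<rho>" for x
        using assms(2)[of x] that by (simp add: dist_commute)
    qed
    then show ?thesis by simp
  qed
  moreover have "continuous_on UNIV (iter_deriv vs f)"
    using Ck_on_iter_deriv[OF assms(1), of 0 vs] by simp
  ultimately show ?thesis using bounded_of_support[of "iter_deriv vs f" \<rho> a] that by blast
qed

text \<open>Directions from \<open>Basis\<close> leave only finitely many lists of length at most
  \<open>m\<close>; their individual bounds are added up.\<close>

lemma iter_deriv_bounded_uniform:
  fixes f :: "'e::euclidean_space \<Rightarrow> real"
  assumes "\<And>k. Ck_on k UNIV f" "\<And>x. dist x a \<ge> \<rho> \<Longrightarrow> f x = 0"
  obtains C where "C \<ge> 0"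
    "\<And>vs x. set vs \<subseteq> Basis \<Longrightarrow> length vs \<le> m \<Longrightarrow> \<bar>iter_deriv vs f x\<bar> \<le> C"
proof -
  have "\<exists>C. \<forall>x. \<bar>iter_deriv vs f x\<bar> \<le> C" for vs
    by (rule iter_deriv_bounded[OF assms]) blast+
  then obtain C where C: "\<And>vs x. \<bar>iter_deriv vs f x\<bar> \<le> C vs" by metis
  define L where "L = {vs. set vs \<subseteq> (Basis::'e set) \<and> length vs \<le> m}"
  have L: "finite L" unfolding L_def by (rule finite_lists_length_le) simp
  show ?thesis
  proof (rule that[of "\<Sum>vs\<in>L. \<bar>C vs\<bar>"])
    fix vs :: "'e list" and x assume "set vs \<subseteq> Basis" "length vs \<le> m"
    then have "\<bar>C vs\<bar> \<le> (\<Sum>vs\<in>L. \<bar>C vs\<bar>)"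
      using L by (intro member_le_sum) (auto simp: L_def)
    then show "\<bar>iter_deriv vs f x\<bar> \<le> (\<Sum>vs\<in>L. \<bar>C vs\<bar>)" using C[of vs x] by linarith
  qed (simp add: sum_nonneg)
qed

text \<open>The scale \<open>N n\<close> is taken so large that all partial derivatives of order at most \<open>n + 1\<close> of
  the \<open>n\<close>-th bump, which moves the \<open>n\<close>-th segment by a fraction \<open>1 / (4 * N n)\<close> of its distance to
  \<open>p\<close>, are exponentially small. Hence every series of such bumps is smooth, also at \<open>p\<close>.\<close>

lemma small_shifts:
  fixes p e :: "'e::euclidean_space"
  assumes e: "e \<in> Basis" and R: "R > 0"
  shows "\<exists>N :: nat \<Rightarrow> nat. (\<forall>n. N n > 0) \<and> (\<forall>s. (\<forall>n. \<bar>s n\<bar> \<le> 1) \<longrightarrow>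
    (\<exists>u :: 'e \<Rightarrow> real. (\<forall>k. Ck_on k UNIV u) \<and>
      (\<forall>x. dist x p \<ge> 2 * R \<longrightarrow> u x = 0) \<and>
      (\<forall>x v. \<bar>frechet_derivative u (at x) v\<bar> \<le> norm v / 2) \<and>
      (\<forall>n t. R / 4 ^ n \<le> t \<and> t \<le> 5 / 4 * (R / 4 ^ n) \<longrightarrow>
         u (p + t *\<^sub>R e) = s n * (R / 4 ^ n / (4 * real (N n))))))"
proof -
  define \<alpha> where "\<alpha> n = R / 4 ^ n" for n :: nat
  have \<alpha>: "\<alpha> n > 0" "\<alpha> n \<le> R" for n using R by (auto simp: \<alpha>_def divide_le_eq mult_le_cancel_left1)
  have \<alpha>_less: "4 * \<alpha> n \<le> \<alpha> m" if "m < n" for m n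
  proof -
    have "(4::real) * 4 ^ m \<le> 4 ^ n" using that power_increasing[of "Suc m" n "4::real"] by simp
    then show ?thesis using R by (simp add: \<alpha>_def field_simps)
  qed
  define a where "a n = p + \<alpha> n *\<^sub>R e" for n
  \<comment> \<open>The point \<open>a n\<close> is the near end of the n-th segment, whose length
    is \<open>\<alpha> n / 4\<close>, so the ball where the bump is 1 covers the segment. The radius
    \<open>\<alpha> n / 2\<close> misses all other segments, since consecutive scales differ by the
    factor 4.\<close>
  have "\<exists>\<psi> :: 'e \<Rightarrow> real. (\<forall>k. Ck_on k UNIV \<psi>) \<and> (\<forall>x. dist x (a n) \<le> \<alpha> n / 4 \<longrightarrow> \<psi> x = 1) \<and>
    (\<forall>x. dist x (a n) \<ge> \<alpha> n / 2 \<longrightarrow> \<psi> x = 0)" for n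
  proof -
    have "\<alpha> n / 4 > 0" "2 * (\<alpha> n / 4) = \<alpha> n / 2" using \<alpha>(1)[of n] by auto
    then show ?thesis using bump_exists[of "\<alpha> n / 4" "a n"] by metis
  qed
  then obtain \<psi> :: "nat \<Rightarrow> 'e \<Rightarrow> real" where \<psi>: "\<And>n k. Ck_on k UNIV (\<psi> n)"
    "\<And>n x. dist x (a n) \<le> \<alpha> n / 4 \<Longrightarrow> \<psi> n x = 1" "\<And>n x. dist x (a n) \<ge> \<alpha> n / 2 \<Longrightarrow> \<psi> n x = 0"
    by metis
  have "\<exists>C\<ge>0. \<forall>vs x. set vs \<subseteq> Basis \<longrightarrow> length vs \<le> n + 1 \<longrightarrow> \<bar>iter_deriv vs (\<psi> n) x\<bar> \<le> C" for n
    by (rule iter_deriv_bounded_uniform[OF \<psi>(1)[of _ n] \<psi>(3)[of n], where m = "n + 1"]) blast+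
  then obtain C where C: "\<And>n. C n \<ge> 0"
    "\<And>n vs x. set vs \<subseteq> Basis \<Longrightarrow> length vs \<le> n + 1 \<Longrightarrow> \<bar>iter_deriv vs (\<psi> n) x\<bar> \<le> C n"
    by metis
  define d where "d = real DIM('e)"
  have d: "d > 0" by (simp add: d_def)
  \<comment> \<open>Chosen so that \<open>c n * C n\<close> is at most 1 / (4 * d * 2^n): the power
    of 2 gives summability, \<open>d\<close> pays for the sum over the basis directions, and
    \<open>Suc\<close> keeps \<open>N n\<close> positive.\<close>
  define N where "N n = Suc (nat \<lceil>\<alpha> n * C n * 2 ^ n * d\<rceil>)" for n
  define c where "c n = \<alpha> n / (4 * real (N n))" for n
  have c: "c n \<ge> 0" "c n * C n \<le> (1 / 2) ^ n / (4 * d)" for n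
  proof -
    show "c n \<ge> 0" using \<alpha>(1)[of n] by (simp add: c_def)
    have "\<alpha> n * C n * 2 ^ n * d \<le> real (N n)" unfolding N_def by linarith
    moreover have "real (N n) > 0" by (simp add: N_def)
    ultimately show "c n * C n \<le> (1 / 2) ^ n / (4 * d)"
      using d by (simp add: c_def field_simps power_divide)
  qed
  have main: "\<exists>u :: 'e \<Rightarrow> real. (\<forall>k. Ck_on k UNIV u) \<and>
      (\<forall>x. dist x p \<ge> 2 * R \<longrightarrow> u x = 0) \<and>
      (\<forall>x v. \<bar>frechet_derivative u (at x) v\<bar> \<le> norm v / 2) \<and>
      (\<forall>n t. \<alpha> n \<le> t \<and> t \<le> 5 / 4 * \<alpha> n \<longrightarrow> u (p + t *\<^sub>R e) = s n * c n)"
    if s: "\<And>n. \<bar>s n\<bar> \<le> 1" for s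
  proof -
    define \<phi> where "\<phi> n x = (s n * c n) * \<psi> n x" for n x
    have \<phi>: "Ck_on k UNIV (\<phi> n)" for n k
      unfolding \<phi>_def by (intro Ck_on_mult Ck_on_const \<psi>(1) open_UNIV)
    have it: "\<bar>iter_deriv vs (\<phi> n) x\<bar> \<le> c n * \<bar>iter_deriv vs (\<psi> n) x\<bar>" for vs n x
    proof -
      have "iter_deriv vs (\<phi> n) x = (s n * c n) * iter_deriv vs (\<psi> n) x"
        unfolding \<phi>_def[abs_def] by (subst iter_deriv_cmult) (auto simp: \<psi>(1))
      then have "\<bar>iter_deriv vs (\<phi> n) x\<bar> = \<bar>s n\<bar> * (c n * \<bar>iter_deriv vs (\<psi> n) x\<bar>)"
        using c(1)[of n] by (simp add: abs_mult)
      also have "\<dots> \<le> 1 * (c n * \<bar>iter_deriv vs (\<psi> n) x\<bar>)"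
        using s c(1) by (intro mult_right_mono) auto
      finally show ?thesis by simp
    qed
    have it': "\<bar>iter_deriv vs (\<phi> n) x\<bar> \<le> (1 / 2) ^ n / (4 * d)"
      if "set vs \<subseteq> Basis" "length vs \<le> n + 1" for vs n x
      using it[of vs n x] mult_left_mono[OF C(2)[OF that, of x] c(1)[of n]] c(2)[of n] by linarith
    have sm: "summable (\<lambda>n. (1 / 2) ^ n / (4 * d))"
      by (intro summable_divide summable_geometric) simp
    have bd: "\<exists>B. summable B \<and> (\<forall>n x. \<bar>iter_deriv vs (\<phi> n) x\<bar> \<le> B n)" if vs: "set vs \<subseteq> Basis" for vs
    proof -
      have "\<exists>D. \<forall>x. \<bar>iter_deriv vs (\<phi> n) x\<bar> \<le> D" for n
        by (rule iter_deriv_bounded[OF \<phi>, where a = "a n" and \<rho> = "\<alpha> n / 2" and vs = vs])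
          (use \<psi>(3) in \<open>auto simp: \<phi>_def\<close>)
      then obtain D where D: "\<And>n x. \<bar>iter_deriv vs (\<phi> n) x\<bar> \<le> D n" by metis
      \<comment> \<open>For a given list the exponential bound is missing only for the finitely many
        n with n + 1 < \<open>length vs\<close>; there any finite bound serves.\<close>
      define B where "B n = (if length vs \<le> n + 1 then (1 / 2) ^ n / (4 * d) else D n)" for n
      have "summable B"
        by (rule summable_cong[THEN iffD2, OF _ sm])
          (auto simp: B_def eventually_sequentially intro!: exI[of _ "length vs"])
      moreover have "\<bar>iter_deriv vs (\<phi> n) x\<bar> \<le> B n" for n x
        using it'[OF vs] D by (simp add: B_def)
      ultimately show ?thesis by blast
    qed
    define u where "u x = (\<Sum>n. \<phi> n x)" for x
    have u: "Ck_on k UNIV u" for k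
      unfolding u_def[abs_def] by (rule Ck_on_suminf[OF \<phi> bd])
    have zero: "\<phi> n x = 0" if "dist x (a n) \<ge> \<alpha> n / 2" for n x
      using \<psi>(3)[OF that] by (simp add: \<phi>_def)
    have far: "u x = 0" if "dist x p \<ge> 2 * R" for x
    proof -
      have "\<phi> n x = 0" for n
      proof (rule zero)
        have "dist p (a n) = \<alpha> n" using \<alpha>(1)[of n] e by (simp add: a_def dist_norm)
        then show "dist x (a n) \<ge> \<alpha> n / 2"
          using that \<alpha>[of n] dist_triangle[of x p "a n"] by (simp add: dist_commute)
      qed
      then show ?thesis by (simp add: u_def)
    qed
    have D1: "\<bar>frechet_derivative (\<phi> n) (at x) b\<bar> \<le> (1 / 2) ^ n / (4 * d)" if "b \<in> Basis" for n x b
      using it'[of "[b]" n x] that by simp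
    have "summable (\<lambda>n. \<phi> n x)" for x
      by (rule summable_comparison_test'[OF sm, of 0]) (use it'[of "[]"] in auto)
    then have Du: "(u has_derivative (\<lambda>v. \<Sum>b\<in>Basis. (v \<bullet> b) * (\<Sum>n. frechet_derivative (\<phi> n) (at x) b))) (at x)" for x
      unfolding u_def[abs_def]
      by (intro has_derivative_suminf_Basis[where B = "\<lambda>b n. (1 / 2) ^ n / (4 * d)"] Ck_on_SucD(1)[OF \<phi>] D1 sm) auto
    have small: "\<bar>frechet_derivative u (at x) v\<bar> \<le> norm v / 2" for x v
    proof -
      \<comment> \<open>Summed over the \<open>d\<close> directions, this leaves the factor 1 / 2,
        which makes the perturbation of the identity invertible.\<close>
      have su: "(\<Sum>n. (1 / 2) ^ n / (4 * d)) = 1 / (2 * d)"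
        using suminf_geometric[of "1 / 2 :: real"] by (subst suminf_divide) auto
      have tb: "\<bar>\<Sum>n. frechet_derivative (\<phi> n) (at x) b\<bar> \<le> 1 / (2 * d)" if "b \<in> Basis" for b
      proof -
        have sa: "summable (\<lambda>n. \<bar>frechet_derivative (\<phi> n) (at x) b\<bar>)"
          by (rule summable_comparison_test'[OF sm, of 0]) (use D1[OF that] in auto)
        have "\<bar>\<Sum>n. frechet_derivative (\<phi> n) (at x) b\<bar> \<le> (\<Sum>n. \<bar>frechet_derivative (\<phi> n) (at x) b\<bar>)"
          by (rule summable_rabs[OF sa])
        also have "\<dots> \<le> (\<Sum>n. (1 / 2) ^ n / (4 * d))" by (rule suminf_le[OF D1[OF that] sa sm])
        finally show ?thesis using su by simp
      qed
      have "\<bar>frechet_derivative u (at x) v\<bar> = \<bar>\<Sum>b\<in>Basis. (v \<bullet> b) * (\<Sum>n. frechet_derivative (\<phi> n) (at x) b)\<bar>"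
        by (subst frechet_derivative_at[OF Du, symmetric]) simp
      also have "\<dots> \<le> (\<Sum>b\<in>Basis. \<bar>v \<bullet> b\<bar> * \<bar>\<Sum>n. frechet_derivative (\<phi> n) (at x) b\<bar>)"
        by (simp add: sum_abs flip: abs_mult)
      also have "\<dots> \<le> (\<Sum>b\<in>(Basis::'e set). norm v * (1 / (2 * d)))"
        by (intro sum_mono mult_mono Basis_le_norm tb) auto
      also have "\<dots> = norm v / 2" using d by (simp add: d_def)
      finally show ?thesis .
    qed
    have val: "u (p + t *\<^sub>R e) = s n * c n" if t: "\<alpha> n \<le> t" "t \<le> 5 / 4 * \<alpha> n" for n t
    proof -
      have ds: "dist (p + t *\<^sub>R e) (a m) = \<bar>t - \<alpha> m\<bar>" for m
        using e by (simp add: a_def dist_norm flip: scaleR_diff_left)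
      have "\<phi> m (p + t *\<^sub>R e) = 0" if "m \<noteq> n" for m
      proof (rule zero)
        show "\<alpha> m / 2 \<le> dist (p + t *\<^sub>R e) (a m)"
        proof (cases "m < n")
          case True
          then show ?thesis unfolding ds using \<alpha>_less[OF True] t \<alpha>(1)[of m] \<alpha>(1)[of n] by linarith
        next
          case False
          then show ?thesis unfolding ds using \<alpha>_less[of n m] that t \<alpha>(1)[of m] by linarith
        qed
      qed
      then have "u (p + t *\<^sub>R e) = \<phi> n (p + t *\<^sub>R e)"
        unfolding u_def by (subst suminf_finite[of "{n}"]) auto
      also have "\<psi> n (p + t *\<^sub>R e) = 1" by (rule \<psi>(2)) (use t in \<open>simp add: ds\<close>)
      then have "\<phi> n (p + t *\<^sub>R e) = s n * c n" by (simp add: \<phi>_def)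
      finally show ?thesis .
    qed
    from u far small val show ?thesis by blast
  qed
  show ?thesis
  proof (intro exI[of _ N] conjI allI impI)
    show "N n > 0" for n by (simp add: N_def)
  qed (rule main[unfolded \<alpha>_def c_def], blast)
qed

text \<open>The displacement has Lipschitz constant 1 / 2, so \<open>G\<close> shrinks distances at
  most by the factor 2; it is injective and its inverse is continuous. As the displacement is along
  \<open>e\<close> only, surjectivity is a fixed point problem in one real variable.\<close>

lemma perturbation_diffeo:
  fixes u :: "'e::euclidean_space \<Rightarrow> real" and e :: 'e
  assumes u: "\<And>k. Ck_on k UNIV u" and e: "norm e = 1"
    and D: "\<And>x v. \<bar>frechet_derivative u (at x) v\<bar> \<le> norm v / 2"
  defines "G \<equiv> \<lambda>x. x + u x *\<^sub>R e"
  obtains Gi where "\<And>k. Ck_on k UNIV G" "\<And>k. Ck_on k UNIV Gi" "\<And>x. Gi (G x) = x" "\<And>x. G (Gi x) = x"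
proof -
  let ?D = "\<lambda>x. frechet_derivative u (at x)"
  have Du: "(u has_derivative ?D x) (at x)" for x using Ck_on_SucD(1)[OF u] by blast
  have lip: "\<bar>u x - u y\<bar> \<le> 1 / 2 * norm (x - y)" for x y
  proof -
    have "norm (u x - u y) \<le> 1 / 2 * norm (x - y)"
    proof (rule differentiable_bound[OF convex_UNIV])
      show "(u has_derivative ?D x) (at x within UNIV)" for x using Du by simp
      show "onorm (?D x) \<le> 1 / 2" for x
        by (rule onorm_bound) (use D in auto)
    qed auto
    then show ?thesis by simp
  qed
  have exp: "norm (x - y) \<le> 2 * norm (G x - G y)" for x y
  proof -
    have "x - y = (G x - G y) - (u x - u y) *\<^sub>R e" by (simp add: G_def algebra_simps)
    then have "norm (x - y) \<le> norm (G x - G y) + norm ((u x - u y) *\<^sub>R e)"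
      by (metis norm_triangle_ineq4)
    then show ?thesis using lip[of x y] e by simp
  qed
  have surj: "\<exists>x. G x = y" for y
  proof -
    \<comment> \<open>A preimage of \<open>y\<close> is sought as \<open>y - t *\<^sub>R e\<close>
      with \<open>t = u (y - t *\<^sub>R e)\<close>, and the right-hand side is a contraction in
      \<open>t\<close>.\<close>
    have "dist (u (y - t *\<^sub>R e)) (u (y - t' *\<^sub>R e)) \<le> 1 / 2 * dist t t'" for t t'
    proof -
      have "(y - t *\<^sub>R e) - (y - t' *\<^sub>R e) = (t' - t) *\<^sub>R e" by (simp add: algebra_simps)
      then show ?thesis
        using lip[of "y - t *\<^sub>R e" "y - t' *\<^sub>R e"] e by (simp add: dist_real_def abs_minus_commute)
    qed
    then have "\<exists>!t. u (y - t *\<^sub>R e) = t"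
      by (intro banach_fix_type[of "1 / 2"]) auto
    then obtain t where "u (y - t *\<^sub>R e) = t" by blast
    then have "G (y - t *\<^sub>R e) = y" by (simp add: G_def)
    then show ?thesis by blast
  qed
  then obtain Gi where Gi: "\<And>y. G (Gi y) = y" by metis
  have inv: "Gi (G x) = x" for x using exp[of "Gi (G x)" x] Gi by simp
  have G: "Ck_on k UNIV G" for k
    unfolding G_def by (intro Ck_on_add Ck_on_scaleR Ck_on_id Ck_on_const u open_UNIV)
  have cont: "continuous (at y) Gi" for y
    unfolding continuous_at_eps_delta
  proof (intro allI impI)
    fix \<epsilon> :: real assume "\<epsilon> > 0"
    then show "\<exists>d>0. \<forall>x'. dist x' y < d \<longrightarrow> dist (Gi x') (Gi y) < \<epsilon>"
    proof (intro exI[of _ "\<epsilon> / 2"] conjI allI impI)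
      fix x' assume "dist x' y < \<epsilon> / 2"
      then show "dist (Gi x') (Gi y) < \<epsilon>"
        using exp[of "Gi x'" "Gi y"] Gi by (simp add: dist_norm)
    qed simp
  qed
  have pos: "1 + ?D x e \<noteq> 0" for x using D[of x e] e by auto
  \<comment> \<open>The inverse of a rank one perturbation of the identity (Sherman-Morrison). Its
    denominator is nonzero because \<open>?D x e\<close> has absolute value at most 1 / 2. The
    factor \<open>- 1\<close> keeps the formula a product, to which the closure rules for
    \<open>Ck_on\<close> apply.\<close>
  define Q where "Q w x = w + (- 1 * (?D x w * inverse (1 + ?D x e))) *\<^sub>R e" for w x
  have Q: "Ck_on k UNIV (Q w)" for k w
    unfolding Q_def
    by (intro Ck_on_add Ck_on_scaleR Ck_on_mult Ck_on_inverse Ck_on_const Ck_on_SucD(2)[OF u] open_UNIV pos)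
  have "(Gi has_derivative (\<lambda>w. Q w (Gi y))) (at y)" for y
  proof (rule has_derivative_inverse_basic[where f = G and T = UNIV])
    let ?x = "Gi y"
    have bl: "bounded_linear (?D ?x)" by (rule has_derivative_bounded_linear[OF Du])
    interpret bounded_linear "?D ?x" by (rule bl)
    show "(G has_derivative (\<lambda>v. v + ?D ?x v *\<^sub>R e)) (at ?x)"
      unfolding G_def by (intro has_derivative_add has_derivative_ident has_derivative_scaleR_left Du)
    show "bounded_linear (\<lambda>w. Q w ?x)"
      unfolding Q_def
      by (intro bounded_linear_add bounded_linear_ident bounded_linear_scaleR_const
          bounded_linear_const_mult bounded_linear_mult_const bl)
    show "(\<lambda>w. Q w ?x) \<circ> (\<lambda>v. v + ?D ?x v *\<^sub>R e) = id"
    proof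
      fix v
      have "?D ?x (v + ?D ?x v *\<^sub>R e) = ?D ?x v * (1 + ?D ?x e)"
        by (simp add: add scaleR algebra_simps)
      then show "((\<lambda>w. Q w ?x) \<circ> (\<lambda>v. v + ?D ?x v *\<^sub>R e)) v = id v"
        using pos[of ?x] by (simp add: Q_def)
    qed
  qed (use cont Gi in auto)
  then have "Ck_on k UNIV Gi" for k by (rule Ck_on_inverse_function) (rule Q)
  then show ?thesis using that G inv Gi by blast
qed

section \<open>Diffeomorphisms of a manifold\<close>

locale smooth_manifold =
  fixes M :: "'a topology" and A :: "('a, 'e::euclidean_space) chart set"
  assumes atlas: "smooth_atlas M A"
begin

lemma chart:
  assumes "(U, \<phi>) \<in> A"
  shows chart_openin: "openin M U" and chart_open_image: "open (\<phi> ` U)"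
    and chart_homeomorphic: "homeomorphic_map (subtopology M U) (top_of_set (\<phi> ` U)) \<phi>"
  using atlas assms unfolding smooth_atlas_def is_chart_def by auto

lemma chart_subset: "(U, \<phi>) \<in> A \<Longrightarrow> U \<subseteq> topspace M"
  using chart_openin openin_subset by blast

lemma chart_inj: "(U, \<phi>) \<in> A \<Longrightarrow> inj_on \<phi> U"
  using homeomorphic_imp_injective_map[OF chart_homeomorphic] chart_subset
  by (metis inf.absorb_iff2 topspace_subtopology)

lemma chart_inv:
  assumes "(U, \<phi>) \<in> A"
  shows "x \<in> U \<Longrightarrow> inv_into U \<phi> (\<phi> x) = x"
    and "y \<in> \<phi> ` U \<Longrightarrow> \<phi> (inv_into U \<phi> y) = y"
    and "y \<in> \<phi> ` U \<Longrightarrow> inv_into U \<phi> y \<in> U"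
  using chart_inj[OF assms] by (simp_all add: f_inv_into_f inv_into_into)

lemma chart_image_open:
  assumes "(U, \<phi>) \<in> A" "openin M W" "W \<subseteq> U"
  shows "open (\<phi> ` W)"
proof -
  have "openin (subtopology M U) W" using assms by (simp add: openin_subtopology) blast
  then have "openin (top_of_set (\<phi> ` U)) (\<phi> ` W)"
    using homeomorphic_imp_open_map[OF chart_homeomorphic[OF assms(1)]] by (simp add: open_map_def)
  then show ?thesis using chart_open_image[OF assms(1)] openin_open_eq by blast
qed

lemma chart_continuous:
  assumes "(U, \<phi>) \<in> A"
  shows "continuous_map (subtopology M U) euclidean \<phi>"
  using homeomorphic_imp_continuous_map[OF chart_homeomorphic[OF assms]]
  by (simp add: continuous_map_in_subtopology)

lemma chart_inv_continuous:
  assumes "(U, \<phi>) \<in> A"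
  shows "continuous_map (top_of_set (\<phi> ` U)) M (inv_into U \<phi>)"
  unfolding continuous_map_def
proof (intro conjI allI impI)
  show "inv_into U \<phi> \<in> topspace (top_of_set (\<phi> ` U)) \<rightarrow> topspace M"
    using chart_inv(3)[OF assms] chart_subset[OF assms] by auto
  fix W assume "openin M W"
  then have "openin M (U \<inter> W)" using chart_openin[OF assms] by blast
  then have "open (\<phi> ` (U \<inter> W))" using chart_image_open[OF assms] by blast
  moreover have "{y \<in> topspace (top_of_set (\<phi> ` U)). inv_into U \<phi> y \<in> W} = \<phi> ` (U \<inter> W)"
    using chart_inv[OF assms] by auto
  ultimately show "openin (top_of_set (\<phi> ` U)) {y \<in> topspace (top_of_set (\<phi> ` U)). inv_into U \<phi> y \<in> W}"
    by (metis image_mono inf_le1 open_subset)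
qed

lemma chart_at:
  assumes "x \<in> topspace M"
  obtains U \<phi> where "(U, \<phi>) \<in> A" "x \<in> U"
  using atlas assms unfolding smooth_atlas_def by blast

lemma transition_smooth:
  assumes "(U, \<phi>) \<in> A" "(V, \<psi>) \<in> A"
  shows "Ck_on k (\<phi> ` (U \<inter> V)) (\<psi> \<circ> inv_into U \<phi>)"
proof -
  have "\<forall>c\<in>A. \<forall>c'\<in>A. Cr_on \<infinity> (snd c ` (fst c \<inter> fst c')) (snd c' \<circ> inv_into (fst c) (snd c))"
    using atlas by (auto simp: smooth_atlas_def case_prod_beta)
  from this[rule_format, OF assms] show ?thesis by (simp add: Cr_on_def)
qed

section \<open>Maps of class C^r in charts\<close>

lemma Cr_mapD:
  assumes "Cr_map r M A f" "(U, \<phi>) \<in> A" "(V, \<psi>) \<in> A"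
  shows "Cr_on r (\<phi> ` (U \<inter> f -` V)) (\<psi> \<circ> f \<circ> inv_into U \<phi>)"
proof -
  have "\<forall>c\<in>A. \<forall>c'\<in>A. Cr_on r (snd c ` (fst c \<inter> f -` fst c')) (snd c' \<circ> f \<circ> inv_into (fst c) (snd c))"
    using assms(1) by (auto simp: Cr_map_def in_charts_def case_prod_beta)
  from this[rule_format, OF assms(2,3)] show ?thesis by simp
qed

lemma Cr_map_continuous: "Cr_map r M A f \<Longrightarrow> continuous_map M M f"
  by (simp add: Cr_map_def)

lemma openin_preimage:
  assumes "continuous_map M M f" "openin M U" "openin M V"
  shows "openin M (U \<inter> f -` V)"
proof -
  have "U \<inter> f -` V = U \<inter> {x \<in> topspace M. f x \<in> V}"
    using openin_subset[OF assms(2)] by auto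
  then show ?thesis using assms openin_continuous_map_preimage by fastforce
qed

text \<open>One suitable pair of charts per point suffices: an arbitrary pair is reached by
  composing with smooth transition maps on both sides, on a smaller neighbourhood \<open>W\<close>
  where everything is defined.\<close>

lemma Cr_map_local:
  assumes cont: "continuous_map M M g"
    and loc: "\<And>x. x \<in> topspace M \<Longrightarrow> \<exists>U \<phi> V \<psi> N. (U, \<phi>) \<in> A \<and> (V, \<psi>) \<in> A \<and> openin M N \<and> x \<in> N \<and>
      N \<subseteq> U \<and> g ` N \<subseteq> V \<and> Cr_on r (\<phi> ` N) (\<psi> \<circ> g \<circ> inv_into U \<phi>)"
  shows "Cr_map r M A g"
proof -
  have "Cr_on r (\<phi> ` (U \<inter> g -` V)) (\<psi> \<circ> g \<circ> inv_into U \<phi>)"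
    if c: "(U, \<phi>) \<in> A" "(V, \<psi>) \<in> A" for U \<phi> V \<psi>
    unfolding Cr_on_def
  proof (intro allI impI, rule Ck_on_local)
    fix k y assume k: "enat k \<le> r" and "y \<in> \<phi> ` (U \<inter> g -` V)"
    then obtain x where x: "x \<in> U" "g x \<in> V" "y = \<phi> x" by auto
    then obtain U1 \<phi>1 V1 \<psi>1 N where 1: "(U1, \<phi>1) \<in> A" "(V1, \<psi>1) \<in> A" "openin M N" "x \<in> N" "N \<subseteq> U1"
      "g ` N \<subseteq> V1" "Cr_on r (\<phi>1 ` N) (\<psi>1 \<circ> g \<circ> inv_into U1 \<phi>1)"
      using loc chart_subset[OF c(1)] by blast
    define W where "W = U \<inter> N \<inter> g -` V"
    have W: "openin M W" unfolding W_def
      using openin_preimage[OF cont _ chart_openin[OF c(2)], of "U \<inter> N"] chart_openin[OF c(1)] 1(3) by blast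
    have WU: "W \<subseteq> U" by (auto simp: W_def)
    note oW = chart_image_open[OF c(1) W WU]
    have oV: "open (\<psi>1 ` (V1 \<inter> V))"
      using chart_image_open[OF 1(2)] chart_openin[OF c(2)] chart_openin[OF 1(2)] by blast
    have a: "Ck_on k (\<phi> ` W) (\<phi>1 \<circ> inv_into U \<phi>)"
      by (rule Ck_on_subset[OF transition_smooth[OF c(1) 1(1)]]) (use 1(5) in \<open>auto simp: W_def\<close>)
    have b: "Ck_on k (\<phi>1 ` W) (\<psi>1 \<circ> g \<circ> inv_into U1 \<phi>1)"
    proof (rule Ck_on_subset)
      show "Ck_on k (\<phi>1 ` N) (\<psi>1 \<circ> g \<circ> inv_into U1 \<phi>1)" using 1(7) k by (simp add: Cr_on_def)
    qed (auto simp: W_def)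
    have W1: "W \<subseteq> U1" using 1(5) by (auto simp: W_def)
    have ab: "Ck_on k (\<phi> ` W) ((\<psi>1 \<circ> g \<circ> inv_into U1 \<phi>1) \<circ> (\<phi>1 \<circ> inv_into U \<phi>))"
      by (rule Ck_on_compose[OF oW chart_image_open[OF 1(1) W W1] _ b a])
        (use chart_inv(1)[OF c(1)] WU in auto)
    have "Ck_on k (\<phi> ` W) ((\<psi> \<circ> inv_into V1 \<psi>1) \<circ> ((\<psi>1 \<circ> g \<circ> inv_into U1 \<phi>1) \<circ> (\<phi>1 \<circ> inv_into U \<phi>)))"
    proof (rule Ck_on_compose[OF oW oV _ transition_smooth[OF 1(2) c(2)]])
      show "((\<psi>1 \<circ> g \<circ> inv_into U1 \<phi>1) \<circ> (\<phi>1 \<circ> inv_into U \<phi>)) ` \<phi> ` W \<subseteq> \<psi>1 ` (V1 \<inter> V)"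
      proof clarify
        fix w assume w: "w \<in> W"
        then have "w \<in> U" "w \<in> U1" "g w \<in> V1 \<inter> V" using WU W1 1(6) by (auto simp: W_def)
        then show "((\<psi>1 \<circ> g \<circ> inv_into U1 \<phi>1) \<circ> (\<phi>1 \<circ> inv_into U \<phi>)) (\<phi> w) \<in> \<psi>1 ` (V1 \<inter> V)"
          using chart_inv(1)[OF c(1)] chart_inv(1)[OF 1(1)] by simp
      qed
    qed (rule ab)
    then have "Ck_on k (\<phi> ` W) (\<psi> \<circ> g \<circ> inv_into U \<phi>)"
    proof (rule Ck_on_cong[OF oW, rotated])
      fix z assume "z \<in> \<phi> ` W"
      then obtain w where w: "w \<in> W" "z = \<phi> w" by auto
      then have "w \<in> U" "w \<in> U1" "g w \<in> V1" using WU W1 1(6) by (auto simp: W_def)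
      then show "((\<psi> \<circ> inv_into V1 \<psi>1) \<circ> ((\<psi>1 \<circ> g \<circ> inv_into U1 \<phi>1) \<circ> (\<phi>1 \<circ> inv_into U \<phi>))) z
          = (\<psi> \<circ> g \<circ> inv_into U \<phi>) z"
        using w(2) chart_inv(1)[OF c(1)] chart_inv(1)[OF 1(1)] chart_inv(1)[OF 1(2)] by simp
    qed
    moreover have "y \<in> \<phi> ` W" using x 1(4) by (auto simp: W_def)
    ultimately show "\<exists>W. open W \<and> y \<in> W \<and> Ck_on k W (\<psi> \<circ> g \<circ> inv_into U \<phi>)" using oW by blast
  qed
  then show ?thesis using cont unfolding Cr_map_def in_charts_def by auto
qed

text \<open>The composite is represented by any \<open>h\<close> that agrees with it on the carrier,
  because group elements are extensional and \<open>compose\<close> resets values outside the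
  carrier. Near each point the neighbourhood is shrunk until \<open>f\<close> sends it into one
  chart and \<open>g\<close> then into another.\<close>

lemma Cr_map_compose:
  assumes f: "Cr_map r M A f" and g: "Cr_map r M A g"
    and h: "\<And>x. x \<in> topspace M \<Longrightarrow> h x = g (f x)"
  shows "Cr_map r M A h"
proof (rule Cr_map_local)
  note cf = Cr_map_continuous[OF f] and cg = Cr_map_continuous[OF g]
  have "continuous_map M M (g \<circ> f)" using cf cg by (rule continuous_map_compose)
  then show "continuous_map M M h" by (rule continuous_map_eq) (simp add: h)
  fix x assume x: "x \<in> topspace M"
  have fx: "f x \<in> topspace M" using cf x by (auto simp: continuous_map_def)
  have gfx: "g (f x) \<in> topspace M" using cg fx by (auto simp: continuous_map_def)
  obtain U \<phi> where U: "(U, \<phi>) \<in> A" "x \<in> U" using chart_at[OF x] .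
  obtain V \<psi> where V: "(V, \<psi>) \<in> A" "f x \<in> V" using chart_at[OF fx] .
  obtain W \<xi> where W: "(W, \<xi>) \<in> A" "g (f x) \<in> W" using chart_at[OF gfx] .
  have oV: "openin M (V \<inter> g -` W)"
    by (rule openin_preimage[OF cg chart_openin[OF V(1)] chart_openin[OF W(1)]])
  define N where "N = U \<inter> f -` (V \<inter> g -` W)"
  have N: "openin M N" unfolding N_def by (rule openin_preimage[OF cf chart_openin[OF U(1)] oV])
  have NU: "N \<subseteq> U" by (auto simp: N_def)
  note oN = chart_image_open[OF U(1) N NU]
  have "Ck_on k (\<phi> ` N) (\<xi> \<circ> h \<circ> inv_into U \<phi>)" if k: "enat k \<le> r" for k
  proof (rule Ck_on_cong[OF oN])
    have "Ck_on k (\<phi> ` (U \<inter> f -` V)) (\<psi> \<circ> f \<circ> inv_into U \<phi>)"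
      using Cr_mapD[OF f U(1) V(1)] k by (simp add: Cr_on_def)
    then have 1: "Ck_on k (\<phi> ` N) (\<psi> \<circ> f \<circ> inv_into U \<phi>)"
      by (rule Ck_on_subset) (auto simp: N_def)
    have 2: "Ck_on k (\<psi> ` (V \<inter> g -` W)) (\<xi> \<circ> g \<circ> inv_into V \<psi>)"
      using Cr_mapD[OF g V(1) W(1)] k by (simp add: Cr_on_def)
    show "Ck_on k (\<phi> ` N) ((\<xi> \<circ> g \<circ> inv_into V \<psi>) \<circ> (\<psi> \<circ> f \<circ> inv_into U \<phi>))"
      by (rule Ck_on_compose[OF oN _ _ 2 1])
        (use chart_image_open[OF V(1) oV] chart_inv(1)[OF U(1)] in \<open>auto simp: N_def\<close>)
    fix z assume "z \<in> \<phi> ` N"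
    then obtain w where "w \<in> N" "z = \<phi> w" by auto
    then show "((\<xi> \<circ> g \<circ> inv_into V \<psi>) \<circ> (\<psi> \<circ> f \<circ> inv_into U \<phi>)) z = (\<xi> \<circ> h \<circ> inv_into U \<phi>) z"
      using chart_inv(1)[OF U(1), of w] chart_inv(1)[OF V(1), of "f w"] h[of w] chart_subset[OF U(1)]
      by (auto simp: N_def)
  qed
  moreover have "h ` N \<subseteq> W" using h NU chart_subset[OF U(1)] by (force simp: N_def)
  moreover have "x \<in> N" using U V W by (simp add: N_def)
  ultimately show "\<exists>U \<phi> V \<psi> N. (U, \<phi>) \<in> A \<and> (V, \<psi>) \<in> A \<and> openin M N \<and> x \<in> N \<and>
      N \<subseteq> U \<and> h ` N \<subseteq> V \<and> Cr_on r (\<phi> ` N) (\<psi> \<circ> h \<circ> inv_into U \<phi>)"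
    using U(1) W(1) N NU unfolding Cr_on_def by blast
qed

lemma Cr_map_id: "Cr_map r M A (\<lambda>x. x)"
proof (rule Cr_map_local)
  fix x assume "x \<in> topspace M"
  then obtain U \<phi> where U: "(U, \<phi>) \<in> A" "x \<in> U" using chart_at by blast
  note o = chart_open_image[OF U(1)]
  have "Cr_on r (\<phi> ` U) (\<phi> \<circ> (\<lambda>x. x) \<circ> inv_into U \<phi>)"
    unfolding Cr_on_def
    by (intro allI impI Ck_on_cong[OF o _ Ck_on_id[OF o]]) (simp add: chart_inv(2)[OF U(1)])
  then show "\<exists>U \<phi> V \<psi> N. (U, \<phi>) \<in> A \<and> (V, \<psi>) \<in> A \<and> openin M N \<and> x \<in> N \<and>
      N \<subseteq> U \<and> (\<lambda>x. x) ` N \<subseteq> V \<and> Cr_on r (\<phi> ` N) (\<psi> \<circ> (\<lambda>x. x) \<circ> inv_into U \<phi>)"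
    using U chart_openin by blast
qed simp

lemma Cr_map_cong: "Cr_map r M A f \<Longrightarrow> (\<And>x. x \<in> topspace M \<Longrightarrow> g x = f x) \<Longrightarrow> Cr_map r M A g"
  using Cr_map_compose[OF _ Cr_map_id] by blast

section \<open>The group of diffeomorphisms\<close>

lemma DiffeoI:
  assumes "f \<in> extensional (topspace M)" "Cr_map r M A f" "Cr_map r M A g"
    "\<And>x. x \<in> topspace M \<Longrightarrow> g (f x) = x" "\<And>x. x \<in> topspace M \<Longrightarrow> f (g x) = x"
  shows "f \<in> Diffeo r M A"
proof -
  have "f ` topspace M \<subseteq> topspace M" "g ` topspace M \<subseteq> topspace M"
    using assms(2,3)[THEN Cr_map_continuous] by (auto simp: continuous_map_def)
  then have b: "bij_betw f (topspace M) (topspace M)"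
    using assms(4,5) by (intro bij_betw_byWitness[where f' = g]) auto
  have "inv_into (topspace M) f x = g x" if "x \<in> topspace M" for x
    by (rule inv_into_f_eq[OF bij_betw_imp_inj_on[OF b]])
      (use that assms(5) \<open>g ` topspace M \<subseteq> topspace M\<close> in auto)
  then have "Cr_map r M A (inv_into (topspace M) f)" using Cr_map_cong[OF assms(3)] by blast
  with b assms(1,2) show ?thesis by (simp add: Diffeo_def Bij_def)
qed

lemma DiffeoD:
  assumes "f \<in> Diffeo r M A"
  shows "f \<in> Bij (topspace M)" "Cr_map r M A f" "Cr_map r M A (inv_into (topspace M) f)"
    "\<And>x. x \<in> topspace M \<Longrightarrow> f x \<in> topspace M" "inj_on f (topspace M)"
    "\<And>x. x \<in> topspace M \<Longrightarrow> inv_into (topspace M) f (f x) = x"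
    "\<And>x. x \<in> topspace M \<Longrightarrow> f (inv_into (topspace M) f x) = x"
    "\<And>x. x \<in> topspace M \<Longrightarrow> inv_into (topspace M) f x \<in> topspace M"
proof -
  show f: "f \<in> Bij (topspace M)" "Cr_map r M A f" "Cr_map r M A (inv_into (topspace M) f)"
    using assms by (auto simp: Diffeo_def)
  then have b: "bij_betw f (topspace M) (topspace M)" by (simp add: Bij_def)
  then show "f x \<in> topspace M" if "x \<in> topspace M" for x using that bij_betwE by blast
  show "inj_on f (topspace M)" using b bij_betw_imp_inj_on by blast
  then show "inv_into (topspace M) f (f x) = x" if "x \<in> topspace M" for x using that by simp
  show "f (inv_into (topspace M) f x) = x" "inv_into (topspace M) f x \<in> topspace M" if "x \<in> topspace M" for x
    using that b by (auto simp: bij_betw_def f_inv_into_f inv_into_into)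
qed

lemma Diffeo_subgroup: "subgroup (Diffeo r M A) (BijGroup (topspace M))"
proof (rule group.subgroupI[OF group_BijGroup])
  let ?S = "topspace M"
  show "Diffeo r M A \<subseteq> carrier (BijGroup ?S)" by (auto simp: Diffeo_def BijGroup_def)
  have "(\<lambda>x\<in>?S. x) \<in> Diffeo r M A"
    by (rule DiffeoI[where g = "\<lambda>x. x"]) (auto intro: Cr_map_id Cr_map_cong)
  then show "Diffeo r M A \<noteq> {}" by blast
  fix f assume f: "f \<in> Diffeo r M A"
  note F = DiffeoD[OF f]
  have "inv\<^bsub>BijGroup ?S\<^esub> f = (\<lambda>x\<in>?S. inv_into ?S f x)" using F(1) by (rule inv_BijGroup)
  moreover have "(\<lambda>x\<in>?S. inv_into ?S f x) \<in> Diffeo r M A"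
    by (rule DiffeoI[where g = f]) (use F in \<open>auto intro: Cr_map_cong\<close>)
  ultimately show "inv\<^bsub>BijGroup ?S\<^esub> f \<in> Diffeo r M A" by simp
  fix g assume g: "g \<in> Diffeo r M A"
  note G = DiffeoD[OF g]
  have "f \<otimes>\<^bsub>BijGroup ?S\<^esub> g = compose ?S f g" using F(1) G(1) by (simp add: BijGroup_def)
  moreover have "compose ?S f g \<in> Diffeo r M A"
  proof (rule DiffeoI)
    show "Cr_map r M A (compose ?S f g)"
      by (rule Cr_map_compose[OF G(2) F(2)]) (simp add: compose_def)
    show "Cr_map r M A (inv_into ?S g \<circ> inv_into ?S f)"
      by (rule Cr_map_compose[OF F(3) G(3)]) simp
  qed (use F G in \<open>auto simp: compose_def\<close>)
  ultimately show "f \<otimes>\<^bsub>BijGroup ?S\<^esub> g \<in> Diffeo r M A" by simp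
qed

lemma group_Diff_group: "group (Diff_group r M A)"
  unfolding Diff_group_def by (rule group.subgroup_imp_group[OF group_BijGroup Diffeo_subgroup])

lemma carrier_Diff_group: "carrier (Diff_group r M A) = Diffeo r M A"
  by (simp add: Diff_group_def)

lemma mult_Diff_group:
  "f \<in> Diffeo r M A \<Longrightarrow> g \<in> Diffeo r M A \<Longrightarrow> f \<otimes>\<^bsub>Diff_group r M A\<^esub> g = compose (topspace M) f g"
  using DiffeoD(1) by (simp add: Diff_group_def BijGroup_def)

section \<open>Transplanting a map through a chart\<close>

definition lift :: "'a set \<Rightarrow> ('a \<Rightarrow> 'e) \<Rightarrow> ('e \<Rightarrow> 'e) \<Rightarrow> 'a \<Rightarrow> 'a" where
  "lift U \<phi> G = (\<lambda>x\<in>topspace M. if x \<in> U then inv_into U \<phi> (G (\<phi> x)) else x)"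

text \<open>Two open sets cover \<open>M\<close>: the chart domain \<open>U\<close>, where the map
  is \<open>G\<close> read in the chart, and the complement of the compact set over
  \<open>K\<close>, where it is the identity. That complement is open because compact sets in a
  Hausdorff space are closed. The lemma asks only for injectivity, so that it serves
  \<open>G\<close> and its inverse alike.\<close>

lemma lift_Cr_map:
  assumes M: "Hausdorff_space M" and c: "(U, \<phi>) \<in> A" and K: "compact K" "K \<subseteq> \<phi> ` U"
    and G: "\<And>k. Ck_on k UNIV G" "inj G" "\<And>x. x \<notin> K \<Longrightarrow> G x = x"
  shows "Cr_map r M A (lift U \<phi> G)" "G ` (\<phi> ` U) \<subseteq> \<phi> ` U"
proof -
  let ?g = "lift U \<phi> G" and ?i = "inv_into U \<phi>"
  \<comment> \<open>If \<open>G x\<close> lay outside \<open>K\<close>, it would be a fixed point,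
    and injectivity would give \<open>G x = x\<close>, which is in \<open>K\<close>.\<close>
  have "G x \<in> K" if "x \<in> K" for x
    using that G(2,3) by (metis injD)
  then have "G y \<in> \<phi> ` U" if "y \<in> \<phi> ` U" for y
    using that K(2) G(3)[of y] by (cases "y \<in> K") auto
  then show sub: "G ` (\<phi> ` U) \<subseteq> \<phi> ` U" by blast
  define K' where "K' = ?i ` K"
  have "compactin (top_of_set (\<phi> ` U)) K" using K by (simp add: compactin_subtopology)
  then have "compactin M K'" unfolding K'_def
    by (rule image_compactin[OF _ chart_inv_continuous[OF c]])
  then have K': "closedin M K'" by (rule compactin_imp_closedin[OF M])
  have gU: "?g x = ?i (G (\<phi> x))" "?g x \<in> U" if "x \<in> U" for x
    using that chart_subset[OF c] sub chart_inv(3)[OF c] by (auto simp: lift_def)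
  have g_id: "?g x = x" if "x \<in> topspace M - K'" for x
  proof (cases "x \<in> U")
    case True
    have "\<phi> x \<notin> K" using that True chart_inv(1)[OF c True] by (force simp: K'_def)
    then show ?thesis using gU(1)[OF True] G(3) chart_inv(1)[OF c True] by simp
  qed (use that in \<open>simp add: lift_def\<close>)
  have cov: "topspace M = U \<union> (topspace M - K')"
    using K chart_inv(3)[OF c] chart_subset[OF c] by (auto simp: K'_def)
  have oK: "openin M (topspace M - K')" using K' by blast
  have contU: "continuous_map (subtopology M U) M ?g"
  proof (rule continuous_map_eq)
    have "continuous_map (subtopology M U) (top_of_set (\<phi> ` U)) (G \<circ> \<phi>)"
      unfolding continuous_map_in_subtopology
    proof
      have "continuous_map euclidean euclidean G" using G(1)[of 0] by simp
      then show "continuous_map (subtopology M U) euclidean (G \<circ> \<phi>)"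
        using continuous_map_compose[OF chart_continuous[OF c]] by blast
    qed (use sub in auto)
    then show "continuous_map (subtopology M U) M (?i \<circ> (G \<circ> \<phi>))"
      using continuous_map_compose chart_inv_continuous[OF c] by blast
  qed (simp add: gU)
  have contK: "continuous_map (subtopology M (topspace M - K')) M ?g"
    by (rule continuous_map_eq[of _ _ "\<lambda>x. x"]) (auto simp: g_id continuous_map_from_subtopology)
  show "Cr_map r M A ?g"
  proof (rule Cr_map_local)
    show "continuous_map M M ?g"
    proof (rule pasting_lemma[where I = UNIV and T = "\<lambda>b. if b then U else topspace M - K'" and f = "\<lambda>_. ?g"])
      show "continuous_map (subtopology M (if b then U else topspace M - K')) M ?g" for b
        using contU contK by simp
      show "openin M (if b then U else topspace M - K')" for b
        using oK chart_openin[OF c] by simp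
      show "\<exists>b. b \<in> UNIV \<and> x \<in> (if b then U else topspace M - K') \<and> ?g x = ?g x" if "x \<in> topspace M" for x
        using that cov by (metis UNIV_I UnE)
    qed simp
    fix x assume x: "x \<in> topspace M"
    show "\<exists>U \<phi> V \<psi> N. (U, \<phi>) \<in> A \<and> (V, \<psi>) \<in> A \<and> openin M N \<and> x \<in> N \<and>
      N \<subseteq> U \<and> ?g ` N \<subseteq> V \<and> Cr_on r (\<phi> ` N) (\<psi> \<circ> ?g \<circ> inv_into U \<phi>)"
    proof (cases "x \<in> U")
      case True
      note o = chart_open_image[OF c]
      have "Cr_on r (\<phi> ` U) (\<phi> \<circ> ?g \<circ> ?i)"
        unfolding Cr_on_def
      proof (intro allI impI Ck_on_cong[OF o _ Ck_on_subset[OF G(1) subset_UNIV]])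
        fix y assume y: "y \<in> \<phi> ` U"
        then have "G y \<in> \<phi> ` U" using sub by blast
        then show "G y = (\<phi> \<circ> ?g \<circ> ?i) y"
          using chart_inv(2,3)[OF c] gU(1) y by simp
      qed
      then show ?thesis using c True chart_openin[OF c] gU(2)
        by (intro exI[of _ U] exI[of _ \<phi>] conjI) auto
    next
      case False
      obtain V \<psi> where V: "(V, \<psi>) \<in> A" "x \<in> V" using chart_at[OF x] .
      let ?N = "V \<inter> (topspace M - K')"
      have N: "openin M ?N" using oK chart_openin[OF V(1)] by blast
      have o: "open (\<psi> ` ?N)" by (rule chart_image_open[OF V(1) N]) auto
      have "Cr_on r (\<psi> ` ?N) (\<psi> \<circ> ?g \<circ> inv_into V \<psi>)"
        unfolding Cr_on_def
      proof (intro allI impI Ck_on_cong[OF o _ Ck_on_id[OF o]])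
        fix y assume "y \<in> \<psi> ` ?N"
        then obtain w where "w \<in> ?N" "y = \<psi> w" by blast
        then show "y = (\<psi> \<circ> ?g \<circ> inv_into V \<psi>) y"
          using chart_inv(1)[OF V(1)] g_id by auto
      qed
      moreover have "?g ` ?N \<subseteq> V" using g_id by auto
      moreover have "x \<in> ?N" using V(2) False cov x by blast
      ultimately show ?thesis using V(1) N by blast
    qed
  qed
qed

lemma lift_Diffeo:
  assumes M: "Hausdorff_space M" and c: "(U, \<phi>) \<in> A" and K: "compact K" "K \<subseteq> \<phi> ` U"
    and G: "\<And>k. Ck_on k UNIV G" "\<And>k. Ck_on k UNIV Gi" "\<And>x. Gi (G x) = x" "\<And>x. G (Gi x) = x"
    "\<And>x. x \<notin> K \<Longrightarrow> G x = x"
  shows "lift U \<phi> G \<in> Diffeo r M A"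
proof -
  have inj: "inj G" "inj Gi" using G(3,4) by (metis injI)+
  have Gi: "Gi x = x" if "x \<notin> K" for x using G(3,5) that by metis
  note 1 = lift_Cr_map[OF M c K G(1) inj(1) G(5)] and 2 = lift_Cr_map[OF M c K G(2) inj(2) Gi]
  have inv: "lift U \<phi> H (lift U \<phi> H' x) = x"
    if "x \<in> topspace M" "\<And>y. H (H' y) = y" "H' ` (\<phi> ` U) \<subseteq> \<phi> ` U" for H H' x
  proof (cases "x \<in> U")
    case True
    then have "H' (\<phi> x) \<in> \<phi> ` U" using that(3) by blast
    then show ?thesis
      using True that(1,2) chart_inv[OF c] chart_subset[OF c] by (auto simp: lift_def)
  qed (use that(1) in \<open>simp add: lift_def\<close>)
  show ?thesis
  proof (rule DiffeoI[where g = "lift U \<phi> Gi"])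
    show "lift U \<phi> G \<in> extensional (topspace M)" by (simp add: lift_def)
    show "Cr_map r M A (lift U \<phi> G)" by (rule 1)
    show "Cr_map r M A (lift U \<phi> Gi)" by (rule 2)
    fix x assume x: "x \<in> topspace M"
    show "lift U \<phi> Gi (lift U \<phi> G x) = x" by (rule inv[OF x G(3) 1(2)])
    show "lift U \<phi> G (lift U \<phi> Gi x) = x" by (rule inv[OF x G(4) 2(2)])
  qed
qed

text \<open>The infinitely many fixed points on the ray force the derivative of \<open>f\<close> at \<open>p\<close> to fix the direction
  of the ray.\<close>

lemma Diffeo_ray:
  assumes M: "Hausdorff_space M" and f: "f \<in> Diffeo r M A" and r: "1 \<le> r" and c: "(U, \<phi>) \<in> A"
    and p: "p \<in> \<phi> ` U" and e: "norm e = 1"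
    and t: "\<And>n. t n > 0" "t \<longlonglongrightarrow> 0" "\<And>n. p + t n *\<^sub>R e \<in> \<phi> ` U"
    and t': "t' \<longlonglongrightarrow> 0" "\<And>n. p + t' n *\<^sub>R e \<in> \<phi> ` U"
    and ft: "\<And>n. f (inv_into U \<phi> (p + t n *\<^sub>R e)) = inv_into U \<phi> (p + t' n *\<^sub>R e)"
    and inf: "infinite {n. t n = t' n}"
  shows "(\<lambda>n. t' n / t n) \<longlonglongrightarrow> 1"
proof -
  let ?i = "inv_into U \<phi>"
  have lim: "limitin M (\<lambda>n. ?i (p + s n *\<^sub>R e)) (?i p) sequentially"
    if "s \<longlonglongrightarrow> 0" "\<And>n. p + s n *\<^sub>R e \<in> \<phi> ` U" for s
  proof -
    have "(\<lambda>n. p + s n *\<^sub>R e) \<longlonglongrightarrow> p + 0 *\<^sub>R e" using that(1) by (intro tendsto_intros)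
    then have "limitin (top_of_set (\<phi> ` U)) (\<lambda>n. p + s n *\<^sub>R e) p sequentially"
      using that(2) p by (simp add: limitin_subtopology)
    then show ?thesis
      using continuous_map_limit[OF chart_inv_continuous[OF c]] by (simp add: comp_def)
  qed
  have cf: "continuous_map M M f" using DiffeoD(2)[OF f] by (rule Cr_map_continuous)
  have "limitin M (\<lambda>n. f (?i (p + t n *\<^sub>R e))) (f (?i p)) sequentially"
    using continuous_map_limit[OF cf lim[OF t(2,3)]] by (simp add: comp_def)
  then have "limitin M (\<lambda>n. ?i (p + t' n *\<^sub>R e)) (f (?i p)) sequentially" unfolding ft .
  \<comment> \<open>Both sequences on the ray tend to the point over \<open>p\<close>, and limits in
    \<open>M\<close> are unique.\<close>
  then have fp: "f (?i p) = ?i p"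
    by (rule limitin_Hausdorff_unique[OF _ lim[OF t'] sequentially_bot M])
  define H where "H = \<phi> \<circ> f \<circ> ?i"
  have Hp: "H p = p" using chart_inv(2)[OF c p] by (simp add: H_def fp)
  have "Cr_on r (\<phi> ` (U \<inter> f -` U)) H"
    unfolding H_def by (rule Cr_mapD[OF DiffeoD(2)[OF f] c c])
  then have "Ck_on (Suc 0) (\<phi> ` (U \<inter> f -` U)) H"
    using r unfolding Cr_on_def by (metis One_nat_def one_enat_def)
  moreover have "p \<in> \<phi> ` (U \<inter> f -` U)"
    using chart_inv(2,3)[OF c p] fp by (metis IntI image_eqI vimageI)
  ultimately have "H differentiable (at p)" unfolding Ck_on.simps by blast
  then obtain L where L: "(H has_derivative L) (at p)" by (auto simp: differentiable_def)
  then have bl: "bounded_linear L" by (rule has_derivative_bounded_linear)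
  have "(\<lambda>h. norm (H (p + h) - H p - L h) / norm h) \<midarrow>0\<rightarrow> 0"
    using L by (simp add: has_derivative_at)
  moreover have "filterlim (\<lambda>n. t n *\<^sub>R e) (at 0) sequentially"
  proof -
    have "(\<lambda>n. t n *\<^sub>R e) \<longlonglongrightarrow> 0 *\<^sub>R e" using t(2) by (intro tendsto_intros)
    moreover have "t n *\<^sub>R e \<noteq> 0" for n using t(1)[of n] e by auto
    ultimately show ?thesis by (simp add: filterlim_at)
  qed
  ultimately have "(\<lambda>n. norm (H (p + t n *\<^sub>R e) - H p - L (t n *\<^sub>R e)) / norm (t n *\<^sub>R e)) \<longlonglongrightarrow> 0"
    by (rule filterlim_compose)
  moreover have "norm (H (p + t n *\<^sub>R e) - H p - L (t n *\<^sub>R e)) / norm (t n *\<^sub>R e)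
      = norm ((t' n / t n) *\<^sub>R e - L e)" for n
  proof -
    have "H (p + t n *\<^sub>R e) = p + t' n *\<^sub>R e"
      using chart_inv(2)[OF c t'(2)] by (simp add: H_def ft)
    then have "H (p + t n *\<^sub>R e) - H p - L (t n *\<^sub>R e) = t n *\<^sub>R ((t' n / t n) *\<^sub>R e - L e)"
      using t(1)[of n] by (simp add: Hp linear_scale[OF bounded_linear.linear[OF bl]] algebra_simps)
    then show ?thesis using t(1)[of n] e by simp
  qed
  ultimately have "(\<lambda>n. (t' n / t n) *\<^sub>R e - L e) \<longlonglongrightarrow> 0"
    by (simp add: tendsto_norm_zero_iff)
  then have lim': "(\<lambda>n. (t' n / t n) *\<^sub>R e) \<longlonglongrightarrow> L e" by (simp add: LIM_zero_cancel)
  have "L e = e"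
  proof (rule ccontr)
    assume "L e \<noteq> e"
    then have "\<forall>\<^sub>F n in sequentially. (t' n / t n) *\<^sub>R e \<noteq> e"
      using lim' by (rule tendsto_imp_eventually_ne[rotated])
    then obtain m where m: "\<And>n. n \<ge> m \<Longrightarrow> (t' n / t n) *\<^sub>R e \<noteq> e"
      by (auto simp: eventually_sequentially)
    obtain n where "n \<ge> m" "t n = t' n" using inf by (auto simp: infinite_nat_iff_unbounded_le)
    then show False using m[of n] t(1)[of n] by simp
  qed
  then have "(\<lambda>n. ((t' n / t n) *\<^sub>R e) \<bullet> e) \<longlonglongrightarrow> e \<bullet> e"
    using lim' by (intro tendsto_intros) simp
  then show ?thesis using e by (simp add: dot_square_norm)
qed

end

section \<open>Generic behaviour on the Baire space\<close>

definition meager :: "'a::topological_space set \<Rightarrow> bool" where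
  "meager A \<longleftrightarrow> (\<exists>F::nat \<Rightarrow> 'a set. (\<forall>n. closed (F n) \<and> interior (F n) = {}) \<and> A \<subseteq> (\<Union>n. F n))"

text \<open>This is the property of Baire: open up to a meager set.\<close>

definition almost_open :: "'a::topological_space set \<Rightarrow> bool" where
  "almost_open A \<longleftrightarrow> (\<exists>U. open U \<and> meager (A - U) \<and> meager (U - A))"

lemma meager_subset: "meager B \<Longrightarrow> A \<subseteq> B \<Longrightarrow> meager A"
  unfolding meager_def by (meson subset_trans)

lemma meager_closed: "closed F \<Longrightarrow> interior F = {} \<Longrightarrow> meager F"
  unfolding meager_def by (intro exI[of _ "\<lambda>_. F"]) auto

lemma meager_UN:
  fixes A :: "'i::countable \<Rightarrow> 'a::topological_space set"
  assumes "\<And>i. meager (A i)"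
  shows "meager (\<Union>i. A i)"
proof -
  obtain F :: "'i \<Rightarrow> nat \<Rightarrow> 'a set" where F: "\<And>i n. closed (F i n) \<and> interior (F i n) = {}"
    "\<And>i. A i \<subseteq> (\<Union>n. F i n)"
    using assms unfolding meager_def by metis
  define G where "G k = (case prod_decode k of (i, n) \<Rightarrow> F (from_nat i) n)" for k
  have "A i \<subseteq> (\<Union>k. G k)" for i
  proof
    fix x assume "x \<in> A i"
    then obtain n where "x \<in> F i n" using F(2) by blast
    then have "x \<in> G (prod_encode (to_nat i, n))" by (simp add: G_def)
    then show "x \<in> (\<Union>k. G k)" by blast
  qed
  moreover have "closed (G k) \<and> interior (G k) = {}" for k
    using F(1) by (auto simp: G_def split: prod.split)
  ultimately show ?thesis unfolding meager_def by (intro exI[of _ G]) auto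
qed

lemma meager_UN_countable:
  assumes "countable I" "\<And>i. i \<in> I \<Longrightarrow> meager (A i)"
  shows "meager (\<Union>i\<in>I. A i)"
proof (cases "I = {}")
  case True
  then show ?thesis by (simp add: meager_closed)
next
  case False
  have "(\<Union>i\<in>I. A i) = (\<Union>n::nat. A (from_nat_into I n))"
    using range_from_nat_into[OF False assms(1)] by (metis image_image)
  then show ?thesis
    using meager_UN[of "\<lambda>n. A (from_nat_into I n)"] assms(2) False from_nat_into by metis
qed

lemma meager_Un: "meager A \<Longrightarrow> meager B \<Longrightarrow> meager (A \<union> B)"
  using meager_UN[of "\<lambda>b. if b then A else B"] by (simp add: UNIV_bool Un_commute)

text \<open>A continuous involution is a homeomorphism, so it preserves closed sets with empty
  interior. The symmetries transported by it below are all involutions, which avoids naming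
  inverses.\<close>

lemma meager_vimage_involution:
  assumes "meager A" "continuous_on UNIV T" "\<And>x. T (T x) = x"
  shows "meager (T -` A)"
proof -
  obtain F :: "nat \<Rightarrow> _ set" where F: "\<And>n. closed (F n)" "\<And>n. interior (F n) = {}" "A \<subseteq> (\<Union>n. F n)"
    using assms(1) unfolding meager_def by auto
  have "interior (T -` F n) = {}" for n
  proof -
    let ?U = "interior (T -` F n)"
    have "open (T -` ?U)" using assms(2) open_interior by (simp add: open_vimage)
    moreover have "T -` ?U \<subseteq> F n" using interior_subset[of "T -` F n"] assms(3) by (metis subsetI subset_eq vimage_eq)
    ultimately have "T -` ?U \<subseteq> {}" using F(2) interior_maximal by metis
    then show ?thesis using assms(3) by (metis all_not_in_conv subset_empty vimage_eq)
  qed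
  moreover have "closed (T -` F n)" for n
    using F(1) assms(2) by (simp add: closed_vimage)
  moreover have "T -` A \<subseteq> (\<Union>n. T -` F n)" using F(3) by blast
  ultimately show ?thesis unfolding meager_def
    by (intro exI[of _ "\<lambda>n. T -` F n"]) simp
qed

lemma almost_open_open: "open U \<Longrightarrow> almost_open U"
  unfolding almost_open_def by (auto simp: meager_closed)

text \<open>The complement of \<open>closure U\<close> serves as the open set; what is lost is the
  boundary of \<open>U\<close>, which is closed with empty interior.\<close>

lemma almost_open_Compl:
  assumes "almost_open A"
  shows "almost_open (- A)"
proof -
  obtain U where U: "open U" "meager (A - U)" "meager (U - A)"
    using assms unfolding almost_open_def by auto
  have "interior (closure U - U) = {}"
  proof -
    let ?V = "interior (closure U - U)"
    have "?V \<inter> U = {}" using interior_subset by fastforce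
    then have "?V \<inter> closure U = {}" by (simp add: open_Int_closure_eq_empty)
    then show ?thesis using interior_subset by fastforce
  qed
  moreover have "closed (closure U - U)" using U(1) by (simp add: closed_Diff)
  ultimately have m: "meager (closure U - U)" by (rule meager_closed[rotated])
  have "- A - (- closure U) \<subseteq> (closure U - U) \<union> (U - A)" by auto
  then have "meager (- A - (- closure U))"
    using meager_Un[OF m U(3)] meager_subset by blast
  moreover have "(- closure U) - (- A) \<subseteq> A - U" using closure_subset by fastforce
  then have "meager ((- closure U) - (- A))" using U(2) meager_subset by blast
  ultimately show ?thesis unfolding almost_open_def
    by (intro exI[of _ "- closure U"]) auto
qed

lemma almost_open_UN:
  fixes A :: "nat \<Rightarrow> 'a::topological_space set"
  assumes "\<And>i. almost_open (A i)"
  shows "almost_open (\<Union>i. A i)"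
proof -
  obtain U where U: "\<And>i. open (U i)" "\<And>i. meager (A i - U i)" "\<And>i. meager (U i - A i)"
    using assms unfolding almost_open_def by metis
  have "meager ((\<Union>i. A i) - (\<Union>i. U i))"
    by (rule meager_subset[OF meager_UN[of "\<lambda>i. A i - U i", OF U(2)]]) auto
  moreover have "meager ((\<Union>i. U i) - (\<Union>i. A i))"
    by (rule meager_subset[OF meager_UN[of "\<lambda>i. U i - A i", OF U(3)]]) auto
  ultimately show ?thesis using U(1) unfolding almost_open_def
    by (intro exI[of _ "\<Union>i. U i"]) auto
qed

lemma almost_open_borel:
  assumes "A \<in> sets borel"
  shows "almost_open A"
proof -
  have "A \<in> sigma_sets UNIV {S. open S}"
    using assms by (simp add: borel_def)
  then show ?thesis
  proof induction
    case Empty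
    show ?case by (simp add: almost_open_open)
  next
    case (Compl a)
    then show ?case using almost_open_Compl by (simp add: Compl_eq_Diff_UNIV)
  qed (auto intro: almost_open_open almost_open_UN)
qed

text \<open>By the property of Baire, a non-meager Borel set is comeager in some open set. This is
  how a frequent value of a function becomes its generic value on a cylinder.\<close>

lemma nonmeager_localize:
  assumes "A \<in> sets borel" "open S" "\<not> meager (S \<inter> A)"
  obtains V where "open V" "V \<noteq> {}" "V \<subseteq> S" "meager (V - A)"
proof -
  obtain U where U: "open U" "meager (A - U)" "meager (U - A)"
    using almost_open_borel[OF assms(1)] unfolding almost_open_def by auto
  have "S \<inter> U \<noteq> {}"
  proof
    assume "S \<inter> U = {}"
    then have "S \<inter> A \<subseteq> A - U" by auto
    then show False using U(2) assms(3) meager_subset by blast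
  qed
  moreover have "meager (S \<inter> U - A)" using U(3) by (rule meager_subset) auto
  ultimately show ?thesis using that[of "S \<inter> U"] U(1) assms(2) by auto
qed

section \<open>Cylinders and the Baire category theorem\<close>

type_synonym baire = "nat \<Rightarrow> nat"

text \<open>A cylinder is named by a full sequence of which only the first \<open>k\<close> entries
  count, so that centres can be changed by function update.\<close>

definition cylinder :: "nat \<Rightarrow> baire \<Rightarrow> baire set" where
  "cylinder k b = {z. \<forall>n<k. z n = b n}"

lemma in_cylinder_self [simp]: "b \<in> cylinder k b"
  by (simp add: cylinder_def)

lemma cylinder_mono: "k \<le> m \<Longrightarrow> cylinder m b \<subseteq> cylinder k b"
  by (auto simp: cylinder_def)

lemma open_cylinder: "open (cylinder k b)"
proof -
  have "cylinder k b = (\<Inter>n\<in>{..<k}. (\<lambda>z. z n) -` {b n})"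
    by (auto simp: cylinder_def)
  moreover have "open ((\<lambda>z::baire. z n) -` {b n})" for n
    by (intro open_vimage continuous_on_product_coordinates) (simp add: open_discrete)
  ultimately show ?thesis by auto
qed

lemma open_contains_cylinder:
  assumes "open S" "b \<in> S"
  obtains k where "cylinder k b \<subseteq> S"
proof -
  have "openin (product_topology (\<lambda>_. euclidean) UNIV) S"
    using assms(1) by (simp add: open_fun_def)
  then obtain X where X: "finite {i. X i \<noteq> (UNIV::nat set)}" "b \<in> Pi\<^sub>E UNIV X" "Pi\<^sub>E UNIV X \<subseteq> S"
    using assms(2) unfolding openin_product_topology_alt by force
  obtain k where k: "\<forall>i\<in>{i. X i \<noteq> UNIV}. i < k"
    using X(1) finite_nat_set_iff_bounded by auto
  have "cylinder k b \<subseteq> Pi\<^sub>E UNIV X"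
  proof
    fix z assume z: "z \<in> cylinder k b"
    have "z i \<in> X i" for i
    proof (cases "i < k")
      case True
      then show ?thesis using z X(2) by (auto simp: cylinder_def PiE_def Pi_def)
    next
      case False
      then show ?thesis using k by auto
    qed
    then show "z \<in> Pi\<^sub>E UNIV X" by auto
  qed
  then show ?thesis using that X(3) by blast
qed

lemma open_meager_empty:
  fixes U :: "baire set"
  assumes "open U" "meager U"
  shows "U = {}"
proof -
  obtain F :: "nat \<Rightarrow> baire set" where F: "\<And>n. closed (F n)" "\<And>n. interior (F n) = {}" "U \<subseteq> (\<Union>n. F n)"
    using assms(2) unfolding meager_def by auto
  have "(euclidean :: nat topology) = discrete_topology UNIV"
    by (simp add: topology_eq open_discrete)
  then have cm: "completely_metrizable_space (euclidean :: baire topology)"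
    by (simp add: completely_metrizable_space_product_topology completely_metrizable_space_discrete_topology
        flip: euclidean_product_topology)
  have "euclidean interior_of \<Union>(range F) = ({}::baire set)"
  proof (rule Baire_category_alt)
    show "completely_metrizable_space (euclidean :: baire topology) \<or>
      locally_compact_space (euclidean :: baire topology) \<and> regular_space (euclidean :: baire topology)"
      using cm by simp
    show "countable (range F)" by simp
    fix T assume "T \<in> range F"
    then show "closedin euclidean T \<and> euclidean interior_of T = {}"
      using F by auto
  qed
  then have "interior (\<Union>n. F n) = {}" by simp
  then show ?thesis using F(3) assms(1) interior_maximal by blast
qed

lemma cylinder_not_meager: "\<not> meager (cylinder k b)"
  using open_meager_empty[OF open_cylinder] in_cylinder_self by blast

section \<open>Coordinatewise moves\<close>

lemma continuous_on_baire:
  fixes T :: "baire \<Rightarrow> baire"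
  assumes "\<And>n. \<exists>h. \<forall>z. T z n = h (z n)"
  shows "continuous_on UNIV T"
proof (rule continuous_on_coordinatewise_then_product)
  fix n
  obtain h where h: "\<And>z. T z n = h (z n)" using assms by blast
  have "continuous_on UNIV (h \<circ> (\<lambda>z::baire. z n))"
    by (intro continuous_on_compose continuous_on_product_coordinates) (simp add: continuous_on_discrete)
  then show "continuous_on UNIV (\<lambda>z. T z n)" by (simp add: h comp_def)
qed

text \<open>Only the parities of \<open>q\<close> matter, so \<open>q\<close> encodes an element of
  a product of groups of order two. Letting \<open>q\<close> range over all of Baire space puts
  moves and points in the same space, and the same category lemmas apply to both.\<close>

definition act :: "(nat \<Rightarrow> nat) \<Rightarrow> baire \<Rightarrow> baire \<Rightarrow> baire" where
  "act \<sigma> q x = (\<lambda>n. if odd (q n) then \<sigma> (x n) else x n)"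

definition swap_even :: "nat \<Rightarrow> nat" where
  "swap_even m = (if even m then m + 1 else m - 1)"

text \<open>The matching {1,2}, {3,4}, ... with 0 left alone; together with {0,1}, {2,3}, ... from
  \<open>swap_even\<close> it joins any two consecutive numbers.\<close>

definition swap_odd :: "nat \<Rightarrow> nat" where
  "swap_odd m = (if m = 0 then 0 else if odd m then m + 1 else m - 1)"

lemma swap_even_invol: "swap_even (swap_even m) = m"
  by (auto simp: swap_even_def)

lemma swap_odd_invol: "swap_odd (swap_odd m) = m"
  by (auto simp: swap_odd_def) 

text \<open>This gives \<open>swap_even\<close> a second role: applied to an entry of a move
  \<open>q\<close>, it switches the move in that coordinate on or off.\<close>

lemma odd_swap_even: "odd (swap_even m) \<longleftrightarrow> even m"
  by (auto simp: swap_even_def)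

lemma continuous_act1: "continuous_on UNIV (act \<sigma> q)"
proof (rule continuous_on_baire)
  fix n show "\<exists>h. \<forall>z. act \<sigma> q z n = h (z n)"
    by (intro exI[of _ "\<lambda>m. if odd (q n) then \<sigma> m else m"]) (simp add: act_def)
qed

lemma continuous_act2: "continuous_on UNIV (\<lambda>q. act \<sigma> q x)"
proof (rule continuous_on_baire)
  fix n show "\<exists>h. \<forall>q. act \<sigma> q x n = h (q n)"
    by (intro exI[of _ "\<lambda>m. if odd m then \<sigma> (x n) else x n"]) (simp add: act_def)
qed

lemma continuous_upd: "continuous_on UNIV (\<lambda>z::baire. z(j := \<sigma> (z j)))"
proof (rule continuous_on_baire)
  fix n show "\<exists>h. \<forall>z. (z(j := \<sigma> (z j))) n = h (z n)"
    by (intro exI[of _ "if n = j then \<sigma> else id"]) auto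
qed

lemma act_invol: "(\<And>m. \<sigma> (\<sigma> m) = m) \<Longrightarrow> act \<sigma> q (act \<sigma> q x) = x"
  by (auto simp: act_def)

text \<open>A Kuratowski--Ulam theorem for the single meager set \<open>B\<close>.\<close>

lemma act_avoids_meager:
  assumes inv: "\<And>m. \<sigma> (\<sigma> m) = m" and B: "meager B" and S: "open S" "S \<noteq> {}"
  obtains x where "x \<in> S" "meager {q. act \<sigma> q x \<in> B}"
proof -
  obtain F :: "nat \<Rightarrow> baire set" where F: "\<And>n. closed (F n)" "\<And>n. interior (F n) = {}" "B \<subseteq> (\<Union>n. F n)"
    using B unfolding meager_def by auto
  \<comment> \<open>Finite lists, padded with zeros, name countably many cylinders that form a base,
    so only countably many conditions \<open>D n l\<close> have to hold at \<open>x\<close>.\<close>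
  define w where "w l = (\<lambda>n. if n < length l then l ! n else (0::nat))" for l
  define D where "D n l = {x. \<exists>q\<in>cylinder (length l) (w l). act \<sigma> q x \<notin> F n}" for n l
  have mD: "meager (- D n l)" for n l
  proof (rule meager_closed)
    have "D n l = (\<Union>q\<in>cylinder (length l) (w l). act \<sigma> q -` (- F n))"
      by (auto simp: D_def)
    moreover have "open (act \<sigma> q -` (- F n))" for q
      using F(1) continuous_act1 by (simp add: open_vimage open_Compl)
    ultimately have "open (D n l)" by auto
    then show "closed (- D n l)" by (simp add: closed_Compl)
    have "U = {}" if "open U" "U \<subseteq> - D n l" for U
    proof -
      \<comment> \<open>The move given by \<open>w l\<close> is its own inverse and carries an open
        set outside \<open>D n l\<close> into \<open>F n\<close>, which has empty interior.\<close>
      have "act \<sigma> (w l) -` U \<subseteq> F n"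
      proof
        fix y assume "y \<in> act \<sigma> (w l) -` U"
        then have "act \<sigma> (w l) y \<notin> D n l" using that(2) by auto
        then have "act \<sigma> (w l) (act \<sigma> (w l) y) \<in> F n" by (auto simp: D_def)
        then show "y \<in> F n" by (simp add: act_invol inv)
      qed
      moreover have "open (act \<sigma> (w l) -` U)"
        using that(1) continuous_act1 by (simp add: open_vimage)
      ultimately have "act \<sigma> (w l) -` U = {}" using F(2) interior_maximal by blast
      then show ?thesis by (metis act_invol inv all_not_in_conv vimage_eq)
    qed
    then show "interior (- D n l) = {}" using interior_subset open_interior by blast
  qed
  have "meager (\<Union>p. - D (fst p) (snd p))" by (rule meager_UN) (rule mD)
  then have "\<not> S \<subseteq> (\<Union>p. - D (fst p) (snd p))"
    using S open_meager_empty meager_subset by blast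
  then obtain x where x: "x \<in> S" "\<And>n l. x \<in> D n l" by fastforce
  have "interior {q. act \<sigma> q x \<in> F n} = {}" for n
  proof (rule ccontr)
    assume "interior {q. act \<sigma> q x \<in> F n} \<noteq> {}"
    then obtain b where "b \<in> interior {q. act \<sigma> q x \<in> F n}" by auto
    then obtain k where k: "cylinder k b \<subseteq> interior {q. act \<sigma> q x \<in> F n}"
      using open_contains_cylinder[OF open_interior] by metis
    define l where "l = map b [0..<k]"
    have "cylinder (length l) (w l) = cylinder k b" by (auto simp: cylinder_def w_def l_def)
    then obtain q where "q \<in> cylinder k b" "act \<sigma> q x \<notin> F n" using x(2)[of n l] by (auto simp: D_def)
    then show False using k interior_subset by blast
  qed
  moreover have "closed {q. act \<sigma> q x \<in> F n}" for n
    using closed_vimage[OF F(1) continuous_act2] by (simp add: vimage_def)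
  ultimately have "meager {q. act \<sigma> q x \<in> B}"
    unfolding meager_def using F(3) by (intro exI[of _ "\<lambda>n. {q. act \<sigma> q x \<in> F n}"]) auto
  with x(1) show ?thesis using that by blast
qed

section \<open>Generic invariance and the zero-one law\<close>

lemma borel_neq_comp:
  fixes f :: "baire \<Rightarrow> nat \<Rightarrow> bool"
  assumes "\<And>i. {z. f z i} \<in> sets borel" "continuous_on UNIV T"
  shows "{z. f z \<noteq> f (T z)} \<in> sets borel"
proof -
  have T: "T \<in> borel_measurable borel" using assms(2) by (rule borel_measurable_continuous_onI)
  have "{z. f (T z) i} \<in> sets borel" for i
    using measurable_sets[OF T assms(1)[of i]] by (simp add: vimage_def)
  moreover have "{z. f z \<noteq> f (T z)} =
    (\<Union>i. ({z. f z i} - {z. f (T z) i}) \<union> ({z. f (T z) i} - {z. f z i}))"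
    by (auto simp: fun_eq_iff)
  ultimately show ?thesis using assms(1) by auto
qed

lemma borel_eq_comp:
  fixes f :: "baire \<Rightarrow> nat \<Rightarrow> bool"
  assumes "\<And>i. {z. f z i} \<in> sets borel" "continuous_on UNIV T"
  shows "{z. f (T z) = y} \<in> sets borel"
proof -
  have T: "T \<in> borel_measurable borel" using assms(2) by (rule borel_measurable_continuous_onI)
  have 1: "{z. f (T z) i} \<in> sets borel" for i
    using measurable_sets[OF T assms(1)[of i]] by (simp add: vimage_def)
  have "{z. f (T z) i = y i} \<in> sets borel" for i
  proof (cases "y i")
    case True
    then show ?thesis using 1 by simp
  next
    case False
    then have "{z. f (T z) i = y i} = - {z. f (T z) i}" by auto
    then show ?thesis using 1[of i] borel_comp by metis
  qed
  moreover have "{z. f (T z) = y} = (\<Inter>i. {z. f (T z) i = y i})"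
    by (auto simp: fun_eq_iff)
  ultimately show ?thesis by auto
qed

text \<open>If invariance failed on every cylinder, arbitrarily late single moves would change
  \<open>f\<close> at a generic point of \<open>S\<close>, hence at comeagerly many points of a
  suitable orbit (those that stay in \<open>S\<close>). But \<open>f\<close> has countably many
  values on that orbit, so one value \<open>y\<close> is taken by comeagerly many moves
  \<open>q\<close> of some cylinder, and switching a late entry of such a \<open>q\<close>
  generically leaves the value unchanged.\<close>

lemma generic_invariance:
  fixes f :: "baire \<Rightarrow> nat \<Rightarrow> bool"
  assumes inv: "\<And>m. \<sigma> (\<sigma> m) = m" and f: "\<And>i. {z. f z i} \<in> sets borel"
    and cnt: "\<And>x. countable (range (\<lambda>q. f (act \<sigma> q x)))"
    and S: "open S" "S \<noteq> {}"
  shows "\<exists>k b. cylinder k b \<subseteq> S \<and>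
    (\<forall>j\<ge>k. meager (cylinder k b \<inter> {z. f z \<noteq> f (z(j := \<sigma> (z j)))}))"
proof (rule ccontr)
  assume result: "\<not> ?thesis"
  then have neg: "\<exists>j\<ge>k. \<not> meager (cylinder k b \<inter> {z. f z \<noteq> f (z(j := \<sigma> (z j)))})"
    if "cylinder k b \<subseteq> S" for k b using that result by blast
  define D where "D j = {z. f z \<noteq> f (z(j := \<sigma> (z j)))}" for j
  define W where "W k = (\<Union>j\<in>{k..}. D j)" for k
  have D: "D j \<in> sets borel" for j
    unfolding D_def by (rule borel_neq_comp[OF f continuous_upd])
  have W: "W k \<in> sets borel" for k unfolding W_def using D by auto
  \<comment> \<open>Otherwise some open set would almost avoid \<open>W k\<close>. In it lies a
    cylinder of depth at least \<open>k\<close>, and by \<open>neg\<close> some move of index at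
    least that depth changes \<open>f\<close> on a non-meager part of it.\<close>
  have mW: "meager (S - W k)" for k
  proof (rule ccontr)
    assume "\<not> meager (S - W k)"
    then have "\<not> meager (S \<inter> - W k)" by (simp add: Diff_eq)
    then obtain V where V: "open V" "V \<noteq> {}" "V \<subseteq> S" "meager (V - - W k)"
      using nonmeager_localize[OF borel_comp[OF W] S(1)] by blast
    then obtain b where "b \<in> V" by auto
    then obtain k' where "cylinder k' b \<subseteq> V" using V(1) open_contains_cylinder by blast
    then have c: "cylinder (max k k') b \<subseteq> V" using cylinder_mono[of k' "max k k'"] by auto
    then obtain j where "j \<ge> max k k'" "\<not> meager (cylinder (max k k') b \<inter> D j)"
      using neg[OF subset_trans[OF c V(3)]] unfolding D_def by blast
    moreover have "cylinder (max k k') b \<inter> D j \<subseteq> V - - W k"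
      using c \<open>j \<ge> max k k'\<close> by (auto simp: W_def)
    ultimately show False using V(4) meager_subset by blast
  qed
  define B where "B = (\<Union>k. S - W k)"
  have mB: "meager B" unfolding B_def by (rule meager_UN) (rule mW)
  obtain b0 where "b0 \<in> S" using S by auto
  then obtain m where m: "cylinder m b0 \<subseteq> S" using S(1) open_contains_cylinder by blast
  obtain x where x: "x \<in> cylinder m b0" "meager {q. act \<sigma> q x \<in> B}"
    using act_avoids_meager[OF inv mB open_cylinder[of m b0]] in_cylinder_self by blast
  \<comment> \<open>Zero is even, so such a move leaves the first \<open>m\<close> coordinates of
    \<open>x\<close> alone.\<close>
  have actS: "act \<sigma> q x \<in> S" if "q \<in> cylinder m (\<lambda>_. 0)" for q
    using that x(1) m by (auto simp: cylinder_def act_def)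
  define Q where "Q y = {q. f (act \<sigma> q x) = y}" for y
  have Q: "Q y \<in> sets borel" for y
    unfolding Q_def by (rule borel_eq_comp[OF f continuous_act2])
  have "\<exists>y\<in>range (\<lambda>q. f (act \<sigma> q x)). \<not> meager (cylinder m (\<lambda>_. 0) \<inter> Q y)"
  proof (rule ccontr)
    assume "\<not> ?thesis"
    then have "meager (\<Union>y\<in>range (\<lambda>q. f (act \<sigma> q x)). cylinder m (\<lambda>_. 0) \<inter> Q y)"
      by (intro meager_UN_countable cnt) auto
    then have "meager (cylinder m (\<lambda>_. 0))"
      by (rule meager_subset) (auto simp: Q_def)
    then show False using cylinder_not_meager by blast
  qed
  then obtain y where "\<not> meager (cylinder m (\<lambda>_. 0) \<inter> Q y)" by blast
  then obtain V where V: "open V" "V \<noteq> {}" "V \<subseteq> cylinder m (\<lambda>_. 0)" "meager (V - Q y)"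
    using nonmeager_localize[OF Q open_cylinder] by blast
  obtain b where "b \<in> V" using V(2) by auto
  then obtain k where k: "cylinder k b \<subseteq> V" using V(1) open_contains_cylinder by blast
  \<comment> \<open>Toggling the j-th entry of a move amounts to one further single move of the
    point; see \<open>act_t\<close>.\<close>
  define t where "t j q = q(j := swap_even (q j))" for j and q :: baire
  have "meager (t j -` (V - Q y))" for j
    by (rule meager_vimage_involution[OF V(4)])
      (auto simp: t_def swap_even_invol intro: continuous_upd)
  then have "meager (\<Union>j. t j -` (V - Q y))" by (rule meager_UN)
  then have "meager ((V - Q y) \<union> (\<Union>j. t j -` (V - Q y)) \<union> {q. act \<sigma> q x \<in> B})"
    using V(4) x(2) meager_Un by blast
  \<comment> \<open>The move \<open>q\<close> avoids countably many meager sets at once: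
    \<open>q\<close> and those of its toggles that stay in \<open>V\<close> give the value
    \<open>y\<close>, and \<open>act \<sigma> q x\<close> is outside the exceptional set
    \<open>B\<close>.\<close>
  then have "\<not> cylinder k b \<subseteq> ((V - Q y) \<union> (\<Union>j. t j -` (V - Q y)) \<union> {q. act \<sigma> q x \<in> B})"
    using cylinder_not_meager meager_subset by blast
  then obtain q where q: "q \<in> cylinder k b" "q \<notin> V - Q y" "\<And>j. t j q \<notin> V - Q y" "act \<sigma> q x \<notin> B"
    by blast
  have "act \<sigma> q x \<in> W k" using q(1,4) k V(3) actS by (auto simp: B_def)
  then obtain j where j: "j \<ge> k" "f (act \<sigma> q x) \<noteq> f ((act \<sigma> q x)(j := \<sigma> (act \<sigma> q x j)))"
    by (auto simp: W_def D_def)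
  have act_t: "act \<sigma> (t j q) x = (act \<sigma> q x)(j := \<sigma> (act \<sigma> q x j))"
    by (auto simp: act_def t_def odd_swap_even inv fun_eq_iff)
  have "t j q \<in> cylinder k b" using q(1) j(1) by (auto simp: t_def cylinder_def)
  then have "f (act \<sigma> (t j q) x) = y" using k q(3)[of j] by (auto simp: Q_def)
  moreover have "f (act \<sigma> q x) = y" using k q(1,2) by (auto simp: Q_def)
  ultimately show False using j(2) act_t by simp
qed

text \<open>A zero-one law. Late single moves preserve \<open>A\<close> up to meager sets and
  connect any two cylinders of equal depth inside \<open>cylinder k b\<close>, so \<open>A\<close>
  is meager in all of these or in none.\<close>

lemma generic_invariance_01:
  assumes A: "A \<in> sets borel"
    and I: "\<And>j \<sigma>. j \<ge> k \<Longrightarrow> \<sigma> \<in> {swap_even, swap_odd} \<Longrightarrow>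
      meager (cylinder k b \<inter> {z. (z \<in> A) \<noteq> (z(j := \<sigma> (z j)) \<in> A)})"
  shows "meager (cylinder k b \<inter> A) \<or> meager (cylinder k b - A)"
proof (rule ccontr)
  assume neg: "\<not> ?thesis"
  have inv: "\<sigma> (\<sigma> m) = m" if "\<sigma> \<in> {swap_even, swap_odd}" for \<sigma> m
    using that swap_even_invol swap_odd_invol by auto
  have step: "meager (cylinder m (c(j := \<sigma> (c j))) \<inter> A)"
    if "meager (cylinder m c \<inter> A)" "c \<in> cylinder k b" "k \<le> m" "k \<le> j" "\<sigma> \<in> {swap_even, swap_odd}"
    for m c j \<sigma>
  proof (rule meager_subset)
    let ?T = "\<lambda>z::baire. z(j := \<sigma> (z j))"
    show "meager ((cylinder k b \<inter> {z. (z \<in> A) \<noteq> (?T z \<in> A)}) \<union> ?T -` (cylinder m c \<inter> A))"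
      using inv[OF that(5)] by (intro meager_Un I that meager_vimage_involution continuous_upd) auto
    have "z \<in> cylinder k b" "?T z \<in> cylinder m c" if "z \<in> cylinder m (c(j := \<sigma> (c j)))" for z
      using that \<open>c \<in> _\<close> \<open>k \<le> m\<close> \<open>k \<le> j\<close> inv[OF \<open>\<sigma> \<in> _\<close>] by (auto simp: cylinder_def)
    then show "cylinder m (c(j := \<sigma> (c j))) \<inter> A \<subseteq>
        (cylinder k b \<inter> {z. (z \<in> A) \<noteq> (?T z \<in> A)}) \<union> ?T -` (cylinder m c \<inter> A)"
      by fastforce
  qed
  \<comment> \<open>Both matchings are used here: the step from \<open>v\<close> to
    \<open>Suc v\<close> belongs to \<open>swap_even\<close> for even \<open>v\<close> and to
    \<open>swap_odd\<close> for odd \<open>v\<close>.\<close>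
  have succ: "\<exists>\<sigma>\<in>{swap_even, swap_odd}. \<sigma> v = Suc v" for v
    by (auto simp: swap_even_def swap_odd_def)
  have upd0: "meager (cylinder m (c(j := v)) \<inter> A) \<longleftrightarrow> meager (cylinder m (c(j := 0)) \<inter> A)"
    if "c \<in> cylinder k b" "k \<le> m" "k \<le> j" for m c j v
  proof (induction v)
    case (Suc v)
    obtain \<sigma> where \<sigma>: "\<sigma> \<in> {swap_even, swap_odd}" "\<sigma> v = Suc v" using succ by blast
    have "\<sigma> (Suc v) = v" using inv[OF \<sigma>(1), of v] \<sigma>(2) by simp
    moreover have c: "c(j := u) \<in> cylinder k b" for u using that by (auto simp: cylinder_def)
    ultimately have "meager (cylinder m (c(j := v)) \<inter> A) \<longleftrightarrow> meager (cylinder m (c(j := Suc v)) \<inter> A)"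
      using step[OF _ c that(2,3) \<sigma>(1), where u1 = v] step[OF _ c that(2,3) \<sigma>(1), where u1 = "Suc v"] \<sigma>(2)
      by (metis fun_upd_same fun_upd_upd)
    then show ?case using Suc by blast
  qed simp
  have upd: "meager (cylinder m (c(j := v)) \<inter> A)"
    if "meager (cylinder m c \<inter> A)" "c \<in> cylinder k b" "k \<le> m" "k \<le> j" for m c j v
    using upd0[OF that(2-4), of v] upd0[OF that(2-4), of "c j"] that(1) by simp
  have move: "meager (cylinder m c' \<inter> A)"
    if "meager (cylinder m c \<inter> A)" "c \<in> cylinder k b" "c' \<in> cylinder k b" "k \<le> m" for m c c'
  proof -
    \<comment> \<open>Entries of \<open>c\<close> are replaced by those of \<open>c'\<close> one at
      a time; entries below \<open>k\<close> agree already, and those from \<open>m\<close> on are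
      invisible to the cylinder.\<close>
    have "meager (cylinder m (\<lambda>n. if n < i then c' n else c n) \<inter> A)" for i
    proof (induction i)
      case 0
      then show ?case using that(1) by simp
    next
      case (Suc i)
      have eq: "(\<lambda>n. if n < Suc i then c' n else c n) = (\<lambda>n. if n < i then c' n else c n)(i := c' i)"
        by (auto simp: fun_eq_iff less_Suc_eq)
      show ?case
      proof (cases "i < k")
        case True
        then have "(\<lambda>n. if n < Suc i then c' n else c n) = (\<lambda>n. if n < i then c' n else c n)"
          using that(2,3) by (auto simp: fun_eq_iff less_Suc_eq cylinder_def)
        then show ?thesis using Suc by simp
      next
        case False
        have "(\<lambda>n. if n < i then c' n else c n) \<in> cylinder k b"
          using that(2,3) by (auto simp: cylinder_def)
        then show ?thesis unfolding eq using upd[OF Suc _ that(4)] False by simp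
      qed
    qed
    from this[of m] show ?thesis by (simp add: cylinder_def)
  qed
  from neg have "\<not> meager (cylinder k b \<inter> A)" "\<not> meager (cylinder k b \<inter> - A)" by (simp_all add: Diff_eq)
  then obtain V1 V2 where V: "open V1" "V1 \<noteq> {}" "V1 \<subseteq> cylinder k b" "meager (V1 - A)"
     "open V2" "V2 \<noteq> {}" "V2 \<subseteq> cylinder k b" "meager (V2 - - A)"
    using nonmeager_localize[OF A open_cylinder] nonmeager_localize[OF borel_comp[OF A] open_cylinder] by metis
  then obtain c1 c2 where c: "c1 \<in> V1" "c2 \<in> V2" by auto
  then obtain m1 m2 where m: "cylinder m1 c1 \<subseteq> V1" "cylinder m2 c2 \<subseteq> V2"
    using V open_contains_cylinder by metis
  define m where "m = max k (max m1 m2)"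
  have m': "cylinder m c1 \<subseteq> V1" "cylinder m c2 \<subseteq> V2"
    using m cylinder_mono[of m1 m c1] cylinder_mono[of m2 m c2] unfolding m_def by fastforce+
  have "meager (cylinder m c2 \<inter> A)" using V(8) m'(2) by (auto intro: meager_subset)
  then have "meager (cylinder m c1 \<inter> A)"
    using move[of m c2 c1] V c by (auto simp: m_def)
  moreover have "meager (cylinder m c1 - A)" using V(4) m'(1) by (auto intro: meager_subset)
  ultimately have "meager (cylinder m c1)"
    using meager_Un meager_subset[of "(cylinder m c1 \<inter> A) \<union> (cylinder m c1 - A)"] by blast
  then show False using cylinder_not_meager by blast
qed

text \<open>The zero-one law decides every bit of \<open>f\<close> separately, and the countably
  many exceptional sets are meager together.\<close>

lemma generically_constant:
  fixes f :: "baire \<Rightarrow> nat \<Rightarrow> bool"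
  assumes f: "\<And>i. {z. f z i} \<in> sets borel"
    and cnt: "\<And>\<sigma> x. \<sigma> \<in> {swap_even, swap_odd} \<Longrightarrow> countable (range (\<lambda>q. f (act \<sigma> q x)))"
  shows "\<exists>k b y. meager (cylinder k b \<inter> {z. f z \<noteq> y})"
proof -
  obtain k1 b1 where 1: "\<And>j. j \<ge> k1 \<Longrightarrow> meager (cylinder k1 b1 \<inter> {z. f z \<noteq> f (z(j := swap_even (z j)))})"
    using generic_invariance[OF swap_even_invol f cnt, of UNIV] by blast
  obtain k2 b2 where 2: "cylinder k2 b2 \<subseteq> cylinder k1 b1"
    "\<And>j. j \<ge> k2 \<Longrightarrow> meager (cylinder k2 b2 \<inter> {z. f z \<noteq> f (z(j := swap_odd (z j)))})"
    using generic_invariance[OF swap_odd_invol f cnt open_cylinder[of k1 b1]] in_cylinder_self by blast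
  \<comment> \<open>The second cylinder was found inside the first; its depth is raised once more so
    that both invariances hold for all indices from \<open>k\<close> on.\<close>
  define k where "k = max k1 k2"
  have sub: "cylinder k b2 \<subseteq> cylinder k1 b1" "cylinder k b2 \<subseteq> cylinder k2 b2"
    using 2(1) cylinder_mono[of k2 k b2] by (auto simp: k_def)
  have I: "meager (cylinder k b2 \<inter> {z. f z \<noteq> f (z(j := \<sigma> (z j)))})"
    if "j \<ge> k" "\<sigma> \<in> {swap_even, swap_odd}" for j \<sigma>
  proof (cases "\<sigma> = swap_even")
    case True
    then show ?thesis using 1[of j] that(1) sub(1) by (auto simp: k_def intro: meager_subset)
  next
    case False
    then have "\<sigma> = swap_odd" using that by auto
    then show ?thesis using 2(2)[of j] that(1) sub(2) by (auto simp: k_def intro: meager_subset)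
  qed
  have 01: "meager (cylinder k b2 \<inter> {z. f z i}) \<or> meager (cylinder k b2 - {z. f z i})" for i
  proof (rule generic_invariance_01[OF f])
    fix j :: nat and \<sigma> assume "j \<ge> k" "\<sigma> \<in> {swap_even, swap_odd}"
    from I[OF this] show "meager (cylinder k b2 \<inter> {z. (z \<in> {z. f z i}) \<noteq> (z(j := \<sigma> (z j)) \<in> {z. f z i})})"
      by (rule meager_subset) auto
  qed
  define y where "y i \<longleftrightarrow> \<not> meager (cylinder k b2 \<inter> {z. f z i})" for i
  have "meager (cylinder k b2 \<inter> {z. f z i \<noteq> y i})" for i
    using 01[of i] by (cases "y i") (auto simp: y_def Diff_eq Compl_eq)
  then have "meager (\<Union>i. cylinder k b2 \<inter> {z. f z i \<noteq> y i})" by (rule meager_UN)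
  then have "meager (cylinder k b2 \<inter> {z. f z \<noteq> y})"
    by (rule meager_subset) (auto simp: fun_eq_iff)
  then show ?thesis by blast
qed

text \<open>Both points come from one generic \<open>z\<close>: an involution \<open>T\<close> that
  preserves the cylinder and meagerness gives \<open>f (T z)\<close> the same generic value, and
  infinitely many odd entries of \<open>z\<close> are 0 for \<open>T\<close> to act on. The even
  entries stay untouched and supply the agreement that \<open>Diffeo_ray\<close> asks for.\<close>

lemma countable_image_gap:
  fixes f :: "baire \<Rightarrow> nat \<Rightarrow> bool" and N :: "nat \<Rightarrow> nat"
  assumes f: "\<And>i. {z. f z i} \<in> sets borel"
    and cnt: "\<And>\<sigma> x. \<sigma> \<in> {swap_even, swap_odd} \<Longrightarrow> countable (range (\<lambda>q. f (act \<sigma> q x)))"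
  obtains z z' where "f z = f z'" "\<And>n. even n \<Longrightarrow> z n = z' n"
    "infinite {n. odd n \<and> z n = 0 \<and> z' n = N n}"
proof -
  obtain k b y where K: "meager (cylinder k b \<inter> {z. f z \<noteq> y})"
    using generically_constant[OF assms] by blast
  \<comment> \<open>Exchanging just the two values 0 and \<open>N n\<close> gives an involution on
    all natural numbers; starting at \<open>k\<close> keeps \<open>T z\<close> in the
    cylinder.\<close>
  define T where "T z = (\<lambda>n. if odd n \<and> n \<ge> k then (if z n = 0 then N n else if z n = N n then 0 else z n) else z n)"
    for z :: baire
  have invT: "T (T z) = z" for z by (auto simp: T_def)
  have contT: "continuous_on UNIV T"
  proof (rule continuous_on_baire)
    fix n show "\<exists>h. \<forall>z. T z n = h (z n)"
      by (intro exI[of _ "\<lambda>m. if odd n \<and> n \<ge> k then (if m = 0 then N n else if m = N n then 0 else m) else m"])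
        (simp add: T_def)
  qed
  \<comment> \<open>Closed with empty interior, since any finite initial part can be continued by
    zeros.\<close>
  define L where "L l = {z::baire. \<forall>n\<ge>l. odd n \<longrightarrow> z n \<noteq> 0}" for l
  have "meager (L l)" for l
  proof (rule meager_closed)
    have "L l = (\<Inter>n\<in>{n. n \<ge> l \<and> odd n}. (\<lambda>z. z n) -` (- {0}))" by (auto simp: L_def)
    moreover have "closed ((\<lambda>z::baire. z n) -` (- {0}))" for n
      by (intro closed_vimage continuous_on_product_coordinates) (simp add: closed_def open_discrete)
    ultimately show "closed (L l)" by auto
    show "interior (L l) = {}"
    proof (rule ccontr)
      assume "interior (L l) \<noteq> {}"
      then obtain c where "c \<in> interior (L l)" by auto
      then obtain m where m: "cylinder m c \<subseteq> interior (L l)" using open_contains_cylinder[OF open_interior] by metis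
      have "(\<lambda>n. if n < m then c n else 0) \<in> cylinder m c" by (simp add: cylinder_def)
      then have "(\<lambda>n. if n < m then c n else 0) \<in> L l" using m interior_subset by blast
      then have "\<not> (2 * (l + m) + 1 \<ge> l \<and> odd (2 * (l + m) + 1) \<and> 2 * (l + m) + 1 \<ge> m)"
        unfolding L_def by fastforce
      then show False by simp
    qed
  qed
  then have "meager (\<Union>l. L l)" by (rule meager_UN)
  moreover have "meager (T -` (cylinder k b \<inter> {z. f z \<noteq> y}))"
    by (rule meager_vimage_involution[OF K contT invT])
  ultimately have "meager ((cylinder k b \<inter> {z. f z \<noteq> y}) \<union> T -` (cylinder k b \<inter> {z. f z \<noteq> y}) \<union> (\<Union>l. L l))"
    using K meager_Un by blast
  then have "\<not> cylinder k b \<subseteq> (cylinder k b \<inter> {z. f z \<noteq> y}) \<union> T -` (cylinder k b \<inter> {z. f z \<noteq> y}) \<union> (\<Union>l. L l)"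
    using cylinder_not_meager meager_subset by blast
  then obtain z where z: "z \<in> cylinder k b" "f z = y" "T z \<in> cylinder k b \<Longrightarrow> f (T z) = y" "\<And>l. z \<notin> L l"
    by blast
  have "T z \<in> cylinder k b" using z(1) by (auto simp: cylinder_def T_def)
  then have "f z = f (T z)" using z by simp
  moreover have "z n = T z n" if "even n" for n using that by (simp add: T_def)
  moreover have "infinite {n. odd n \<and> z n = 0 \<and> T z n = N n}"
    unfolding infinite_nat_iff_unbounded_le
  proof
    fix l
    obtain n where "n \<ge> max k l" "odd n" "z n = 0" using z(4)[of "max k l"] unfolding L_def by auto
    then show "\<exists>n\<ge>l. n \<in> {n. odd n \<and> z n = 0 \<and> T z n = N n}"
      by (intro exI[of _ n]) (simp add: T_def)
  qed
  ultimately show ?thesis using that by blast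
qed

section \<open>The Borel action on sequences of points\<close>

lemma second_countable_euclidean: "second_countable (euclidean :: 'e::second_countable_topology topology)"
proof -
  obtain B :: "'e set set" where B: "countable B" "\<And>C. C \<in> B \<Longrightarrow> open C"
    "\<And>S. open S \<Longrightarrow> \<exists>U. U \<subseteq> B \<and> S = \<Union>U"
    by (rule univ_second_countable) blast
  have "\<exists>V\<in>B. x \<in> V \<and> V \<subseteq> U" if U: "open U" "x \<in> U" for U x
    using B(3)[OF U(1)] U(2) by blast
  then show ?thesis unfolding second_countable_def using B(1,2) by (intro exI[of _ B]) auto
qed

lemma second_countable_finite_open_cover:
  assumes "finite I" "\<And>i. i \<in> I \<Longrightarrow> openin X (U i)" "topspace X \<subseteq> (\<Union>i\<in>I. U i)"
    "\<And>i. i \<in> I \<Longrightarrow> second_countable (subtopology X (U i))"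
  shows "second_countable X"
proof -
  have "\<exists>B. countable B \<and> (\<forall>V\<in>B. openin (subtopology X (U i)) V) \<and>
      (\<forall>W x. openin (subtopology X (U i)) W \<and> x \<in> W \<longrightarrow> (\<exists>V\<in>B. x \<in> V \<and> V \<subseteq> W))" if "i \<in> I" for i
    using assms(4)[OF that] unfolding second_countable_def .
  then obtain B where B: "\<And>i. i \<in> I \<Longrightarrow> countable (B i)"
    "\<And>i V. i \<in> I \<Longrightarrow> V \<in> B i \<Longrightarrow> openin (subtopology X (U i)) V"
    "\<And>i W x. i \<in> I \<Longrightarrow> openin (subtopology X (U i)) W \<Longrightarrow> x \<in> W \<Longrightarrow> \<exists>V\<in>B i. x \<in> V \<and> V \<subseteq> W"
    by metis
  show ?thesis unfolding second_countable_def
  proof (intro exI[of _ "\<Union>i\<in>I. B i"] conjI ballI allI impI)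
    show "countable (\<Union>i\<in>I. B i)" using assms(1) B(1) by (simp add: countable_finite)
    show "openin X V" if "V \<in> (\<Union>i\<in>I. B i)" for V
      using that B(2) assms(2) openin_trans_full by (metis UN_E)
    fix W x assume W: "openin X W \<and> x \<in> W"
    then have "x \<in> topspace X" using openin_subset by blast
    then obtain i where i: "i \<in> I" "x \<in> U i" using assms(3) by blast
    have "openin (subtopology X (U i)) (W \<inter> U i)"
      using W by (auto simp: openin_subtopology)
    then obtain V where "V \<in> B i" "x \<in> V" "V \<subseteq> W \<inter> U i" using B(3)[OF i(1)] W i(2) by blast
    then show "\<exists>V\<in>\<Union>i\<in>I. B i. x \<in> V \<and> V \<subseteq> W" using i(1) by blast
  qed
qed

text \<open>The infix notation of topological closures clashes with a notation of HOL-Algebra.\<close>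

abbreviation (input) clo :: "'a topology \<Rightarrow> 'a set \<Rightarrow> 'a set" where
  "clo X V \<equiv> Abstract_Topology.closure_of X V"

lemma regular_base_closure:
  assumes "regular_space X" "openin X W" "x \<in> W"
    "\<And>U x. openin X U \<Longrightarrow> x \<in> U \<Longrightarrow> \<exists>V\<in>B. x \<in> V \<and> V \<subseteq> U"
  shows "\<exists>V\<in>B. x \<in> V \<and> clo X V \<subseteq> W"
proof -
  have "closedin X (topspace X - W)" "x \<in> topspace X - (topspace X - W)"
    using assms(2,3) openin_subset by fastforce+
  then obtain U where U: "openin X U" "x \<in> U" "disjnt (topspace X - W) (clo X U)"
    using assms(1) unfolding regular_space by metis
  obtain V where V: "V \<in> B" "x \<in> V" "V \<subseteq> U" using assms(4)[OF U(1,2)] by blast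
  have "clo X V \<subseteq> clo X U" using V(3) by (rule closure_of_mono)
  then have "clo X V \<subseteq> W"
    using U(3) closure_of_subset_topspace[of X U] by (auto simp: disjnt_def)
  then show ?thesis using V by blast
qed

text \<open>Urysohn metrization: functions separating the countably many pairs of basic sets with
  disjoint closures embed \<open>X\<close> into a countable power of the reals. Compactness makes
  the image closed, and this gives completeness.\<close>

lemma compact_Hausdorff_second_countable_imp_completely_metrizable:
  assumes X: "compact_space X" "Hausdorff_space X" "second_countable X"
  shows "completely_metrizable_space X"
proof -
  have reg: "regular_space X" and nor: "normal_space X"
    using X compact_Hausdorff_imp_regular_space compact_Hausdorff_or_regular_imp_normal_space by blast+
  obtain B where B: "countable B" "\<And>V. V \<in> B \<Longrightarrow> openin X V"
    "\<And>U x. openin X U \<Longrightarrow> x \<in> U \<Longrightarrow> \<exists>V\<in>B. x \<in> V \<and> V \<subseteq> U"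
    using X(3) unfolding second_countable_def by metis
  define P where "P = {p \<in> B \<times> B. disjnt (clo X (fst p)) (clo X (snd p))}"
  have cP: "countable P" unfolding P_def using B(1) by (auto intro: countable_subset[of _ "B \<times> B"])
  let ?S = "\<lambda>p g. continuous_map X euclideanreal g \<and> (\<forall>x\<in>clo X (fst p). g x = 0) \<and> (\<forall>x\<in>clo X (snd p). g x = 1)"
  have "\<forall>p\<in>P. \<exists>g. ?S p g"
  proof
    fix p assume "p \<in> P"
    then have "disjnt (clo X (fst p)) (clo X (snd p))" by (simp add: P_def)
    then obtain g where "continuous_map X euclideanreal g" "g ` (clo X (fst p)) \<subseteq> {0}" "g ` (clo X (snd p)) \<subseteq> {1}"
      by (rule Urysohn_lemma_alt[OF nor closedin_closure_of closedin_closure_of])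
    then show "\<exists>g. ?S p g" by (intro exI[of _ g]) auto
  qed
  then obtain g where g: "\<forall>p\<in>P. ?S p (g p)" using bchoice[of P ?S] by blast
  define Y where "Y = product_topology (\<lambda>_. euclideanreal) P"
  define F where "F x = (\<lambda>p\<in>P. g p x)" for x
  have cont: "continuous_map X Y F"
    unfolding Y_def F_def using g by (auto simp: continuous_map_componentwise)
  have inj: "inj_on F (topspace X)"
  proof (rule inj_onI, rule ccontr)
    fix x y assume xy: "x \<in> topspace X" "y \<in> topspace X" "F x = F y" "x \<noteq> y"
    then obtain U V where UV: "openin X U" "openin X V" "x \<in> U" "y \<in> V" "disjnt U V"
      using X(2) unfolding Hausdorff_space_def by metis
    obtain U' where U': "U' \<in> B" "x \<in> U'" "clo X U' \<subseteq> U"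
      using regular_base_closure[OF reg UV(1,3) B(3)] by blast
    obtain V' where V': "V' \<in> B" "y \<in> V'" "clo X V' \<subseteq> V"
      using regular_base_closure[OF reg UV(2,4) B(3)] by blast
    have p: "(U', V') \<in> P" using UV(5) U' V' by (auto simp: P_def disjnt_def)
    have "x \<in> clo X U'" using U'(2) closure_of_subset[OF openin_subset[OF B(2)[OF U'(1)]]] by (rule subsetD[rotated])
    moreover have "y \<in> clo X V'" using V'(2) closure_of_subset[OF openin_subset[OF B(2)[OF V'(1)]]] by (rule subsetD[rotated])
    ultimately have "g (U', V') x = 0" "g (U', V') y = 1" using bspec[OF g p] by simp_all
    moreover have "g (U', V') x = g (U', V') y" using fun_cong[OF xy(3), of "(U', V')"] p by (simp add: F_def)
    ultimately show False by simp
  qed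
  have mY: "completely_metrizable_space Y"
    unfolding Y_def completely_metrizable_space_product_topology
    using cP by (auto intro: countable_subset[OF _ cP] simp: completely_metrizable_space_euclidean)
  have hY: "Hausdorff_space Y"
    using mY completely_metrizable_imp_metrizable_space metrizable_imp_Hausdorff_space by blast
  have "closed_map X Y F"
    by (rule continuous_imp_closed_map_gen[OF X(1) Hausdorff_imp_kc_space[OF hY] cont])
  then have "embedding_map X Y F" using cont inj injective_closed_imp_embedding_map by blast
  then have hom: "X homeomorphic_space subtopology Y (F ` topspace X)"
    by (rule embedding_map_imp_homeomorphic_space)
  have "closedin Y (F ` topspace X)"
    using \<open>closed_map X Y F\<close> by (simp add: closed_map_def)
  then have "completely_metrizable_space (subtopology Y (F ` topspace X))"
    by (rule completely_metrizable_space_closedin[OF mY])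
  then show ?thesis using homeomorphic_completely_metrizable_space[OF hom] by simp
qed

section \<open>Measurability through a countable base\<close>

lemma openin_borel_of: "openin T U \<Longrightarrow> U \<in> sets (borel_of T)"
  unfolding borel_of_def by (rule in_measure_of) (use openin_subset in blast)+

lemma measurable_borel_of_base:
  assumes f: "\<And>x. x \<in> space N \<Longrightarrow> f x \<in> topspace T"
    and B: "countable B" "\<And>V. V \<in> B \<Longrightarrow> openin T V"
    "\<And>U x. openin T U \<Longrightarrow> x \<in> U \<Longrightarrow> \<exists>V\<in>B. x \<in> V \<and> V \<subseteq> U"
    and m: "\<And>V. V \<in> B \<Longrightarrow> {x \<in> space N. f x \<in> V} \<in> sets N"
  shows "f \<in> measurable N (borel_of T)"
  unfolding borel_of_def
proof (rule measurable_measure_of)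
  show "{U. openin T U} \<subseteq> Pow (topspace T)" using openin_subset by blast
  show "f \<in> space N \<rightarrow> topspace T" using f by auto
  fix U assume "U \<in> {U. openin T U}"
  then have "f -` U \<inter> space N = (\<Union>V\<in>{V \<in> B. V \<subseteq> U}. {x \<in> space N. f x \<in> V})"
    using B(3) by (auto; blast)
  moreover have "countable {V \<in> B. V \<subseteq> U}" using B(1) by (auto intro: countable_subset)
  ultimately show "f -` U \<inter> space N \<in> sets N" using m by auto
qed

definition seq_base :: "'a topology \<Rightarrow> 'a set list \<Rightarrow> (nat \<Rightarrow> 'a) set" where
  "seq_base X l = {z. (\<forall>n. z n \<in> topspace X) \<and> (\<forall>n<length l. z n \<in> l ! n)}"

lemma seq_base:
  assumes B: "countable B" "\<And>V. V \<in> B \<Longrightarrow> openin X V"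
    "\<And>U x. openin X U \<Longrightarrow> x \<in> U \<Longrightarrow> \<exists>V\<in>B. x \<in> V \<and> V \<subseteq> U"
  shows "countable (seq_base X ` lists B)"
    and "V \<in> seq_base X ` lists B \<Longrightarrow> openin (product_topology (\<lambda>_. X) UNIV) V"
    and "openin (product_topology (\<lambda>_. X) UNIV) U \<Longrightarrow> z \<in> U \<Longrightarrow> \<exists>V\<in>seq_base X ` lists B. z \<in> V \<and> V \<subseteq> U"
proof -
  show "countable (seq_base X ` lists B)" using B(1) by simp
  show "openin (product_topology (\<lambda>_. X) UNIV) V" if V: "V \<in> seq_base X ` lists B" for V
  proof -
    obtain l where l: "l \<in> lists B" "V = seq_base X l" using V by blast
    have "V = Pi\<^sub>E UNIV (\<lambda>n. if n < length l then l ! n else topspace X)"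
    proof -
      have "l ! n \<subseteq> topspace X" if "n < length l" for n
        using that l(1) B(2) openin_subset by (metis in_listsD nth_mem)
      then have "z \<in> V \<longleftrightarrow> (\<forall>n. z n \<in> (if n < length l then l ! n else topspace X))" for z
        unfolding l(2) seq_base_def by auto
      then show ?thesis by (auto simp: PiE_iff)
    qed
    moreover have "openin (product_topology (\<lambda>_. X) UNIV) (Pi\<^sub>E UNIV (\<lambda>n. if n < length l then l ! n else topspace X))"
    proof (rule product_topology_basis)
      show "openin X (if n < length l then l ! n else topspace X)" for n
        using l(1) B(2) by (auto simp: in_lists_conv_set)
      have "{n. (if n < length l then l ! n else topspace X) \<noteq> topspace X} \<subseteq> {..<length l}" by auto
      then show "finite {n. (if n < length l then l ! n else topspace X) \<noteq> topspace X}"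
        by (rule finite_subset) simp
    qed
    ultimately show ?thesis by simp
  qed
  show "\<exists>V\<in>seq_base X ` lists B. z \<in> V \<and> V \<subseteq> U"
    if U: "openin (product_topology (\<lambda>_. X) UNIV) U" "z \<in> U" for U z
  proof -
    obtain W where W: "finite {i. W i \<noteq> topspace X}" "\<And>i. openin X (W i)"
      "z \<in> Pi\<^sub>E UNIV W" "Pi\<^sub>E UNIV W \<subseteq> U"
      using U unfolding openin_product_topology_alt by force
    obtain k where k: "\<And>i. W i \<noteq> topspace X \<Longrightarrow> i < k"
      using W(1) finite_nat_set_iff_bounded by auto
    have "\<exists>V\<in>B. z n \<in> V \<and> V \<subseteq> W n" for n using B(3)[OF W(2)] W(3) by (auto simp: PiE_iff)
    then obtain V where V: "\<And>n. V n \<in> B" "\<And>n. z n \<in> V n" "\<And>n. V n \<subseteq> W n" by metis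
    have "z \<in> seq_base X (map V [0..<k])"
      using V(2) W(2,3) openin_subset by (fastforce simp: seq_base_def PiE_iff)
    moreover have "y n \<in> W n" if y: "y \<in> seq_base X (map V [0..<k])" for y n
    proof (cases "n < k")
      case True
      then show ?thesis using y V(3)[of n] by (auto simp: seq_base_def)
    next
      case False
      then have "W n = topspace X" using k by blast
      then show ?thesis using y by (simp add: seq_base_def)
    qed
    then have "seq_base X (map V [0..<k]) \<subseteq> U" using W(4) by (auto simp: PiE_iff)
    moreover have "map V [0..<k] \<in> lists B" using V(1) by (auto simp: in_lists_conv_set)
    ultimately show ?thesis by blast
  qed
qed

lemma standard_borel_seq:
  assumes X: "compact_space X" "Hausdorff_space X" "second_countable X"
  shows "standard_borel (borel_of (product_topology (\<lambda>_::nat. X) UNIV))"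
proof -
  obtain B where B: "countable B" "\<And>V. V \<in> B \<Longrightarrow> openin X V"
    "\<And>U x. openin X U \<Longrightarrow> x \<in> U \<Longrightarrow> \<exists>V\<in>B. x \<in> V \<and> V \<subseteq> U"
    using X(3) unfolding second_countable_def by metis
  have "second_countable (product_topology (\<lambda>_::nat. X) UNIV)"
    unfolding second_countable_def using seq_base[OF B]
    by (intro exI[of _ "seq_base X ` lists B"]) blast
  moreover have "completely_metrizable_space (product_topology (\<lambda>_::nat. X) UNIV)"
    unfolding completely_metrizable_space_product_topology
    using compact_Hausdorff_second_countable_imp_completely_metrizable[OF X] by simp
  ultimately show ?thesis unfolding standard_borel_def
    by (intro exI[of _ "product_topology (\<lambda>_::nat. X) UNIV"]) simp
qed

context smooth_manifold
begin

text \<open>Second countability is not built into \<open>smooth_atlas\<close>; compactness supplies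
  it through a finite cover by charts, each homeomorphic to a subset of a Euclidean space.\<close>

lemma second_countable_manifold:
  assumes "compact_space M"
  shows "second_countable M"
proof -
  have "\<exists>F. finite F \<and> F \<subseteq> fst ` A \<and> topspace M \<subseteq> \<Union>F"
    by (rule compactinD[OF assms[unfolded compact_space_def]])
      (use chart_openin chart_at in \<open>auto, metis fst_conv image_eqI\<close>)
  then obtain F where F: "finite F" "F \<subseteq> fst ` A" "topspace M \<subseteq> \<Union>F" by blast
  show ?thesis
  proof (rule second_countable_finite_open_cover[where I = F and U = "\<lambda>U. U"])
    show "second_countable (subtopology M U)" if "U \<in> F" for U
    proof -
      obtain \<phi> where c: "(U, \<phi>) \<in> A" using \<open>U \<in> F\<close> F(2) by auto
      have "subtopology M U homeomorphic_space top_of_set (\<phi> ` U)"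
        using chart_homeomorphic[OF c] homeomorphic_space by blast
      then show ?thesis
        using homeomorphic_space_second_countability second_countable_subtopology[OF second_countable_euclidean]
        by blast
    qed
    show "openin M U" if "U \<in> F" for U using that F(2) chart_openin by auto
  qed (use F in auto)
qed

section \<open>Evaluation is jointly Borel\<close>

lemma openin_eval:
  assumes W: "openin M W" and x: "x \<in> topspace M"
  shows "openin (Diff_topology r M A) {g \<in> Diffeo r M A. g x \<in> W}"
proof (subst openin_subopen, intro ballI)
  fix f assume "f \<in> {g \<in> Diffeo r M A. g x \<in> W}"
  then have f: "f \<in> Diffeo r M A" "f x \<in> W" by auto
  obtain U \<phi> where U: "(U, \<phi>) \<in> A" "x \<in> U" using chart_at[OF x] .
  obtain V \<psi> where V: "(V, \<psi>) \<in> A" "f x \<in> V" using chart_at DiffeoD(4)[OF f(1) x] .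
  have "open (\<psi> ` (V \<inter> W))"
    using W chart_openin[OF V(1)] by (intro chart_image_open[OF V(1)]) auto
  then obtain \<epsilon> where \<epsilon>: "\<epsilon> > 0" "ball (\<psi> (f x)) \<epsilon> \<subseteq> \<psi> ` (V \<inter> W)"
    using V(2) f(2) by (metis IntI image_eqI open_contains_ball)
  define T where "T = Cr_nhd r M A f (U, \<phi>) (V, \<psi>) {x} 0 \<epsilon>"
  have "openin (Diff_topology r M A) T"
    unfolding Diff_topology_def
  proof (rule topology_generated_by_Basis)
    have "compactin M {x}" using x by (simp add: compactin_sing)
    moreover have "enat 0 \<le> r" by (simp add: zero_enat_def[symmetric])
    ultimately show "T \<in> insert (Diffeo r M A)
     {Cr_nhd r M A f c c' K k \<epsilon> | f c c' K k \<epsilon>.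
        f \<in> Diffeo r M A \<and> c \<in> A \<and> c' \<in> A \<and> compactin M K \<and> K \<subseteq> fst c \<and> f ` K \<subseteq> fst c' \<and>
        enat k \<le> r \<and> \<epsilon> > 0}"
      unfolding T_def using f U V \<epsilon>(1) 
      by (intro insertI2 CollectI exI[of _ f] exI[of _ "(U, \<phi>)"] exI[of _ "(V, \<psi>)"] exI[of _ "{x}"]
          exI[of _ 0] exI[of _ \<epsilon>] conjI) auto
  qed
  moreover have "f \<in> T"
    using f(1) V(2) \<epsilon>(1) by (auto simp: T_def Cr_nhd_def)
  moreover have "g x \<in> W" if "g \<in> T" for g
  proof -
    have "g x \<in> V" "norm (\<psi> (g x) - \<psi> (f x)) < \<epsilon>"
      using that chart_inv(1)[OF U] by (auto simp: T_def Cr_nhd_def in_charts_def)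
    then have "\<psi> (g x) \<in> \<psi> ` (V \<inter> W)" using \<epsilon>(2) by (auto simp: dist_norm norm_minus_commute)
    then show ?thesis using chart_inj[OF V(1)] \<open>g x \<in> V\<close> by (auto simp: inj_on_def)
  qed
  moreover have "T \<subseteq> Diffeo r M A" by (auto simp: T_def Cr_nhd_def)
  ultimately show "\<exists>T. openin (Diff_topology r M A) T \<and> f \<in> T \<and> T \<subseteq> {g \<in> Diffeo r M A. g x \<in> W}"
    by blast
qed

lemma space_Diff_topology: "topspace (Diff_topology r M A) = Diffeo r M A"
  by (simp add: topspace_Diff_topology carrier_Diff_group)

text \<open>The product sigma-algebra is generated by rectangles, so the preimage of
  \<open>W\<close> is written as a countable union of measurable rectangles: by regularity,
  \<open>g x\<close> is in \<open>W\<close> iff \<open>x\<close> has a basic neighbourhood that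
  \<open>g\<close> maps into some \<open>clo V\<close> inside \<open>W\<close>. By continuity this
  can be tested on the countable dense set \<open>Z\<close>, which involves only evaluations at
  fixed points.\<close>

lemma measurable_eval:
  assumes M: "compact_space M" "Hausdorff_space M"
  shows "(\<lambda>(g, x). g x) \<in> measurable (borel_of (Diff_topology r M A) \<Otimes>\<^sub>M borel_of M) (borel_of M)"
proof -
  let ?D = "borel_of (Diff_topology r M A)"
  let ?N = "?D \<Otimes>\<^sub>M borel_of M"
  obtain B where B: "countable B" "\<And>V. V \<in> B \<Longrightarrow> openin M V"
    "\<And>U x. openin M U \<Longrightarrow> x \<in> U \<Longrightarrow> \<exists>V\<in>B. x \<in> V \<and> V \<subseteq> U"
    using second_countable_manifold[OF M(1)] unfolding second_countable_def by metis
  have reg: "regular_space M" using M by (rule compact_Hausdorff_imp_regular_space)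
  have spN: "space ?N = Diffeo r M A \<times> topspace M" by (simp add: space_pair_measure space_Diff_topology)
  define c where "c V = (SOME x. x \<in> V)" for V :: "'a set"
  have c: "c V \<in> V" if "V \<noteq> {}" for V unfolding c_def using that by (simp add: some_in_eq)
  define Z where "Z = c ` (B - {{}})"
  have cZ: "countable Z" using B(1) by (simp add: Z_def)
  have ZM: "Z \<subseteq> topspace M" unfolding Z_def using c openin_subset[OF B(2)] by blast
  have ev: "{g \<in> Diffeo r M A. g x \<in> C} \<in> sets ?D" if "closedin M C" "x \<in> topspace M" for C x
  proof -
    have "{g \<in> Diffeo r M A. g x \<in> topspace M - C} \<in> sets ?D"
      using that by (intro openin_borel_of openin_eval) blast+
    then have "space ?D - {g \<in> Diffeo r M A. g x \<in> topspace M - C} \<in> sets ?D" by (rule sets.compl_sets)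
    moreover have "space ?D - {g \<in> Diffeo r M A. g x \<in> topspace M - C} = {g \<in> Diffeo r M A. g x \<in> C}"
      using that(2) DiffeoD(4) by (auto simp: space_Diff_topology)
    ultimately show ?thesis by simp
  qed
  define K where "K V C = {g \<in> Diffeo r M A. \<forall>d\<in>V \<inter> Z. g d \<in> C}" for V C
  have K: "K V C \<in> sets ?D" if "closedin M C" for V C
  proof -
    \<comment> \<open>The case distinction avoids an empty intersection, which would be
      \<open>UNIV\<close> and not the space.\<close>
    have "{g \<in> Diffeo r M A. \<forall>d\<in>V \<inter> Z. g d \<in> C} =
        (if V \<inter> Z = {} then space ?D else (\<Inter>d\<in>V \<inter> Z. {g \<in> Diffeo r M A. g d \<in> C}))"
      by (auto simp: space_Diff_topology)
    moreover have "(\<Inter>d\<in>V \<inter> Z. {g \<in> Diffeo r M A. g d \<in> C}) \<in> sets ?D" if "V \<inter> Z \<noteq> {}"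
      using that cZ ZM by (intro sets.countable_INT' image_subsetI ev[OF \<open>closedin M C\<close>]) auto
    ultimately show ?thesis unfolding K_def using sets.top[of ?D] by presburger
  qed
  \<comment> \<open>A point of \<open>V\<close> sent outside the closed set \<open>C\<close> would
    have a basic neighbourhood in \<open>V\<close> sent there as well, and that neighbourhood
    contains a point of \<open>Z\<close>.\<close>
  have KI: "g x \<in> C" if "g \<in> K V C" "x \<in> V" "closedin M C" "openin M V" for g x V C
  proof (rule ccontr)
    assume "g x \<notin> C"
    have g: "g \<in> Diffeo r M A" using that(1) by (simp add: K_def)
    have x: "x \<in> topspace M" using that(2,4) openin_subset by blast
    have "openin M (V \<inter> g -` (topspace M - C))"
      using that(3,4) by (intro openin_preimage Cr_map_continuous[OF DiffeoD(2)[OF g]]) blast+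
    moreover have "x \<in> V \<inter> g -` (topspace M - C)"
      using that(2) \<open>g x \<notin> C\<close> DiffeoD(4)[OF g x] by simp
    ultimately obtain W where W: "W \<in> B" "x \<in> W" "W \<subseteq> V \<inter> g -` (topspace M - C)" using B(3) by blast
    then have "c W \<in> W" "c W \<in> Z" using c[of W] by (auto simp: Z_def)
    then show False using W(3) that(1) by (auto simp: K_def)
  qed
  show ?thesis
  proof (rule measurable_borel_of_base[OF _ B])
    show "(case p of (g, x) \<Rightarrow> g x) \<in> topspace M" if "p \<in> space ?N" for p
      using that DiffeoD(4) by (auto simp: spN)
    fix W assume "W \<in> B"
    then have W: "openin M W" by (rule B(2))
    define I where "I = {p \<in> B \<times> B. clo M (fst p) \<subseteq> W}"
    have cI: "countable I" unfolding I_def using B(1) by (auto intro: countable_subset[of _ "B \<times> B"])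
    have "{p \<in> space ?N. (case p of (g, x) \<Rightarrow> g x) \<in> W} = (\<Union>p\<in>I. K (snd p) (clo M (fst p)) \<times> snd p)"
    proof (intro equalityI subsetI)
      fix p assume "p \<in> {p \<in> space ?N. (case p of (g, x) \<Rightarrow> g x) \<in> W}"
      then obtain g x where p: "p = (g, x)" "g \<in> Diffeo r M A" "x \<in> topspace M" "g x \<in> W"
        by (auto simp: spN)
      obtain V where V: "V \<in> B" "g x \<in> V" "clo M V \<subseteq> W"
        using regular_base_closure[OF reg W p(4) B(3)] by blast
      have "openin M (topspace M \<inter> g -` V)"
        by (intro openin_preimage Cr_map_continuous[OF DiffeoD(2)[OF p(2)]] openin_topspace B(2)[OF V(1)])
      then obtain V' where V': "V' \<in> B" "x \<in> V'" "V' \<subseteq> topspace M \<inter> g -` V"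
        using B(3)[of "topspace M \<inter> g -` V" x] p(3) V(2) by auto
      have "V \<subseteq> clo M V" by (rule closure_of_subset[OF openin_subset[OF B(2)[OF V(1)]]])
      then have "g \<in> K V' (clo M V)" using p(2) V'(3) by (auto simp: K_def)
      then show "p \<in> (\<Union>p\<in>I. K (snd p) (clo M (fst p)) \<times> snd p)"
        using V V' p(1) by (intro UN_I[of "(V, V')"]) (auto simp: I_def)
    next
      fix p assume "p \<in> (\<Union>p\<in>I. K (snd p) (clo M (fst p)) \<times> snd p)"
      then obtain V V' where V: "V' \<in> B" "clo M V \<subseteq> W" "fst p \<in> K V' (clo M V)" "snd p \<in> V'"
        by (auto simp: I_def)
      have "fst p (snd p) \<in> clo M V" by (rule KI[OF V(3,4) closedin_closure_of B(2)[OF V(1)]])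
      moreover have "snd p \<in> topspace M" using V(1,4) B(2) openin_subset by blast
      ultimately show "p \<in> {p \<in> space ?N. (case p of (g, x) \<Rightarrow> g x) \<in> W}"
        using V(2,3) by (auto simp: spN K_def case_prod_beta mem_Times_iff)
    qed
    moreover have "K (snd p) (clo M (fst p)) \<times> snd p \<in> sets ?N" if "p \<in> I" for p
      using that B(2) by (intro pair_measureI K openin_borel_of) (auto simp: I_def)
    ultimately show "{p \<in> space ?N. (case p of (g, x) \<Rightarrow> g x) \<in> W} \<in> sets ?N"
      using cI by auto
  qed
qed

lemma measurable_seq_action:
  assumes M: "compact_space M" "Hausdorff_space M"
  defines "Q \<equiv> borel_of (product_topology (\<lambda>_::nat. M) UNIV)"
  shows "(\<lambda>(g, z). \<lambda>n. g (z n)) \<in> measurable (borel_of (Diff_topology r M A) \<Otimes>\<^sub>M Q) Q"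
proof -
  let ?N = "borel_of (Diff_topology r M A) \<Otimes>\<^sub>M Q"
  obtain B where B: "countable B" "\<And>V. V \<in> B \<Longrightarrow> openin M V"
    "\<And>U x. openin M U \<Longrightarrow> x \<in> U \<Longrightarrow> \<exists>V\<in>B. x \<in> V \<and> V \<subseteq> U"
    using second_countable_manifold[OF M(1)] unfolding second_countable_def by metis
  have spN: "space ?N = Diffeo r M A \<times> {z. \<forall>n. z n \<in> topspace M}"
    by (auto simp: space_pair_measure space_Diff_topology Q_def PiE_iff)
  have "(\<lambda>z. z n) \<in> measurable Q (borel_of M)" for n
    unfolding Q_def by (intro continuous_map_measurable continuous_map_product_projection) simp
  then have "(\<lambda>p. (fst p, snd p n)) \<in> measurable ?N (borel_of (Diff_topology r M A) \<Otimes>\<^sub>M borel_of M)" for n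
    by measurable
  from measurable_compose[OF this measurable_eval[OF M]]
  have ev: "(\<lambda>p. fst p (snd p n)) \<in> measurable ?N (borel_of M)" for n by simp
  have evV: "{p \<in> space ?N. fst p (snd p n) \<in> V} \<in> sets ?N" if "V \<in> B" for V n
    using measurable_sets[OF ev openin_borel_of[OF B(2)[OF that]], of n]
    by (simp add: vimage_def Int_def conj_commute)
  have "(\<lambda>(g, z). \<lambda>n. g (z n)) \<in> measurable ?N (borel_of (product_topology (\<lambda>_. M) UNIV))"
  proof (rule measurable_borel_of_base[OF _ seq_base[OF B]])
    show "(case p of (g, z) \<Rightarrow> \<lambda>n. g (z n)) \<in> topspace (product_topology (\<lambda>_. M) UNIV)"
      if "p \<in> space ?N" for p
      using that DiffeoD(4) by (auto simp: spN PiE_iff)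
    fix V assume "V \<in> seq_base M ` lists B"
    then obtain l where l: "l \<in> lists B" "V = seq_base M l" by blast
    have "{p \<in> space ?N. (case p of (g, z) \<Rightarrow> \<lambda>n. g (z n)) \<in> V} =
        space ?N \<inter> (\<Inter>n\<in>{..<length l}. {p \<in> space ?N. fst p (snd p n) \<in> l ! n})"
      using DiffeoD(4) by (auto simp: l(2) seq_base_def spN)
    moreover have "l ! n \<in> B" if "n < length l" for n using l(1) that by (simp add: in_lists_conv_set)
    ultimately show "{p \<in> space ?N. (case p of (g, z) \<Rightarrow> \<lambda>n. g (z n)) \<in> V} \<in> sets ?N"
      using evV by (cases "l = []") (auto intro!: sets.Int sets.finite_INT)
  qed
  then show ?thesis by (simp only: Q_def)
qed

text \<open>The diagonal action is carried over to a Borel copy of the sequence space on the reals,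
  the form in which the theorem asks for it. The last clause translates the orbit relation back to
  sequences of points.\<close>

lemma seq_action:
  assumes M: "compact_space M" "Hausdorff_space M"
  obtains R :: "real measure" and h \<alpha> where "standard_borel R"
    "h \<in> measurable (borel_of (product_topology (\<lambda>_::nat. M) UNIV)) R"
    "borel_action (Diff_group r M A) (Diff_topology r M A) R \<alpha>"
    "\<And>z z' :: nat \<Rightarrow> 'a. (\<And>n. z n \<in> topspace M) \<Longrightarrow> (\<And>n. z' n \<in> topspace M) \<Longrightarrow>
      (h z, h z') \<in> orbit_relation (Diff_group r M A) (space R) \<alpha> \<longleftrightarrow>
      (\<exists>g\<in>Diffeo r M A. \<forall>n. g (z n) = z' n)"
proof -
  define Q where "Q = borel_of (product_topology (\<lambda>_::nat. M) UNIV)"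
  have spQ: "z \<in> space Q \<longleftrightarrow> (\<forall>n. z n \<in> topspace M)" for z :: "nat \<Rightarrow> 'a" by (auto simp: Q_def PiE_iff)
  obtain R :: "real measure" and h h' where R: "standard_borel R" "h \<in> measurable Q R" "h' \<in> measurable R Q"
    "\<And>z. z \<in> space Q \<Longrightarrow> h' (h z) = z" "\<And>y. y \<in> space R \<Longrightarrow> h (h' y) = y"
    using standard_borel_real_copy[OF standard_borel_seq[OF M second_countable_manifold[OF M(1)]]]
    unfolding Q_def by metis
  have hR: "h z \<in> space R" if "z \<in> space Q" for z using measurable_space[OF R(2) that] .
  have hQ: "h' y \<in> space Q" if "y \<in> space R" for y using measurable_space[OF R(3) that] .
  \<comment> \<open>Restricted to \<open>space R\<close>, since \<open>Bij\<close> admits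
    extensional functions only.\<close>
  define \<alpha> where "\<alpha> g = (\<lambda>y\<in>space R. h (\<lambda>n. g (h' y n)))" for g :: "'a \<Rightarrow> 'a"
  have actQ: "(\<lambda>n. g (z n)) \<in> space Q" if "g \<in> Diffeo r M A" "z \<in> space Q" for g z
    using that DiffeoD(4) by (auto simp: spQ)
  have \<alpha>: "\<alpha> g y \<in> space R" "h' (\<alpha> g y) = (\<lambda>n. g (h' y n))" if "g \<in> Diffeo r M A" "y \<in> space R" for g y
    using that actQ[OF that(1) hQ[OF that(2)]] hR R(4) by (auto simp: \<alpha>_def)
  have inj: "y = y'" if "y \<in> space R" "y' \<in> space R" "h' y = h' y'" for y y'
    using that R(5) by metis
  have mult: "\<alpha> (compose (topspace M) f g) = compose (space R) (\<alpha> f) (\<alpha> g)"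
    if fg: "f \<in> Diffeo r M A" "g \<in> Diffeo r M A" for f g
  proof
    fix y
    show "\<alpha> (compose (topspace M) f g) y = compose (space R) (\<alpha> f) (\<alpha> g) y"
    proof (cases "y \<in> space R")
      case True
      have "\<alpha> f (\<alpha> g y) = h (\<lambda>n. f (g (h' y n)))"
        using \<alpha>[OF fg(2) True] by (simp add: \<alpha>_def[of f])
      moreover have "(\<lambda>n. compose (topspace M) f g (h' y n)) = (\<lambda>n. f (g (h' y n)))"
        using hQ[OF True] by (auto simp: spQ compose_def)
      ultimately show ?thesis using True by (simp add: compose_def \<alpha>_def[of "\<lambda>x\<in>topspace M. f (g x)"])
    qed (simp add: \<alpha>_def compose_def)
  qed
  have bij: "\<alpha> g \<in> Bij (space R)" if g: "g \<in> Diffeo r M A" for g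
  proof -
    let ?gi = "\<lambda>x\<in>topspace M. inv_into (topspace M) g x"
    have gi: "?gi \<in> Diffeo r M A"
      by (rule DiffeoI[where g = g]) (use DiffeoD[OF g] in \<open>auto intro: Cr_map_cong\<close>)
    have inv1: "\<alpha> ?gi (\<alpha> g y) = y" if y: "y \<in> space R" for y
    proof (rule inj)
      show "h' (\<alpha> ?gi (\<alpha> g y)) = h' y"
        using \<alpha>(2)[OF gi \<alpha>(1)[OF g y]] \<alpha>(2)[OF g y] hQ[OF y] DiffeoD(4,6)[OF g] by (auto simp: spQ)
    qed (use \<alpha>(1)[OF gi \<alpha>(1)[OF g y]] y in auto)
    have inv2: "\<alpha> g (\<alpha> ?gi y) = y" if y: "y \<in> space R" for y
    proof (rule inj)
      show "h' (\<alpha> g (\<alpha> ?gi y)) = h' y"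
        using \<alpha>(2)[OF g \<alpha>(1)[OF gi y]] \<alpha>(2)[OF gi y] hQ[OF y] DiffeoD(7)[OF g] by (auto simp: spQ)
    qed (use \<alpha>(1)[OF g \<alpha>(1)[OF gi y]] y in auto)
    have "bij_betw (\<alpha> g) (space R) (space R)"
      by (rule bij_betw_byWitness[where f' = "\<alpha> ?gi"]) (use inv1 inv2 \<alpha>(1)[OF g] \<alpha>(1)[OF gi] in auto)
    then show ?thesis by (simp add: Bij_def \<alpha>_def)
  qed
  have "\<alpha> \<in> hom (Diff_group r M A) (BijGroup (space R))"
  proof (rule homI)
    fix f assume "f \<in> carrier (Diff_group r M A)"
    then show "\<alpha> f \<in> carrier (BijGroup (space R))" using bij by (simp add: carrier_Diff_group BijGroup_def)
    fix g assume "g \<in> carrier (Diff_group r M A)"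
    with \<open>f \<in> _\<close> show "\<alpha> (f \<otimes>\<^bsub>Diff_group r M A\<^esub> g) = \<alpha> f \<otimes>\<^bsub>BijGroup (space R)\<^esub> \<alpha> g"
      using bij mult by (simp add: carrier_Diff_group mult_Diff_group BijGroup_def)
  qed
  then have ga: "group_action (Diff_group r M A) (space R) \<alpha>"
    unfolding group_action_def group_hom_def group_hom_axioms_def
    using group_Diff_group group_BijGroup by blast
  have "(\<lambda>(g, y). \<alpha> g y) \<in> measurable (borel_of (Diff_topology r M A) \<Otimes>\<^sub>M R) R"
  proof -
    have "(\<lambda>p. (fst p, h' (snd p))) \<in> measurable (borel_of (Diff_topology r M A) \<Otimes>\<^sub>M R) (borel_of (Diff_topology r M A) \<Otimes>\<^sub>M Q)"
      using R(3) by measurable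
    from measurable_compose[OF measurable_compose[OF this measurable_seq_action[OF M, folded Q_def]] R(2)]
    have "(\<lambda>p. h (\<lambda>n. fst p (h' (snd p) n))) \<in> measurable (borel_of (Diff_topology r M A) \<Otimes>\<^sub>M R) R"
      by simp
    then show ?thesis
      by (rule measurable_cong[THEN iffD1, rotated]) (auto simp: \<alpha>_def space_pair_measure)
  qed
  with ga have ba: "borel_action (Diff_group r M A) (Diff_topology r M A) R \<alpha>"
    by (simp add: borel_action_def)
  show ?thesis
  proof (rule that[OF R(1) R(2)[unfolded Q_def] ba])
    fix z z' :: "nat \<Rightarrow> 'a" assume z: "\<And>n. z n \<in> topspace M" "\<And>n. z' n \<in> topspace M"
    then have zQ: "z \<in> space Q" "z' \<in> space Q" by (auto simp: spQ)
    have "\<alpha> g (h z) = h z' \<longleftrightarrow> (\<forall>n. g (z n) = z' n)" if g: "g \<in> Diffeo r M A" for g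
    proof -
      have "h' (\<alpha> g (h z)) = (\<lambda>n. g (z n))" using \<alpha>(2)[OF g hR[OF zQ(1)]] R(4)[OF zQ(1)] by simp
      then have "\<alpha> g (h z) = h z' \<longleftrightarrow> (\<lambda>n. g (z n)) = z'"
        using inj[OF \<alpha>(1)[OF g hR[OF zQ(1)]] hR[OF zQ(2)]] R(4)[OF zQ(2)] by auto
      then show ?thesis by (auto simp: fun_eq_iff)
    qed
    then show "(h z, h z') \<in> orbit_relation (Diff_group r M A) (space R) \<alpha> \<longleftrightarrow>
      (\<exists>g\<in>Diffeo r M A. \<forall>n. g (z n) = z' n)"
      using hR[OF zQ(1)] unfolding orbit_relation_def carrier_Diff_group by (auto; metis)
  qed
qed

end

section \<open>The orbit equivalence relation\<close>

lemma borel_of_euclidean: "borel_of euclidean = borel"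
  by (simp add: borel_of_def borel_def)

text \<open>A point is determined by the basic open sets that contain it. These bits bring an
  arbitrary target space into the form \<open>nat \<Rightarrow> bool\<close> of the category
  lemmas.\<close>

lemma countable_base_code:
  assumes T: "second_countable T" "Hausdorff_space T"
  obtains c :: "'a \<Rightarrow> nat \<Rightarrow> bool" where "\<And>i. {y \<in> topspace T. c y i} \<in> sets (borel_of T)"
    "inj_on c (topspace T)"
proof -
  obtain B where B: "countable B" "\<And>V. V \<in> B \<Longrightarrow> openin T V"
    "\<And>U x. openin T U \<Longrightarrow> x \<in> U \<Longrightarrow> \<exists>V\<in>B. x \<in> V \<and> V \<subseteq> U"
    using T(1) unfolding second_countable_def by metis
  define W where "W = from_nat_into (insert {} B)"
  have rW: "range W = insert {} B" unfolding W_def using B(1) by (intro range_from_nat_into) auto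
  have oW: "openin T (W i)" for i
  proof -
    have "W i \<in> insert {} B" using rW by blast
    then show ?thesis using B(2) by auto
  qed
  show ?thesis
  proof (rule that[of "\<lambda>y i. y \<in> W i"])
    show "{y \<in> topspace T. y \<in> W i} \<in> sets (borel_of T)" for i
    proof -
      have "{y \<in> topspace T. y \<in> W i} = W i" using openin_subset[OF oW] by blast
      then show ?thesis using openin_borel_of[OF oW] by simp
    qed
    show "inj_on (\<lambda>y i. y \<in> W i) (topspace T)"
    proof (rule inj_onI, rule ccontr)
      fix x y assume xy: "x \<in> topspace T" "y \<in> topspace T" "(\<lambda>i. x \<in> W i) = (\<lambda>i. y \<in> W i)" "x \<noteq> y"
      then obtain U V where UV: "openin T U" "openin T V" "x \<in> U" "y \<in> V" "disjnt U V"
        using T(2) unfolding Hausdorff_space_def by metis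
      obtain S where S: "S \<in> B" "x \<in> S" "S \<subseteq> U" using B(3)[OF UV(1,3)] by blast
      then have "S \<in> range W" using rW by simp
      then obtain i where "S = W i" by blast
      then have "y \<in> S" using fun_cong[OF xy(3), of i] S(2) by simp
      then show False using S(3) UV(4,5) by (auto simp: disjnt_def)
    qed
  qed
qed

text \<open>Both matchings move a number by at most 1, and truncation at \<open>N\<close> does not
  increase distances. This is the closeness that a single diffeomorphism can realize.\<close>

lemma act_close:
  assumes "\<sigma> \<in> {swap_even, swap_odd}"
  shows "\<bar>real (min (act \<sigma> q x n) N) - real (min (x n) N)\<bar> \<le> 1"
proof -
  have "\<sigma> k \<le> k + 1 \<and> k \<le> \<sigma> k + 1" for k
    using assms by (auto simp: swap_even_def swap_odd_def)
  then have "act \<sigma> q x n \<le> x n + 1 \<and> x n \<le> act \<sigma> q x n + 1" by (simp add: act_def)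
  then show ?thesis by (auto simp: min_def abs_if)
qed

theorem corollary1p7:
  fixes M :: "'a topology"
    and A :: "('a, 'e::euclidean_space) chart set"
    and r :: enat
  assumes "smooth_atlas M A"
    and "topspace M \<noteq> {}"
    and "compact_space M"
    and "Hausdorff_space M"
    and "connected_space M"
    and "DIM('e) \<ge> 1"
    and "1 \<le> r"
  shows "\<exists>(S :: real measure) \<alpha>.
    standard_borel S \<and>
    borel_action (Diff_group r M A) (Diff_topology r M A) S \<alpha> \<and>
    \<not> essentially_countable S (orbit_relation (Diff_group r M A) (space S) \<alpha>)"
proof -
  interpret smooth_manifold M A by unfold_locales (rule assms)
  obtain S :: "real measure" and h \<alpha> where S: "standard_borel S"
    "h \<in> measurable (borel_of (product_topology (\<lambda>_::nat. M) UNIV)) S"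
    "borel_action (Diff_group r M A) (Diff_topology r M A) S \<alpha>"
    "\<And>z z' :: nat \<Rightarrow> 'a. (\<And>n. z n \<in> topspace M) \<Longrightarrow> (\<And>n. z' n \<in> topspace M) \<Longrightarrow>
      (h z, h z') \<in> orbit_relation (Diff_group r M A) (space S) \<alpha> \<longleftrightarrow>
      (\<exists>g\<in>Diffeo r M A. \<forall>n. g (z n) = z' n)"
    by (rule seq_action[where r = r, OF assms(3,4)]) (rule that, assumption, assumption, assumption, blast)
  obtain U \<phi> x0 where c: "(U, \<phi>) \<in> A" "x0 \<in> U" using assms(2) chart_at by (metis ex_in_conv)
  define p where "p = \<phi> x0"
  have p: "p \<in> \<phi> ` U" using c(2) by (simp add: p_def)
  obtain \<rho> where \<rho>: "\<rho> > 0" "cball p \<rho> \<subseteq> \<phi> ` U"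
    using chart_open_image[OF c(1)] p by (meson open_contains_cball)
  \<comment> \<open>Half of the radius, because the displacements from \<open>small_shifts\<close>
    live in the ball of radius \<open>2 * R\<close>.\<close>
  define R where "R = \<rho> / 2"
  have R: "R > 0" "cball p (2 * R) \<subseteq> \<phi> ` U" using \<rho> by (simp_all add: R_def)
  obtain e :: 'e where e: "e \<in> Basis" using nonempty_Basis by blast
  obtain N where N: "\<forall>n. N n > 0" "\<forall>s. (\<forall>n. \<bar>s n\<bar> \<le> 1) \<longrightarrow>
    (\<exists>u :: 'e \<Rightarrow> real. (\<forall>k. Ck_on k UNIV u) \<and>
      (\<forall>x. dist x p \<ge> 2 * R \<longrightarrow> u x = 0) \<and>
      (\<forall>x v. \<bar>frechet_derivative u (at x) v\<bar> \<le> norm v / 2) \<and>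
      (\<forall>n t. R / 4 ^ n \<le> t \<and> t \<le> 5 / 4 * (R / 4 ^ n) \<longrightarrow>
         u (p + t *\<^sub>R e) = s n * (R / 4 ^ n / (4 * real (N n)))))"
    using small_shifts[OF e R(1), of p] by (elim exE conjE)
  note N = N[rule_format]
  \<comment> \<open>Truncation turns every natural number into an admissible subdivision point, so
    the swaps need no boundary condition at \<open>N n\<close>.\<close>
  define m where "m z n = real (min (z n) (N n))" for z :: baire and n
  define t where "t z n = R / 4 ^ n + m z n * (R / 4 ^ n / (4 * real (N n)))" for z n
  have t: "R / 4 ^ n \<le> t z n" "t z n \<le> 5 / 4 * (R / 4 ^ n)" for z n
  proof -
    have "m z n * (R / 4 ^ n / (4 * real (N n))) \<le> real (N n) * (R / 4 ^ n / (4 * real (N n)))"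
      using R(1) by (intro mult_right_mono) (auto simp: m_def)
    then show "R / 4 ^ n \<le> t z n" "t z n \<le> 5 / 4 * (R / 4 ^ n)"
      using R(1) N(1)[of n] by (simp_all add: t_def m_def)
  qed
  have t_pos: "t z n > 0" for z n
  proof -
    have "0 < R / 4 ^ n" using R(1) by simp
    then show ?thesis using t(1)[where z = z and n = n] by linarith
  qed
  have t_lim: "t z \<longlonglongrightarrow> 0" for z
  proof (rule tendsto_sandwich[where f = "\<lambda>_. 0" and h = "\<lambda>n. 5 / 4 * (R / 4 ^ n)"])
    have "(\<lambda>n. 5 / 4 * (R / 4 ^ n)) \<longlonglongrightarrow> 5 / 4 * 0"
      by (intro tendsto_mult tendsto_const LIMSEQ_divide_realpow_zero) simp
    then show "(\<lambda>n. 5 / 4 * (R / 4 ^ n)) \<longlonglongrightarrow> 0" by simp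
    show "\<forall>\<^sub>F n in sequentially. 0 \<le> t z n" by (intro always_eventually allI less_imp_le t_pos)
    show "\<forall>\<^sub>F n in sequentially. t z n \<le> 5 / 4 * (R / 4 ^ n)" by (intro always_eventually allI t(2))
  qed simp
  have t_in: "p + t z n *\<^sub>R e \<in> \<phi> ` U" for z n
  proof -
    have "R / 4 ^ n \<le> R" using R(1) by (simp add: divide_le_eq mult_le_cancel_left1)
    then have "t z n \<le> 2 * R" using t(2)[of z n] R(1) by linarith
    then have "p + t z n *\<^sub>R e \<in> cball p (2 * R)"
      using t_pos[of z n] e by (simp add: dist_norm)
    then show ?thesis using R(2) by blast
  qed
  define pt where "pt z n = inv_into U \<phi> (p + t z n *\<^sub>R e)" for z n
  have ptM: "pt z n \<in> topspace M" for z n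
    using chart_inv(3)[OF c(1) t_in] chart_subset[OF c(1)] by (auto simp: pt_def)
  \<comment> \<open>The factor prescribed on the n-th segment is the difference of the two choices
    counted in steps; the closeness hypothesis puts it in [-1, 1], as \<open>small_shifts\<close>
    requires.\<close>
  have near: "\<exists>g\<in>Diffeo r M A. \<forall>n. g (pt z n) = pt z' n" if close: "\<And>n. \<bar>m z' n - m z n\<bar> \<le> 1" for z z'
  proof -
    obtain u :: "'e \<Rightarrow> real" where u: "\<And>k. Ck_on k UNIV u" "\<And>x. dist x p \<ge> 2 * R \<Longrightarrow> u x = 0"
      "\<And>x v. \<bar>frechet_derivative u (at x) v\<bar> \<le> norm v / 2"
      "\<And>n t. R / 4 ^ n \<le> t \<Longrightarrow> t \<le> 5 / 4 * (R / 4 ^ n) \<Longrightarrow>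
         u (p + t *\<^sub>R e) = (m z' n - m z n) * (R / 4 ^ n / (4 * real (N n)))"
      using N(2)[of "\<lambda>n. m z' n - m z n", OF close] by blast
    define G where "G x = x + u x *\<^sub>R e" for x
    obtain Gi where G: "\<And>k. Ck_on k UNIV G" "\<And>k. Ck_on k UNIV Gi" "\<And>x. Gi (G x) = x" "\<And>x. G (Gi x) = x"
      using perturbation_diffeo[OF u(1) norm_Basis[OF e] u(3)] unfolding G_def[abs_def] by blast
    have "lift U \<phi> G \<in> Diffeo r M A"
    proof (rule lift_Diffeo[OF assms(4) c(1) compact_cball R(2) G])
      show "G x = x" if "x \<notin> cball p (2 * R)" for x
        using that u(2)[of x] by (simp add: G_def dist_commute)
    qed
    moreover have "lift U \<phi> G (pt z n) = pt z' n" for n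
    proof -
      have "G (p + t z n *\<^sub>R e) = p + t z' n *\<^sub>R e"
      proof -
        have "t z' n = t z n + (m z' n - m z n) * (R / 4 ^ n / (4 * real (N n)))"
          unfolding t_def left_diff_distrib by simp
        then show ?thesis by (simp only: G_def u(4)[OF t] scaleR_add_left add.assoc)
      qed
      then show ?thesis
        using ptM chart_inv(2,3)[OF c(1) t_in] by (simp add: lift_def pt_def)
    qed
    ultimately show ?thesis by blast
  qed
  have cont: "continuous_map euclidean (product_topology (\<lambda>_. M) UNIV) pt"
    unfolding continuous_map_componentwise_UNIV
  proof
    fix n
    define w where "w k = inv_into U \<phi> (p + (R / 4 ^ n + real (min k (N n)) * (R / 4 ^ n / (4 * real (N n)))) *\<^sub>R e)" for k
    have ptw: "pt z n = w (z n)" for z by (simp add: pt_def t_def m_def w_def)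
    have "w k \<in> topspace M" for k using ptM[of "\<lambda>_. k" n] by (simp add: ptw)
    then have "continuous_map euclidean M w"
      by (simp add: continuous_map_def open_discrete)
    moreover have "continuous_map euclidean euclidean (\<lambda>z::baire. z n)"
      by (simp add: continuous_on_product_coordinates)
    ultimately have "continuous_map euclidean M (w \<circ> (\<lambda>z::baire. z n))"
      using continuous_map_compose by blast
    then show "continuous_map euclidean M (\<lambda>z. pt z n)" by (simp add: ptw comp_def)
  qed
  let ?E = "orbit_relation (Diff_group r M A) (space S) \<alpha>"
  have "\<not> essentially_countable S ?E"
  proof
    assume "essentially_countable S ?E"
    then obtain Y :: "real measure" and F f where Y: "standard_borel Y" "countable_borel_equiv Y F"
      "borel_reduction S ?E Y F f"
      unfolding essentially_countable_def by blast
    \<comment> \<open>\<open>T\<close> is a Polish topology on a set of reals that may differ from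
      the usual one; the bits are read off a base of \<open>T\<close>.\<close>
    obtain T where T: "completely_metrizable_space T" "second_countable T"
      "space Y = topspace T" "sets Y = sets (borel_of T)"
      using Y(1) unfolding standard_borel_def by blast
    have hT: "Hausdorff_space T"
      using T(1) completely_metrizable_imp_metrizable_space metrizable_imp_Hausdorff_space by blast
    obtain code :: "real \<Rightarrow> nat \<Rightarrow> bool" where code: "\<And>i. {y \<in> topspace T. code y i} \<in> sets (borel_of T)" "inj_on code (topspace T)"
      by (rule countable_base_code[OF T(2) hT]) (rule that; blast)
    have fS: "f \<in> measurable S Y"
      and fred: "\<And>x x'. x \<in> space S \<Longrightarrow> x' \<in> space S \<Longrightarrow> (x, x') \<in> ?E \<longleftrightarrow> (f x, f x') \<in> F"
      using Y(3) unfolding borel_reduction_def by blast+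
    have eqF: "equiv (space Y) F" and cF: "\<And>y. y \<in> space Y \<Longrightarrow> countable (F `` {y})"
      using Y(2) unfolding countable_borel_equiv_def by blast+
    define q where "q z = f (h (pt z))" for z
    have ptm: "pt \<in> measurable borel (borel_of (product_topology (\<lambda>_. M) UNIV))"
      using continuous_map_measurable[OF cont] by (simp add: borel_of_euclidean)
    have hpt: "h (pt z) \<in> space S" for z
      using measurable_space[OF measurable_compose[OF ptm S(2)], of z] by simp
    have qm: "q \<in> measurable borel Y"
      unfolding q_def using measurable_compose[OF measurable_compose[OF ptm S(2)] fS] .
    have qY: "q z \<in> space Y" for z using measurable_space[OF qm, of z] by simp
    have qF: "(q z, q z') \<in> F \<longleftrightarrow> (\<exists>g\<in>Diffeo r M A. \<forall>n. g (pt z n) = pt z' n)" for z z'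
      using fred[OF hpt[of z] hpt[of z']] S(4)[of "pt z" "pt z'", OF ptM ptM] unfolding q_def by blast
    obtain z z' where zz: "code (q z) = code (q z')" "\<And>n. even n \<Longrightarrow> z n = z' n"
      "infinite {n. odd n \<and> z n = 0 \<and> z' n = N n}"
    proof (rule countable_image_gap[of "\<lambda>z. code (q z)" N])
      show "{z. code (q z) i} \<in> sets borel" for i
      proof -
        have "{z. code (q z) i} = q -` {y \<in> topspace T. code y i} \<inter> space borel"
          using qY T(3) by auto
        then show ?thesis using measurable_sets[OF qm code(1)[of i, folded T(4)]] by (simp only:)
      qed
      fix \<sigma> x assume \<sigma>: "\<sigma> \<in> {swap_even, swap_odd}"
      \<comment> \<open>All moves of one family keep \<open>q\<close> within a single class of
        \<open>F\<close>, which is countable.\<close>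
      have "range (\<lambda>v. code (q (act \<sigma> v x))) \<subseteq> code ` (F `` {q x})"
      proof clarify
        fix v
        have "(q x, q (act \<sigma> v x)) \<in> F"
          unfolding qF by (rule near) (simp add: m_def act_close[OF \<sigma>])
        then show "code (q (act \<sigma> v x)) \<in> code ` (F `` {q x})" by blast
      qed
      then show "countable (range (\<lambda>v. code (q (act \<sigma> v x))))"
        using cF[OF qY] countable_subset by blast
    qed blast
    have "q z = q z'" using zz(1) code(2) qY T(3) by (auto simp: inj_on_def)
    then have "(q z, q z') \<in> F" using eqF qY[of z'] by (auto simp: equiv_def refl_on_def)
    then obtain g where g: "g \<in> Diffeo r M A" "\<And>n. g (pt z n) = pt z' n" using qF by blast
    have "(\<lambda>n. t z' n / t z n) \<longlonglongrightarrow> 1"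
    proof (rule Diffeo_ray[OF assms(4) g(1) assms(7) c(1) p norm_Basis[OF e] t_pos t_lim t_in t_lim t_in])
      show "g (inv_into U \<phi> (p + t z n *\<^sub>R e)) = inv_into U \<phi> (p + t z' n *\<^sub>R e)" for n
        using g(2) by (simp add: pt_def)
      \<comment> \<open>The untouched even coordinates provide the ratios equal to 1 that pin down
        the derivative.\<close>
      have "infinite {n::nat. even n}"
        unfolding infinite_nat_iff_unbounded_le by (metis dvd_triv_left le_add2 mem_Collect_eq mult_2)
      then show "infinite {n. t z n = t z' n}"
        by (rule infinite_super[rotated]) (auto simp: t_def m_def zz(2))
    qed
    then have "\<forall>\<^sub>F n in sequentially. t z' n / t z n < 5 / 4"
      by (rule order_tendstoD) simp
    then obtain k where k: "\<And>n. n \<ge> k \<Longrightarrow> t z' n / t z n < 5 / 4"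
      by (auto simp: eventually_sequentially)
    obtain n where "n \<ge> k" "z n = 0" "z' n = N n"
      using zz(3) unfolding infinite_nat_iff_unbounded_le by auto
    \<comment> \<open>These are the near and the far end of the n-th segment: their ratio is exactly
      5 / 4 for arbitrarily large n, against the limit 1.\<close>
    then have "t z n = R / 4 ^ n" "t z' n = 5 / 4 * (R / 4 ^ n)"
      using N(1)[of n] by (simp_all add: t_def m_def field_simps)
    then have "t z' n / t z n = 5 / 4" using R(1) by simp
    then show False using k[OF \<open>n \<ge> k\<close>] by simp
  qed
  then show ?thesis using S(1,3) by blast
qed

end
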